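(* Let $y\in C([0,T];\mathbb{R}^p)$ and let $\mathbf{d}(\tau)=(d_1(\tau),d_2(\tau-\cdot,\tau))\in M^2_\tau$. Let $\hat\xi\in\mathbb{R}^d$ and $\tilde\xi\in H^1(0,T;\mathbb{R}^d)$ satisfy $\tilde\xi(0)=\hat\xi$, and for $\tau\in(0,T)$ identify $\Xi=(\hat\xi,\tilde\xi)$ with the element $(\hat\xi,\tilde\xi|_{(0,\tau)})$ of $\mathrm{Dom}\,\mathcal{A}_\tau\subset M^2_\tau$. Then for $\tau\in(0,T)$ $$\frac{d}{d\tau}\langle\mathbf{d}(\tau),\Xi\rangle=-\big\langle\mathbf{d}(\tau),\big(\mathcal{A}_\tau-\mathcal{B}_\tau\mathcal{B}_\tau^*\mathcal{P}(\tau)\big)\Xi\big\rangle+\langle y(\tau),\mathcal{C}_\tau\Xi\rangle,$$ and $\mathbf{d}(T)=0$.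
   Context: Fix $T>0$, constant real matrices $A\in\mathbb{R}^{d\times d}$, $B\in\mathbb{R}^{d\times m}$, $C\in\mathbb{R}^{p\times d}$, and a continuous function $N:[0,T]\to\mathbb{R}^{d\times d}$. A star denotes transpose/adjoint. For $\tau\in(0,T]$ let $M^2_\tau=\mathbb{R}^d\times L^2(0,\tau;\mathbb{R}^d)$ with its natural inner product. Definition of the coefficients. For $\tau\in(0,T)$, $(\hat\xi,\tilde\xi)\in M^2_\tau$ and $u\in L^2(\tau,T;\mathbb{R}^m)$ let $w$ solve on $[\tau,T]$ $$w'(t)=Aw(t)+\int_\tau^tN(t-s)w(s)\,ds+Bu(t)+\int_0^\tau N(t-s)\tilde\xi(s)\,ds,\qquad w(\tau)=\hat\xi,$$ and let $W_\tau(\hat\xi,\tilde\xi)=\min_{u}\int_\tau^T\big[\|Cw(t)-y(t)\|^2+\|u(t)\|^2\big]\,dt$. The functions $P_0(\tau)$, $P_1(s,\tau)$, $P_2(s,\nu,\tau)$ (with values in $\mathbb{R}^{d\times d}$, independent of $y$), $d_1(\tau)$, $d_2(s,\tau)$ (with values in $\mathbb{R}^d$) and $M(\tau)$ (real valued), defined for $0\le s,\nu\le\tau\le T$, are the continuous functions with $P_0(\tau)=P_0^*(\tau)$, $P_2(s,\nu,\tau)=P_2^*(\nu,s,\tau)$ such that $$W_\tau(\hat\xi,\tilde\xi)=\langle\hat\xi,P_0(\tau)\hat\xi\rangle+2\Big\langle\hat\xi,\int_0^\tau P_1(s,\tau)\tilde\xi(s)\,ds\Big\rangle+\int_0^\tau\!\!\int_0^\tau\langle\tilde\xi(s),P_2(s,\nu,\tau)\tilde\xi(\nu)\rangle\,d\nu\,ds+2\langle\hat\xi,d_1(\tau)\rangle+2\int_0^\tau\langle\tilde\xi(s),d_2(s,\tau)\rangle\,ds+M(\tau)$$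 for every $\tau\in(0,T)$ and $(\hat\xi,\tilde\xi)\in M^2_\tau$. Operators. For $\tau\in(0,T]$ put $\mathcal{P}_1(\tau):L^2(0,\tau;\mathbb{R}^d)\to\mathbb{R}^d$, $\mathcal{P}_1(\tau)\tilde\xi=\int_0^\tau P_1(\tau-s,\tau)\tilde\xi(s)\,ds$, and $\mathcal{P}_2(\tau):L^2(0,\tau;\mathbb{R}^d)\to L^2(0,\tau;\mathbb{R}^d)$, $(\mathcal{P}_2(\tau)\tilde\xi)(s)=\int_0^\tau P_2(\tau-s,\tau-\nu,\tau)\tilde\xi(\nu)\,d\nu$. The Riccati operator on $M^2_\tau$ is $$\mathcal{P}(\tau)=\begin{bmatrix}P_0(\tau)&\mathcal{P}_1(\tau)\\ \mathcal{P}_1^*(\tau)&\mathcal{P}_2(\tau)\end{bmatrix}.$$ The state operator $\mathcal{A}_\tau$ on $M^2_\tau$ has domain $\mathrm{Dom}\,\mathcal{A}_\tau=\{(\hat\xi,\tilde\xi)\in M^2_\tau:\ \tilde\xi\in H^1(0,\tau;\mathbb{R}^d),\ \tilde\xi(0)=\hat\xi\}$ and $$\mathcal{A}_\tau(\hat\xi,\tilde\xi)=\Big(A\hat\xi+\int_0^\tau N(s)\tilde\xi(s)\,ds,\ -\tilde\xi'\Big).$$ The input operator $\mathcal{B}_\tau:\mathbb{R}^m\to M^2_\tau$ is $\mathcal{B}_\tau u=(Bu,0)$ and the output operator $\mathcal{C}_\tau:M^2_\tau\to\mathbb{R}^p$ is $\mathcal{C}_\tau(\hat\xi,\tilde\xi)=C\hat\xi$.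 *)

theory Defs
  imports "HOL-Analysis.Analysis"
begin

section \<open>Function spaces on an interval\<close>

text \<open>
  Elements of the Lebesgue space are represented by functions on the whole line of which only the
  values on the interval matter; two representatives that agree almost everywhere there are the
  same element.
\<close>

definition L2 :: "real \<Rightarrow> real \<Rightarrow> (real \<Rightarrow> 'a::euclidean_space) set" where
  "L2 a b = {f. set_borel_measurable lborel {a..b} f \<and>
                set_integrable lborel {a..b} (\<lambda>t. (norm (f t))\<^sup>2)}"

definition L2_inner :: "real \<Rightarrow> real \<Rightarrow> (real \<Rightarrow> 'a::euclidean_space) \<Rightarrow> (real \<Rightarrow> 'a) \<Rightarrow> real" where
  "L2_inner a b f g = (LBINT t:{a..b}. f t \<bullet> g t)"

text \<open>
  In one dimension the Sobolev space \<open>H\<^sup>1(a,b)\<close> consists of the primitives of square integrable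
  functions.  A member of \<^term>\<open>H1 a b\<close> below is the absolutely continuous representative, so that
  its value at an end point is the trace.
\<close>

definition H1_deriv ::
  "real \<Rightarrow> real \<Rightarrow> (real \<Rightarrow> 'a::euclidean_space) \<Rightarrow> (real \<Rightarrow> 'a) \<Rightarrow> bool" where
  "H1_deriv a b f g \<longleftrightarrow> g \<in> L2 a b \<and> (\<forall>t\<in>{a..b}. f t = f a + (LBINT s:{a..t}. g s))"

definition H1 :: "real \<Rightarrow> real \<Rightarrow> (real \<Rightarrow> 'a::euclidean_space) set" where
  "H1 a b = {f. \<exists>g. H1_deriv a b f g}"

text \<open>The derivative is determined up to a null set only; any choice represents it.\<close>

definition weak_deriv ::
  "real \<Rightarrow> real \<Rightarrow> (real \<Rightarrow> 'a::euclidean_space) \<Rightarrow> real \<Rightarrow> 'a" where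
  "weak_deriv a b f = (SOME g. H1_deriv a b f g)"

text \<open>
  The adjoint of \<open>F\<close>, an operator from the Hilbert space with carrier \<open>X\<close> and inner product \<open>ip\<close>
  to the Hilbert space with inner product \<open>ip'\<close>.  It is unique as an element of \<open>X\<close>, that is,
  up to null sets if \<open>X\<close> consists of representatives.
\<close>

definition hilbert_adjoint ::
  "'x set \<Rightarrow> ('x \<Rightarrow> 'x \<Rightarrow> real) \<Rightarrow> ('y \<Rightarrow> 'y \<Rightarrow> real) \<Rightarrow> ('x \<Rightarrow> 'y) \<Rightarrow> 'y \<Rightarrow> 'x" where
  "hilbert_adjoint X ip ip' F y = (SOME x. x \<in> X \<and> (\<forall>z\<in>X. ip z x = ip' (F z) y))"


section \<open>The state space\<close>

type_synonym 'd state = "(real^'d) \<times> (real \<Rightarrow> real^'d)"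

definition M2 :: "real \<Rightarrow> ('d::finite) state set" where
  "M2 \<tau> = {\<xi>. snd \<xi> \<in> L2 0 \<tau>}"

definition M2_inner :: "real \<Rightarrow> ('d::finite) state \<Rightarrow> 'd state \<Rightarrow> real" where
  "M2_inner \<tau> \<xi> \<eta> = fst \<xi> \<bullet> fst \<eta> + L2_inner 0 \<tau> (snd \<xi>) (snd \<eta>)"

definition M2_is_zero :: "real \<Rightarrow> ('d::finite) state \<Rightarrow> bool" where
  "M2_is_zero \<tau> \<xi> \<longleftrightarrow> fst \<xi> = 0 \<and> (AE s\<in>{0..\<tau>} in lborel. snd \<xi> s = 0)"


section \<open>The tracking problem and the coefficients of its value function\<close>

text \<open>
  Solutions are Caratheodory solutions, as the control is only square integrable.  In the initial
  datum \<open>\<xi>\<close> at time \<open>\<tau>\<close> the second component is the past trajectory in its original time.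
\<close>

definition is_solution ::
  "real \<Rightarrow> real^'d^'d \<Rightarrow> real^'m^'d \<Rightarrow> (real \<Rightarrow> real^'d^'d) \<Rightarrow> real \<Rightarrow> ('d::finite) state \<Rightarrow>
   (real \<Rightarrow> real^'m::finite) \<Rightarrow> (real \<Rightarrow> real^'d) \<Rightarrow> bool" where
  "is_solution T A B N \<tau> \<xi> u w \<longleftrightarrow>
     w \<tau> = fst \<xi> \<and>
     (\<exists>w'. H1_deriv \<tau> T w w' \<and>
       (AE t\<in>{\<tau>..T} in lborel.
          w' t = A *v w t + (LBINT s:{\<tau>..t}. N (t - s) *v w s) + B *v u t
                 + (LBINT s:{0..\<tau>}. N (t - s) *v snd \<xi> s)))"

definition cost ::
  "real \<Rightarrow> real^'d^'p \<Rightarrow> (real \<Rightarrow> real^'p) \<Rightarrow> real \<Rightarrow>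
   (real \<Rightarrow> real^'m::finite) \<Rightarrow> (real \<Rightarrow> real^'d::finite) \<Rightarrow> real" where
  "cost T C y \<tau> u w = (LBINT t:{\<tau>..T}. (norm (C *v w t - y t))\<^sup>2 + (norm (u t))\<^sup>2)"

text \<open>
  The value is the minimum of the cost (see \<open>optimal_value_eq\<close> below); as a function it is
  written as the infimum.
\<close>

definition optimal_value ::
  "real \<Rightarrow> real^'d^'d \<Rightarrow> real^'m^'d \<Rightarrow> real^'d^'p \<Rightarrow> (real \<Rightarrow> real^'d^'d) \<Rightarrow> (real \<Rightarrow> real^'p) \<Rightarrow>
   real \<Rightarrow> ('d::finite) state \<Rightarrow> real" where
  "optimal_value T A (B :: real^'m::finite^'d) C N y \<tau> \<xi> =
     Inf {cost T C y \<tau> u w | (u :: real \<Rightarrow> real^'m) w. u \<in> L2 \<tau> T \<and> is_solution T A B N \<tau> \<xi> u w}"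

lemma optimal_value_eq:
  fixes B :: "real^'m::finite^'d::finite"
  assumes "u \<in> L2 \<tau> T" "is_solution T A B N \<tau> \<xi> u w"
    and "\<And>v x. v \<in> L2 \<tau> T \<Longrightarrow> is_solution T A B N \<tau> \<xi> v x \<Longrightarrow> cost T C y \<tau> u w \<le> cost T C y \<tau> v x"
  shows "optimal_value T A B C N y \<tau> \<xi> = cost T C y \<tau> u w"
  unfolding optimal_value_def
proof (rule cInf_eq_minimum)
  show "cost T C y \<tau> u w \<in>
    {cost T C y \<tau> u w | (u :: real \<Rightarrow> real^'m) w. u \<in> L2 \<tau> T \<and> is_solution T A B N \<tau> \<xi> u w}"
    using assms(1,2) by (intro CollectI exI conjI) (rule refl)
qed (elim CollectE exE conjE, simp only: assms(3))

definition value_coefficients ::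
  "real \<Rightarrow> real^'d^'d \<Rightarrow> real^'m^'d \<Rightarrow> real^'d^'p \<Rightarrow> (real \<Rightarrow> real^'d^'d) \<Rightarrow> (real \<Rightarrow> real^'p) \<Rightarrow>
   (real \<Rightarrow> real^'d^'d) \<Rightarrow> (real \<Rightarrow> real \<Rightarrow> real^'d^'d) \<Rightarrow> (real \<Rightarrow> real \<Rightarrow> real \<Rightarrow> real^'d^'d) \<Rightarrow>
   (real \<Rightarrow> real^'d) \<Rightarrow> (real \<Rightarrow> real \<Rightarrow> real^'d::finite) \<Rightarrow> (real \<Rightarrow> real) \<Rightarrow> bool" where
  "value_coefficients T A (B :: real^'m::finite^'d) C N y P0 P1 P2 d1 d2 M \<longleftrightarrow>
     continuous_on {0..T} P0 \<and>
     continuous_on {(s, \<tau>). 0 \<le> s \<and> s \<le> \<tau> \<and> \<tau> \<le> T} (\<lambda>(s, \<tau>). P1 s \<tau>) \<and>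
     continuous_on {(s, \<nu>, \<tau>). 0 \<le> s \<and> s \<le> \<tau> \<and> 0 \<le> \<nu> \<and> \<nu> \<le> \<tau> \<and> \<tau> \<le> T} (\<lambda>(s, \<nu>, \<tau>). P2 s \<nu> \<tau>) \<and>
     continuous_on {0..T} d1 \<and>
     continuous_on {(s, \<tau>). 0 \<le> s \<and> s \<le> \<tau> \<and> \<tau> \<le> T} (\<lambda>(s, \<tau>). d2 s \<tau>) \<and>
     continuous_on {0..T} M \<and>
     (\<forall>\<tau>\<in>{0..T}. P0 \<tau> = transpose (P0 \<tau>)) \<and>
     (\<forall>\<tau>\<in>{0..T}. \<forall>s\<in>{0..\<tau>}. \<forall>\<nu>\<in>{0..\<tau>}. P2 s \<nu> \<tau> = transpose (P2 \<nu> s \<tau>)) \<and>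
     (\<forall>\<tau>\<in>{0<..<T}. \<forall>(\<xi>h, \<xi>t)\<in>M2 \<tau>.
        optimal_value T A B C N y \<tau> (\<xi>h, \<xi>t) =
          \<xi>h \<bullet> (P0 \<tau> *v \<xi>h)
          + 2 * (\<xi>h \<bullet> (LBINT s:{0..\<tau>}. P1 s \<tau> *v \<xi>t s))
          + (LBINT s:{0..\<tau>}. LBINT \<nu>:{0..\<tau>}. \<xi>t s \<bullet> (P2 s \<nu> \<tau> *v \<xi>t \<nu>))
          + 2 * (\<xi>h \<bullet> d1 \<tau>)
          + 2 * (LBINT s:{0..\<tau>}. \<xi>t s \<bullet> d2 s \<tau>)
          + M \<tau>)"


section \<open>The operators\<close>

text \<open>
  From here on the second component of a state is the past trajectory in reversed time, which is
  the source of the arguments \<open>\<tau> - s\<close>.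
\<close>

definition P1_op :: "(real \<Rightarrow> real \<Rightarrow> real^'d^'d) \<Rightarrow> real \<Rightarrow> (real \<Rightarrow> real^'d::finite) \<Rightarrow> real^'d" where
  "P1_op P1 \<tau> f = (LBINT s:{0..\<tau>}. P1 (\<tau> - s) \<tau> *v f s)"

definition P2_op ::
  "(real \<Rightarrow> real \<Rightarrow> real \<Rightarrow> real^'d^'d) \<Rightarrow> real \<Rightarrow> (real \<Rightarrow> real^'d::finite) \<Rightarrow> real \<Rightarrow> real^'d" where
  "P2_op P2 \<tau> f s = (LBINT \<nu>:{0..\<tau>}. P2 (\<tau> - s) (\<tau> - \<nu>) \<tau> *v f \<nu>)"

definition P1_op_adj :: "(real \<Rightarrow> real \<Rightarrow> real^'d^'d) \<Rightarrow> real \<Rightarrow> real^'d::finite \<Rightarrow> real \<Rightarrow> real^'d" where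
  "P1_op_adj P1 \<tau> = hilbert_adjoint (L2 0 \<tau>) (L2_inner 0 \<tau>) inner (P1_op P1 \<tau>)"

definition riccati_op ::
  "(real \<Rightarrow> real^'d^'d) \<Rightarrow> (real \<Rightarrow> real \<Rightarrow> real^'d^'d) \<Rightarrow> (real \<Rightarrow> real \<Rightarrow> real \<Rightarrow> real^'d^'d) \<Rightarrow>
   real \<Rightarrow> ('d::finite) state \<Rightarrow> 'd state" where
  "riccati_op P0 P1 P2 \<tau> \<xi> =
     (P0 \<tau> *v fst \<xi> + P1_op P1 \<tau> (snd \<xi>),
      \<lambda>s. P1_op_adj P1 \<tau> (fst \<xi>) s + P2_op P2 \<tau> (snd \<xi>) s)"

definition state_dom :: "real \<Rightarrow> ('d::finite) state set" where
  "state_dom \<tau> = {\<xi> \<in> M2 \<tau>. snd \<xi> \<in> H1 0 \<tau> \<and> snd \<xi> 0 = fst \<xi>}"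

definition state_op ::
  "real^'d^'d \<Rightarrow> (real \<Rightarrow> real^'d^'d) \<Rightarrow> real \<Rightarrow> ('d::finite) state \<Rightarrow> 'd state" where
  "state_op A N \<tau> \<xi> =
     (A *v fst \<xi> + (LBINT s:{0..\<tau>}. N s *v snd \<xi> s), \<lambda>s. - weak_deriv 0 \<tau> (snd \<xi>) s)"

definition input_op :: "real^'m^'d \<Rightarrow> real^'m::finite \<Rightarrow> ('d::finite) state" where
  "input_op B u = (B *v u, \<lambda>_. 0)"

definition input_op_adj :: "real^'m^'d \<Rightarrow> real \<Rightarrow> ('d::finite) state \<Rightarrow> real^'m::finite" where
  "input_op_adj B \<tau> = hilbert_adjoint UNIV inner (M2_inner \<tau>) (input_op B)"

definition output_op :: "real^'d^'p \<Rightarrow> ('d::finite) state \<Rightarrow> real^'p::finite" where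
  "output_op C \<xi> = C *v fst \<xi>"

definition d_state :: "(real \<Rightarrow> real^'d) \<Rightarrow> (real \<Rightarrow> real \<Rightarrow> real^'d) \<Rightarrow> real \<Rightarrow> ('d::finite) state" where
  "d_state d1 d2 \<tau> = (d1 \<tau>, \<lambda>s. d2 (\<tau> - s) \<tau>)"

lemma L2_imp_set_integrable:
  fixes g :: "real \<Rightarrow> 'a::euclidean_space"
  assumes "g \<in> L2 a b"
  shows "set_integrable lborel {a..b} g"
proof (rule set_integrable_bound)
  show "set_integrable lborel {a..b} (\<lambda>t. 1 + (norm (g t))\<^sup>2)"
    using assms
    by (intro set_integral_add(1) borel_integrable_atLeastAtMost'[of _ _ "\<lambda>_. 1"])
       (simp_all add: L2_def)
  show "set_borel_measurable lborel {a..b} g"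
    using assms by (simp add: L2_def)
  have "norm x \<le> norm (1 + (norm x)\<^sup>2)" for x :: 'a
    using zero_le_power2[of "norm x - 1 / 2"] by (simp add: power2_eq_square algebra_simps)
  then show "AE t\<in>{a..b} in lborel. norm (g t) \<le> norm (1 + (norm (g t))\<^sup>2)"
    by simp
qed

lemma H1_subinterval:
  assumes "f \<in> H1 a b" "c \<le> b"
  shows "f \<in> H1 a c"
proof -
  obtain g where g: "g \<in> L2 a b" "\<And>t. t \<in> {a..b} \<Longrightarrow> f t = f a + (LBINT s:{a..t}. g s)"
    using assms(1) by (auto simp only: H1_def H1_deriv_def mem_Collect_eq)
  have sub: "{a..c} \<subseteq> {a..b}"
    using assms(2) by auto
  have "set_borel_measurable lborel {a..c} g"
    using g(1) by (intro set_borel_measurable_subset[OF _ _ sub]) (simp_all add: L2_def)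
  moreover have "set_integrable lborel {a..c} (\<lambda>t. (norm (g t))\<^sup>2)"
    using g(1) by (intro set_integrable_subset[OF _ _ sub]) (simp_all add: L2_def)
  ultimately have "g \<in> L2 a c"
    by (simp add: L2_def)
  moreover have "\<forall>t\<in>{a..c}. f t = f a + (LBINT s:{a..t}. g s)"
    using g(2) sub by blast
  ultimately show ?thesis
    unfolding H1_def H1_deriv_def by blast
qed

lemma H1_imp_continuous_on:
  assumes "f \<in> H1 a b"
  shows "continuous_on {a..b} f"
proof -
  obtain g where g: "g \<in> L2 a b" "\<And>t. t \<in> {a..b} \<Longrightarrow> f t = f a + (LBINT s:{a..t}. g s)"
    using assms by (auto simp only: H1_def H1_deriv_def mem_Collect_eq)
  have int: "set_integrable lborel {a..b} g"
    by (rule L2_imp_set_integrable[OF g(1)])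
  have eq: "f t = f a + integral {a..t} g" if t: "t \<in> {a..b}" for t
  proof -
    have "set_integrable lborel {a..t} g"
      using t by (intro set_integrable_subset[OF int]) auto
    then show ?thesis
      using g(2)[OF t] set_borel_integral_eq_integral(2) by metis
  qed
  have "continuous_on {a..b} (\<lambda>t. f a + integral {a..t} g)"
    by (intro continuous_intros indefinite_integral_continuous_1
        set_borel_integral_eq_integral(1)[OF int])
  then show ?thesis
    by (rule continuous_on_eq) (rule eq[symmetric])
qed

lemma H1_subset_L2: "H1 a b \<subseteq> L2 a b"
proof
  fix f :: "real \<Rightarrow> 'a"
  assume "f \<in> H1 a b"
  then have cont: "continuous_on {a..b} f"
    by (rule H1_imp_continuous_on)
  have "set_borel_measurable lborel {a..b} f"
    using borel_integrable_atLeastAtMost'[OF cont]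
    unfolding set_integrable_def set_borel_measurable_def by (rule borel_measurable_integrable)
  moreover have "set_integrable lborel {a..b} (\<lambda>t. (norm (f t))\<^sup>2)"
    by (intro borel_integrable_atLeastAtMost' continuous_intros cont)
  ultimately show "f \<in> L2 a b"
    by (simp add: L2_def)
qed

text \<open>A member of \<open>H\<^sup>1(0,T)\<close> gives an element of the domain on every shorter interval.\<close>

lemma state_dom_restrict:
  assumes "\<xi>t \<in> H1 0 T" "\<xi>t 0 = \<xi>h" "\<tau> \<le> T"
  shows "(\<xi>h, \<xi>t) \<in> state_dom \<tau>"
  using H1_subinterval[OF assms(1,3)] H1_subset_L2 assms(2)
  by (auto simp only: state_dom_def M2_def mem_Collect_eq fst_conv snd_conv)

end

theory Submission
  imports Defs
begin

text \<open>
  Write the value function as \<open>V = q + 2 l + M\<close> with \<open>q\<close> quadratic and \<open>l\<close> linear in the state.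
  Splitting a minimizer into the minimizer \<open>(u, W)\<close> for the target \<open>y = 0\<close> and a part that does not
  depend on the initial state gives \<open>l = - \<integral> y \<bullet> C W\<close>.  Hence \<open>l\<close> changes along \<open>W\<close> by the integral
  of \<open>y \<bullet> C W\<close> over the time step, and the displacement of the state in the step involves only the
  mean of \<open>u\<close>.  Stationarity in the direction of a control that is constant on the step identifies this
  mean with the feedback \<open>- B\<^sup>* P\<close>, up to higher order.  This yields the right derivative of
  \<open>l\<close>; it is continuous in time, so it is the derivative.  Minimizers need not exist for this: it
  suffices that the first variation is small compared with the step length, which holds for pairs
  that are optimal up to a sufficiently small error because the cost is quadratic.
\<close>

section \<open>Preliminaries\<close>

lemma bounded_bilinear_matrix_vector_mult:
  "bounded_bilinear ((*v) :: real^'n::finite^'m::finite \<Rightarrow> real^'n \<Rightarrow> real^'m)"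
  unfolding bilinear_conv_bounded_bilinear[symmetric] bilinear_def
  by (auto intro!: linearI simp: matrix_vector_right_distrib matrix_vector_mult_add_rdistrib
      matrix_vector_mult_scaleR scaleR_matrix_vector_assoc)

lemmas continuous_on_matrix_vector_mult [continuous_intros] =
  bounded_bilinear.continuous_on[OF bounded_bilinear_matrix_vector_mult]

lemma bounded_on_interval:
  fixes f :: "real \<Rightarrow> 'a::real_normed_vector"
  assumes "continuous_on {a..b} f"
  obtains K where "K > 0" "\<And>t. t \<in> {a..b} \<Longrightarrow> norm (f t) \<le> K"
proof -
  have "bounded (f ` {a..b})"
    using assms by (intro compact_imp_bounded compact_continuous_image) auto
  then show thesis
    using that unfolding bounded_pos by auto
qed

lemma continuous_on_integral_moving:
  fixes f :: "real \<Rightarrow> real \<Rightarrow> 'a::euclidean_space"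
  assumes cont: "continuous_on {(r, s). 0 \<le> r \<and> r \<le> s \<and> s \<le> T} (\<lambda>(r, s). f r s)"
  shows "continuous_on {0..T} (\<lambda>s. integral {0..s} (\<lambda>r. f r s))"
proof (rule continuous_on_eq)
  have "continuous_on ({0..T} \<times> cbox 0 1) (\<lambda>(s, \<theta>). (\<lambda>(r, s). f r s) (s * \<theta>, s))"
    unfolding case_prod_beta
    by (rule continuous_on_compose2[OF cont[unfolded case_prod_beta]])
      (auto intro!: continuous_intros simp: mult_left_le)
  then have "continuous_on {0..T} (\<lambda>s. integral (cbox 0 1) (\<lambda>\<theta>. f (s * \<theta>) s))"
    by (intro integral_continuous_on_param) simp
  then show "continuous_on {0..T} (\<lambda>s. s *\<^sub>R integral {0..1} (\<lambda>\<theta>. f (s * \<theta>) s))"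
    by (intro continuous_intros) simp
next
  fix s assume s: "s \<in> {0..T}"
  show "s *\<^sub>R integral {0..1} (\<lambda>\<theta>. f (s * \<theta>) s) = integral {0..s} (\<lambda>r. f r s)"
  proof (cases "s = 0")
    case False
    have "continuous_on {0..s} (\<lambda>r. (\<lambda>(r, s). f r s) (r, s))"
      by (rule continuous_on_compose2[OF cont]) (use s in \<open>auto intro!: continuous_intros\<close>)
    then have "(\<lambda>r. f r s) integrable_on {0..s}"
      by (simp add: integrable_continuous_real)
    from has_integral_stretch_real[OF integrable_integral[OF this] False]
    have "((\<lambda>\<theta>. f (s * \<theta>) s) has_integral (1 / s) *\<^sub>R integral {0..s} (\<lambda>r. f r s)) ((\<lambda>x. x / s) ` {0..s})"
      using s by simp
    moreover have "(\<lambda>x. x / s) ` {0..s} = {0..1}"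
      using s False image_divide_atLeastAtMost[of s 0 s] by simp
    ultimately show ?thesis
      using False by (simp add: integral_unique)
  qed simp
qed

subsection \<open>Square integrable functions\<close>

lemma L2_integrable_on: "f \<in> L2 a b \<Longrightarrow> f integrable_on {a..b}"
  by (rule set_borel_integral_eq_integral(1)[OF L2_imp_set_integrable])

lemma continuous_on_imp_L2:
  fixes f :: "real \<Rightarrow> 'a::euclidean_space"
  assumes "continuous_on {a..b} f"
  shows "f \<in> L2 a b"
proof -
  have "set_borel_measurable lborel {a..b} f"
    using borel_integrable_atLeastAtMost'[OF assms]
    unfolding set_integrable_def set_borel_measurable_def by (rule borel_measurable_integrable)
  moreover have "set_integrable lborel {a..b} (\<lambda>t. (norm (f t))\<^sup>2)"
    by (intro borel_integrable_atLeastAtMost' continuous_intros assms)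
  ultimately show ?thesis
    by (simp add: L2_def)
qed

lemma L2_inner_set_integrable:
  fixes f g :: "real \<Rightarrow> 'a::euclidean_space"
  assumes "f \<in> L2 a b" "g \<in> L2 a b"
  shows "set_integrable lborel {a..b} (\<lambda>t. f t \<bullet> g t)"
proof (rule set_integrable_bound)
  show "set_integrable lborel {a..b} (\<lambda>t. (norm (f t))\<^sup>2 + (norm (g t))\<^sup>2)"
    using assms by (intro set_integral_add(1)) (simp_all add: L2_def)
  have "(\<lambda>t. (indicator {a..b} t *\<^sub>R f t) \<bullet> (indicator {a..b} t *\<^sub>R g t)) \<in> borel_measurable lborel"
    using assms by (intro borel_measurable_inner) (auto simp: L2_def set_borel_measurable_def)
  moreover have "(indicator {a..b} t *\<^sub>R f t) \<bullet> (indicator {a..b} t *\<^sub>R g t)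
      = indicator {a..b} t *\<^sub>R (f t \<bullet> g t)" for t
    by (auto simp: indicator_def)
  ultimately show "set_borel_measurable lborel {a..b} (\<lambda>t. f t \<bullet> g t)"
    unfolding set_borel_measurable_def by (simp only:)
  have "norm (x \<bullet> z) \<le> norm ((norm x)\<^sup>2 + (norm z)\<^sup>2)" for x z :: 'a
    using Cauchy_Schwarz_ineq2[of x z] zero_le_power2[of "norm x - norm z"]
      zero_le_power2[of "norm x"] zero_le_power2[of "norm z"]
    by (simp add: power2_diff)
  then show "AE t\<in>{a..b} in lborel. norm (f t \<bullet> g t) \<le> norm ((norm (f t))\<^sup>2 + (norm (g t))\<^sup>2)"
    by simp
qed

lemma L2_inner_integrable_on:
  "f \<in> L2 a b \<Longrightarrow> g \<in> L2 a b \<Longrightarrow> (\<lambda>t. f t \<bullet> g t) integrable_on {a..b}"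
  by (rule set_borel_integral_eq_integral(1)[OF L2_inner_set_integrable])

lemma L2_add_scaleR:
  fixes f g :: "real \<Rightarrow> 'a::euclidean_space"
  assumes f: "f \<in> L2 a b" and g: "g \<in> L2 a b"
  shows "(\<lambda>t. f t + c *\<^sub>R g t) \<in> L2 a b"
proof -
  have "(\<lambda>t. indicator {a..b} t *\<^sub>R f t) \<in> borel_measurable lborel"
    "(\<lambda>t. indicator {a..b} t *\<^sub>R g t) \<in> borel_measurable lborel"
    using assms by (simp_all only: L2_def set_borel_measurable_def mem_Collect_eq)
  then have "(\<lambda>t. indicator {a..b} t *\<^sub>R f t + c *\<^sub>R (indicator {a..b} t *\<^sub>R g t)) \<in> borel_measurable lborel"
    by (rule borel_measurable_add[OF _ borel_measurable_scaleR[OF borel_measurable_const]])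
  then have "set_borel_measurable lborel {a..b} (\<lambda>t. f t + c *\<^sub>R g t)"
    by (simp only: set_borel_measurable_def scaleR_add_right scaleR_left_commute)
  moreover have "set_integrable lborel {a..b} (\<lambda>t. (f t \<bullet> f t + c * c * (g t \<bullet> g t)) + 2 * c * (f t \<bullet> g t))"
    by (intro set_integral_add(1) set_integrable_mult_right L2_inner_set_integrable f g)
  then have "set_integrable lborel {a..b} (\<lambda>t. (norm (f t + c *\<^sub>R g t))\<^sup>2)"
    by (simp add: power2_norm_eq_inner inner_commute algebra_simps)
  ultimately show ?thesis
    by (simp add: L2_def)
qed

lemma L2_subinterval:
  fixes f :: "real \<Rightarrow> 'a::euclidean_space"
  assumes "f \<in> L2 a b" "{c..d} \<subseteq> {a..b}"
  shows "f \<in> L2 c d"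
proof -
  have "set_borel_measurable lborel {c..d} f"
    using assms by (intro set_borel_measurable_subset[OF _ _ assms(2)]) (simp_all add: L2_def)
  moreover have "set_integrable lborel {c..d} (\<lambda>t. (norm (f t))\<^sup>2)"
    using assms by (intro set_integrable_subset[OF _ _ assms(2)]) (simp_all add: L2_def)
  ultimately show ?thesis
    by (simp add: L2_def)
qed

lemma L2_matrix_vector_mult:
  fixes B :: "real^'m::finite^'d::finite"
  assumes "u \<in> L2 a b"
  shows "(\<lambda>t. B *v u t) \<in> L2 a b"
proof -
  obtain K where K: "\<And>x. norm (B *v x) \<le> norm x * K" "0 \<le> K"
    using bounded_linear.nonneg_bounded[OF matrix_vector_mul_bounded_linear] by blast
  have "(\<lambda>t. B *v (indicator {a..b} t *\<^sub>R u t)) \<in> borel_measurable lborel"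
    using assms by (intro borel_measurable_continuous_on[where f="(*v) B"]
        linear_continuous_on matrix_vector_mul_bounded_linear)
      (auto simp: L2_def set_borel_measurable_def)
  then have m: "set_borel_measurable lborel {a..b} (\<lambda>t. B *v u t)"
    by (simp add: set_borel_measurable_def matrix_vector_mult_scaleR)
  have "set_integrable lborel {a..b} (\<lambda>t. (norm (B *v u t))\<^sup>2)"
  proof (rule set_integrable_bound)
    show "set_integrable lborel {a..b} (\<lambda>t. K\<^sup>2 * (norm (u t))\<^sup>2)"
      using assms by (intro set_integrable_mult_right) (simp add: L2_def)
    have "(\<lambda>t. (norm (indicator {a..b} t *\<^sub>R (B *v u t)))\<^sup>2) \<in> borel_measurable lborel"
      using m unfolding set_borel_measurable_def
      by (intro borel_measurable_power measurable_compose[OF _ borel_measurable_norm])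
    moreover have "(norm (indicator {a..b} t *\<^sub>R (B *v u t)))\<^sup>2 = indicator {a..b} t *\<^sub>R (norm (B *v u t))\<^sup>2" for t
      by (auto simp: indicator_def)
    ultimately show "set_borel_measurable lborel {a..b} (\<lambda>t. (norm (B *v u t))\<^sup>2)"
      unfolding set_borel_measurable_def by (simp only:)
    have "norm ((norm (B *v x))\<^sup>2) \<le> norm (K\<^sup>2 * (norm x)\<^sup>2)" for x
      using power_mono[OF K(1)[of x], of 2] by (simp add: power_mult_distrib mult.commute)
    then show "AE t\<in>{a..b} in lborel. norm ((norm (B *v u t))\<^sup>2) \<le> norm (K\<^sup>2 * (norm (u t))\<^sup>2)"
      by simp
  qed
  with m show ?thesis
    by (simp add: L2_def)
qed

lemma L2_if_less:
  fixes v :: "real \<Rightarrow> 'a::euclidean_space"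
  assumes "v \<in> L2 \<sigma> T" "\<tau> \<le> \<sigma>"
  shows "(\<lambda>t. if t < \<sigma> then 0 else v t) \<in> L2 \<tau> T"
proof -
  have "indicator {\<tau>..T} t *\<^sub>R (if t < \<sigma> then 0 else v t) = indicator {\<sigma>..T} t *\<^sub>R v t"
    "indicator {\<tau>..T} t *\<^sub>R (norm (if t < \<sigma> then 0 else v t))\<^sup>2
      = indicator {\<sigma>..T} t *\<^sub>R (norm (v t))\<^sup>2" for t
    using assms(2) by (auto simp: indicator_def)
  then show ?thesis
    using assms(1) unfolding L2_def set_borel_measurable_def set_integrable_def mem_Collect_eq
    by (simp only: simp_thms)
qed

lemma continuous_on_indefinite_integral:
  fixes g :: "real \<Rightarrow> 'a::banach"
  assumes "g integrable_on {\<tau>..T}"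
  shows "continuous_on {..T} (\<lambda>t. integral {\<tau>..t} g)"
proof (cases "\<tau> \<le> T")
  case True
  have "continuous_on {..T} (\<lambda>t. integral {\<tau>..max \<tau> t} g)"
    by (rule continuous_on_compose2[OF indefinite_integral_continuous_1[OF assms]])
      (use True in \<open>auto intro!: continuous_intros\<close>)
  moreover have "integral {\<tau>..max \<tau> t} g = integral {\<tau>..t} g" for t
    by (cases "t < \<tau>") auto
  ultimately show ?thesis
    by simp
next
  case False
  then have "continuous_on {..T} (\<lambda>t. 0 :: 'a)" "\<And>t. t \<in> {..T} \<Longrightarrow> 0 = integral {\<tau>..t} g"
    by auto
  then show ?thesis
    by (rule continuous_on_eq)
qed

section \<open>Calculus\<close>

text \<open>
  Convergence along this filter on pairs \<open>(\<sigma>, s)\<close> is convergence as \<open>\<sigma> \<rightarrow> \<tau>+\<close>, uniformly in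
  \<open>s \<in> [\<tau>, \<sigma>]\<close>.
\<close>

definition wedge :: "real \<Rightarrow> (real \<times> real) filter"
  where "wedge \<tau> = Abs_filter (\<lambda>P. eventually (\<lambda>\<sigma>. \<forall>s\<in>{\<tau>..\<sigma>}. P (\<sigma>, s)) (at_right \<tau>))"

lemma eventually_wedge:
  "eventually P (wedge \<tau>) \<longleftrightarrow> eventually (\<lambda>\<sigma>. \<forall>s\<in>{\<tau>..\<sigma>}. P (\<sigma>, s)) (at_right \<tau>)"
  unfolding wedge_def
proof (rule eventually_Abs_filter, rule is_filter.intro)
  fix P Q :: "real \<times> real \<Rightarrow> bool"
  assume "\<forall>\<^sub>F \<sigma> in at_right \<tau>. \<forall>s\<in>{\<tau>..\<sigma>}. P (\<sigma>, s)" "\<forall>\<^sub>F \<sigma> in at_right \<tau>. \<forall>s\<in>{\<tau>..\<sigma>}. Q (\<sigma>, s)"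
  then show "\<forall>\<^sub>F \<sigma> in at_right \<tau>. \<forall>s\<in>{\<tau>..\<sigma>}. P (\<sigma>, s) \<and> Q (\<sigma>, s)"
    by eventually_elim auto
next
  fix P Q :: "real \<times> real \<Rightarrow> bool"
  assume *: "\<forall>x. P x \<longrightarrow> Q x" and "\<forall>\<^sub>F \<sigma> in at_right \<tau>. \<forall>s\<in>{\<tau>..\<sigma>}. P (\<sigma>, s)"
  from this(2) show "\<forall>\<^sub>F \<sigma> in at_right \<tau>. \<forall>s\<in>{\<tau>..\<sigma>}. Q (\<sigma>, s)"
    by eventually_elim (use * in auto)
qed simp

lemma eventually_wedge_less:
  assumes "\<tau> < T"
  shows "eventually (\<lambda>p. fst p \<in> {\<tau><..<T} \<and> snd p \<in> {\<tau>..fst p}) (wedge \<tau>)"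
  unfolding eventually_wedge using eventually_at_right_real[OF assms] by eventually_elim auto

lemma filterlim_wedge_fst: "(g \<longlongrightarrow> c) (at_right \<tau>) \<Longrightarrow> ((\<lambda>p. g (fst p)) \<longlongrightarrow> c) (wedge \<tau>)"
  by (rule topological_tendstoI) (auto simp: eventually_wedge dest!: topological_tendstoD elim!: eventually_mono)

lemma tendsto_wedge_ident: "(fst \<longlongrightarrow> \<tau>) (wedge \<tau>)" "(snd \<longlongrightarrow> \<tau>) (wedge \<tau>)"
proof -
  have "((\<lambda>\<sigma>::real. \<sigma>) \<longlongrightarrow> \<tau>) (at_right \<tau>)"
    by (rule tendsto_ident_at)
  from filterlim_wedge_fst[OF this] show fst: "(fst \<longlongrightarrow> \<tau>) (wedge \<tau>)"
    by simp
  show "(snd \<longlongrightarrow> \<tau>) (wedge \<tau>)"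
    by (rule tendsto_sandwich[OF _ _ tendsto_const fst]) (auto simp: eventually_wedge)
qed

lemma tendsto_wedge_snd:
  assumes "continuous_on {a..b} f" "a \<le> \<tau>" "\<tau> < b"
  shows "((\<lambda>p. f (snd p)) \<longlongrightarrow> f \<tau>) (wedge \<tau>)"
proof (rule continuous_on_tendsto_compose[OF assms(1) tendsto_wedge_ident(2)])
  show "eventually (\<lambda>p. snd p \<in> {a..b}) (wedge \<tau>)"
    using eventually_wedge_less[OF assms(3)] by eventually_elim (use assms in auto)
qed (use assms in auto)

lemma tendsto_at_right_continuous_on:
  assumes "continuous_on {a..b} f" "a \<le> \<tau>" "\<tau> < (b::real)"
  shows "(f \<longlongrightarrow> f \<tau>) (at_right \<tau>)"
proof (rule continuous_on_tendsto_compose[OF assms(1) tendsto_ident_at])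
  show "eventually (\<lambda>s. s \<in> {a..b}) (at_right \<tau>)"
    using eventually_at_right_real[OF assms(3)] by eventually_elim (use assms in auto)
qed (use assms in auto)

lemma tendsto_average:
  fixes \<phi> :: "real \<Rightarrow> real \<Rightarrow> 'a::banach"
  assumes lim: "((\<lambda>p. \<phi> (fst p) (snd p)) \<longlongrightarrow> c) (wedge \<tau>)"
    and int: "eventually (\<lambda>\<sigma>. \<phi> \<sigma> integrable_on {\<tau>..\<sigma>}) (at_right \<tau>)"
  shows "((\<lambda>\<sigma>. (1 / (\<sigma> - \<tau>)) *\<^sub>R integral {\<tau>..\<sigma>} (\<phi> \<sigma>)) \<longlongrightarrow> c) (at_right \<tau>)"
proof (rule tendstoI)
  fix e :: real assume "0 < e"
  then have "eventually (\<lambda>p. dist (\<phi> (fst p) (snd p)) c < e / 2) (wedge \<tau>)"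
    using tendstoD[OF lim, of "e / 2"] by simp
  then have "\<forall>\<^sub>F \<sigma> in at_right \<tau>. \<forall>s\<in>{\<tau>..\<sigma>}. dist (\<phi> \<sigma> s) c < e / 2"
    by (simp add: eventually_wedge)
  then show "\<forall>\<^sub>F \<sigma> in at_right \<tau>. dist ((1 / (\<sigma> - \<tau>)) *\<^sub>R integral {\<tau>..\<sigma>} (\<phi> \<sigma>)) c < e"
    using int eventually_at_right_less[of \<tau>]
  proof eventually_elim
    case (elim \<sigma>)
    have h: "0 < \<sigma> - \<tau>"
      using elim by simp
    have "norm (integral {\<tau>..\<sigma>} (\<lambda>s. \<phi> \<sigma> s - c)) \<le> integral {\<tau>..\<sigma>} (\<lambda>s. e / 2)"
      using elim by (intro integral_norm_bound_integral integrable_diff) (auto simp: dist_norm less_imp_le)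
    then have "norm (integral {\<tau>..\<sigma>} (\<phi> \<sigma>) - (\<sigma> - \<tau>) *\<^sub>R c) \<le> (\<sigma> - \<tau>) * (e / 2)"
      using elim integral_diff[OF elim(2) integrable_const_ivl[of c]] by simp
    moreover have "(1 / (\<sigma> - \<tau>)) *\<^sub>R integral {\<tau>..\<sigma>} (\<phi> \<sigma>) - c
        = (1 / (\<sigma> - \<tau>)) *\<^sub>R (integral {\<tau>..\<sigma>} (\<phi> \<sigma>) - (\<sigma> - \<tau>) *\<^sub>R c)"
      using h by (simp add: scaleR_diff_right)
    ultimately have "dist ((1 / (\<sigma> - \<tau>)) *\<^sub>R integral {\<tau>..\<sigma>} (\<phi> \<sigma>)) c \<le> e / 2"
      unfolding dist_norm using h by (simp only: norm_scaleR) (simp add: pos_divide_le_eq mult.commute)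
    then show ?case
      using \<open>0 < e\<close> by simp
  qed
qed

lemma tendsto_average_continuous:
  fixes F :: "real \<Rightarrow> 'a::banach"
  assumes "continuous_on {a..b} F" "a \<le> \<tau>" "\<tau> < b"
  shows "((\<lambda>h. (1 / h) *\<^sub>R integral {\<tau>..\<tau> + h} F) \<longlongrightarrow> F \<tau>) (at_right 0)"
proof -
  have "((\<lambda>\<sigma>. (1 / (\<sigma> - \<tau>)) *\<^sub>R integral {\<tau>..\<sigma>} F) \<longlongrightarrow> F \<tau>) (at_right \<tau>)"
  proof (rule tendsto_average[OF tendsto_wedge_snd[OF assms]])
    show "\<forall>\<^sub>F \<sigma> in at_right \<tau>. F integrable_on {\<tau>..\<sigma>}"
      using eventually_at_right_real[OF assms(3)]
      by eventually_elim (use assms in \<open>auto intro!: integrable_continuous_real elim: continuous_on_subset\<close>)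
  qed
  then show ?thesis
    unfolding filterlim_at_right_to_0[of _ _ \<tau>] by (simp add: add.commute)
qed

lemma right_derivative_nonpos_imp_le:
  fixes G :: "real \<Rightarrow> real"
  assumes ab: "a \<le> b" and cont: "continuous_on {a..b} G"
    and der: "\<And>t. t \<in> {a..<b} \<Longrightarrow> ((\<lambda>s. (G s - G t) / (s - t)) \<longlongrightarrow> 0) (at_right t)"
  shows "G b \<le> G a"
proof (rule field_le_epsilon)
  fix e0 :: real assume "0 < e0"
  define e where "e = e0 / (b - a + 1)"
  have e: "0 < e" "e * (b - a) \<le> e0"
    using \<open>0 < e0\<close> ab by (auto simp: e_def field_simps)
  let ?S = "{t \<in> {a..b}. G t - e * t \<le> G a - e * a}"
  have "continuous_on {a..b} (\<lambda>t. G t - e * t)"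
    by (intro continuous_intros cont)
  then have "closed ({a..b} \<inter> (\<lambda>t. G t - e * t) -` {..G a - e * a})"
    by (rule continuous_closed_preimage) auto
  moreover have "{a..b} \<inter> (\<lambda>t. G t - e * t) -` {..G a - e * a} = ?S"
    by auto
  ultimately have "closed ?S"
    by simp
  moreover have "bounded ?S"
    by (rule bounded_subset[of "{a..b}"]) auto
  ultimately have "compact ?S"
    by (simp add: compact_eq_bounded_closed)
  moreover have "a \<in> ?S"
    using ab by simp
  ultimately obtain t where t: "t \<in> ?S" "\<And>s. s \<in> ?S \<Longrightarrow> s \<le> t"
    using compact_attains_sup[of ?S] by blast
  have "t = b"
  proof (rule ccontr)
    assume "t \<noteq> b"
    then have "t < b" "t \<in> {a..<b}"
      using t by auto
    have "\<forall>\<^sub>F s in at_right t. (G s - G t) / (s - t) < e"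
      using der[OF \<open>t \<in> {a..<b}\<close>] e(1) by (rule order_tendstoD)
    then have "\<forall>\<^sub>F s in at_right t. s \<in> {t<..<b} \<and> (G s - G t) / (s - t) < e"
      using eventually_at_right_real[OF \<open>t < b\<close>] by eventually_elim auto
    then obtain s where s: "s \<in> {t<..<b}" "(G s - G t) / (s - t) < e"
      using eventually_happens'[OF trivial_limit_at_right_real] by blast
    then have "G s - G t < e * (s - t)"
      by (simp add: field_simps)
    then have "G s - e * s \<le> G t - e * t"
      by (simp add: algebra_simps)
    then have "s \<in> ?S"
      using s t(1) by auto
    then show False
      using t(2) s(1) by fastforce
  qed
  then show "G b \<le> G a + e0"
    using t(1) e(2) by (simp add: algebra_simps)
qed

lemma continuous_right_derivative_imp_derivative:
  fixes f f' :: "real \<Rightarrow> real"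
  assumes f: "continuous_on {a<..<b} f" and f': "continuous_on {a<..<b} f'"
    and der: "\<And>t. t \<in> {a<..<b} \<Longrightarrow> ((\<lambda>s. (f s - f t) / (s - t)) \<longlongrightarrow> f' t) (at_right t)"
    and t: "t \<in> {a<..<b}"
  shows "(f has_real_derivative f' t) (at t)"
proof -
  obtain p r where p: "a < p" "p < t" and r: "t < r" "r < b"
    using t dense[of a t] dense[of t b] by auto
  have sub: "{p..r} \<subseteq> {a<..<b}"
    using p r by auto
  define F where "F s = integral {p..s} f'" for s
  have F: "(F has_real_derivative f' s) (at s within {p..r})" if "s \<in> {p..r}" for s
    unfolding F_def by (rule integral_has_real_derivative[OF continuous_on_subset[OF f' sub] that])
  have Fr: "((\<lambda>u. (F u - F s) / (u - s)) \<longlongrightarrow> f' s) (at_right s)" if "s \<in> {p..<r}" for s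
  proof -
    have "(F has_real_derivative f' s) (at s within {s..r})"
      using F[of s] that by (auto intro: DERIV_subset)
    then show ?thesis
      using that at_within_Icc_at_right[of s r] by (simp add: has_field_derivative_iff)
  qed
  have cont: "continuous_on {p..r} (\<lambda>s. f s - F s)"
    by (intro continuous_intros continuous_on_subset[OF f sub] DERIV_continuous_on[OF F])
  have eq: "f s - F s = f p - F p" if s: "s \<in> {p..r}" for s
  proof (rule antisym)
    have quot: "((\<lambda>u. ((f u - F u) - (f v - F v)) / (u - v)) \<longlongrightarrow> 0) (at_right v)" if "v \<in> {p..<s}" for v
    proof -
      have "((\<lambda>u. (f u - f v) / (u - v) - (F u - F v) / (u - v)) \<longlongrightarrow> f' v - f' v) (at_right v)"
        using that s p r by (intro tendsto_diff der Fr) auto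
      moreover have "(\<lambda>u. (f u - f v) / (u - v) - (F u - F v) / (u - v))
          = (\<lambda>u. ((f u - F u) - (f v - F v)) / (u - v))"
        by (rule ext) (simp add: diff_divide_distrib)
      ultimately show ?thesis
        by simp
    qed
    have "continuous_on {p..s} (\<lambda>s. f s - F s)"
      using s by (intro continuous_on_subset[OF cont]) auto
    from right_derivative_nonpos_imp_le[OF _ this quot] show "f s - F s \<le> f p - F p"
      using s by simp
    have "((\<lambda>u. (- (f u - F u) - - (f v - F v)) / (u - v)) \<longlongrightarrow> 0) (at_right v)" if "v \<in> {p..<s}" for v
    proof -
      have "(\<lambda>u. - (((f u - F u) - (f v - F v)) / (u - v)))
          = (\<lambda>u. (- (f u - F u) - - (f v - F v)) / (u - v))"
        by (rule ext) (simp add: diff_divide_distrib)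
      then show ?thesis
        using tendsto_minus[OF quot[OF that]] by simp
    qed
    moreover have "continuous_on {p..s} (\<lambda>s. - (f s - F s))"
      using s by (intro continuous_on_minus continuous_on_subset[OF cont]) auto
    ultimately have "- (f s - F s) \<le> - (f p - F p)"
      using s right_derivative_nonpos_imp_le[of p s "\<lambda>s. - (f s - F s)"] by simp
    then show "f p - F p \<le> f s - F s"
      by simp
  qed
  have "((\<lambda>s. F s + (f p - F p)) has_real_derivative f' t) (at t within {p..r})"
    using F[of t] p r by (auto intro!: derivative_eq_intros)
  then have "(f has_real_derivative f' t) (at t within {p..r})"
    by (rule has_field_derivative_transform_within[OF _ zero_less_one])
      (use eq p r in \<open>auto simp: algebra_simps\<close>)
  moreover have "at t within {p..r} = at t"
    using p r by (intro at_within_interior) auto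
  ultimately show ?thesis
    by simp
qed

subsection \<open>Difference quotients of Sobolev functions\<close>

lemma L2_norm_integrable_on:
  fixes g :: "real \<Rightarrow> 'a::euclidean_space"
  assumes "g \<in> L2 a b"
  shows "(\<lambda>t. norm (g t)) integrable_on {a..b}"
proof (rule set_borel_integral_eq_integral(1))
  have "integrable lborel (\<lambda>t. norm (indicator {a..b} t *\<^sub>R g t))"
    using L2_imp_set_integrable[OF assms] unfolding set_integrable_def by (rule integrable_norm)
  then show "set_integrable lborel {a..b} (\<lambda>t. norm (g t))"
    unfolding set_integrable_def by (simp add: indicator_def)
qed

lemma L2_continuous_integrable_on:
  fixes g :: "real \<Rightarrow> 'a::euclidean_space"
  assumes "g \<in> L2 a b" "{s..t} \<subseteq> {a..b}" "continuous_on {s..t} c"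
  shows "(\<lambda>r. g r \<bullet> c r) integrable_on {s..t}"
  by (intro L2_inner_integrable_on L2_subinterval[OF assms(1,2)] continuous_on_imp_L2 assms)

lemma H1_deriv_imp_integral:
  assumes "H1_deriv a b f g"
  shows "g \<in> L2 a b" "\<And>t. t \<in> {a..b} \<Longrightarrow> f t = f a + integral {a..t} g"
    "\<And>s t. a \<le> s \<Longrightarrow> s \<le> t \<Longrightarrow> t \<le> b \<Longrightarrow> f t - f s = integral {s..t} g"
proof -
  show g: "g \<in> L2 a b"
    using assms by (simp add: H1_deriv_def)
  show 1: "f t = f a + integral {a..t} g" if "t \<in> {a..b}" for t
  proof -
    have "(LBINT s:{a..t}. g s) = integral {a..t} g"
      using that by (intro set_borel_integral_eq_integral(2) L2_imp_set_integrable L2_subinterval[OF g]) auto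
    moreover have "f t = f a + (LBINT s:{a..t}. g s)"
      using assms that unfolding H1_deriv_def by blast
    ultimately show ?thesis
      by (simp only:)
  qed
  show "f t - f s = integral {s..t} g" if "a \<le> s" "s \<le> t" "t \<le> b" for s t
  proof -
    have "integral {a..s} g + integral {s..t} g = integral {a..t} g"
      using that by (intro Henstock_Kurzweil_Integration.integral_combine L2_integrable_on L2_subinterval[OF g]) auto
    moreover have "s \<in> {a..b}" "t \<in> {a..b}"
      using that by auto
    note this[THEN 1]
    ultimately show ?thesis
      by (simp only: add_diff_cancel_left) (metis add_diff_cancel_left')
  qed
qed

lemma H1_deriv_imp_continuous_on: "H1_deriv a b f g \<Longrightarrow> continuous_on {a..b} f"
  by (rule H1_imp_continuous_on) (auto simp: H1_def)

context
  fixes T :: real and \<xi> g :: "real \<Rightarrow> 'a::euclidean_space"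
  assumes H1: "H1_deriv 0 T \<xi> g"
begin

private definition G where "G t = integral {0..t} (\<lambda>s. norm (g s))"

private lemma G_diff:
  assumes "0 \<le> s" "s \<le> t" "t \<le> T"
  shows "G t - G s = integral {s..t} (\<lambda>s. norm (g s))"
proof -
  have "integral {0..s} (\<lambda>s. norm (g s)) + integral {s..t} (\<lambda>s. norm (g s)) = integral {0..t} (\<lambda>s. norm (g s))"
    using assms by (intro Henstock_Kurzweil_Integration.integral_combine L2_norm_integrable_on
        L2_subinterval[OF H1_deriv_imp_integral(1)[OF H1]]) auto
  then show ?thesis
    by (simp add: G_def)
qed

private lemma G_mono: "0 \<le> s \<Longrightarrow> s \<le> t \<Longrightarrow> t \<le> T \<Longrightarrow> G s \<le> G t"
  using G_diff[of s t] integral_nonneg[of "\<lambda>s. norm (g s)" "{s..t}"]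
    L2_norm_integrable_on[OF L2_subinterval[OF H1_deriv_imp_integral(1)[OF H1], of s t]] by force

private lemma G_continuous: "continuous_on {0..T} G"
  unfolding G_def
  by (rule indefinite_integral_continuous_1[OF L2_norm_integrable_on[OF H1_deriv_imp_integral(1)[OF H1]]])

private lemma norm_diff_le_G:
  assumes "0 \<le> s" "s \<le> t" "t \<le> T"
  shows "norm (\<xi> t - \<xi> s) \<le> G t - G s"
proof -
  have "g \<in> L2 s t"
    using assms by (intro L2_subinterval[OF H1_deriv_imp_integral(1)[OF H1]]) auto
  then have "norm (integral {s..t} g) \<le> integral {s..t} (\<lambda>s. norm (g s))"
    by (intro integral_norm_bound_integral L2_integrable_on L2_norm_integrable_on) auto
  then show ?thesis
    using H1_deriv_imp_integral(3)[OF H1 assms] G_diff[OF assms] by simp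
qed

private lemma shift_continuous:
  fixes F :: "real \<Rightarrow> 'b::euclidean_space"
  assumes "0 \<le> \<alpha>" "\<beta> + h \<le> T" "0 \<le> h" "continuous_on {0..T} F"
  shows "continuous_on {\<alpha>..\<beta>} (\<lambda>r. F (r + h))" "continuous_on {\<alpha>..\<beta>} F"
  by (rule continuous_on_compose2[OF assms(4)]; use assms in \<open>auto intro!: continuous_intros\<close>)
    (rule continuous_on_subset[OF assms(4)]; use assms in auto)

private lemma integral_shift_diff:
  fixes F :: "real \<Rightarrow> 'b::euclidean_space"
  assumes "0 \<le> \<alpha>" "\<alpha> \<le> \<beta>" "\<beta> + h \<le> T" "0 \<le> h" and F: "continuous_on {0..T} F"
  shows "integral {\<alpha>..\<beta>} (\<lambda>r. F (r + h) - F r) = integral {\<beta>..\<beta> + h} F - integral {\<alpha>..\<alpha> + h} F"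
proof -
  have int: "F integrable_on {a..b}" if "0 \<le> a" "b \<le> T" for a b
    using that by (intro integrable_continuous_real continuous_on_subset[OF F]) auto
  have "integral {\<alpha>..\<beta>} (\<lambda>r. F (r + h) - F r) = integral {\<alpha>..\<beta>} (\<lambda>r. F (r + h)) - integral {\<alpha>..\<beta>} F"
    using shift_continuous[OF assms(1,3,4) F] by (intro integral_diff integrable_continuous_real)
  also have "integral {\<alpha>..\<beta>} (\<lambda>r. F (r + h)) = integral {\<alpha> + h..\<beta> + h} F"
    using integral_shift[OF continuous_on_subset[OF F], of \<alpha> h \<beta>] assms by (simp add: o_def)
  finally have 1: "integral {\<alpha>..\<beta>} (\<lambda>r. F (r + h) - F r) = integral {\<alpha> + h..\<beta> + h} F - integral {\<alpha>..\<beta>} F" .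
  have "integral {\<alpha>..\<alpha> + h} F + integral {\<alpha> + h..\<beta> + h} F = integral {\<alpha>..\<beta> + h} F"
    using assms by (intro Henstock_Kurzweil_Integration.integral_combine int) auto
  moreover have "integral {\<alpha>..\<beta>} F + integral {\<beta>..\<beta> + h} F = integral {\<alpha>..\<beta> + h} F"
    using assms by (intro Henstock_Kurzweil_Integration.integral_combine int) auto
  ultimately have "integral {\<alpha> + h..\<beta> + h} F = integral {\<alpha>..\<beta> + h} F - integral {\<alpha>..\<alpha> + h} F"
    "integral {\<alpha>..\<beta>} F = integral {\<alpha>..\<beta> + h} F - integral {\<beta>..\<beta> + h} F"
    by (metis add_diff_cancel_left', metis add_diff_cancel_right')
  then show ?thesis
    unfolding 1 by simp
qed

private lemma integral_norm_diff_le: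
  assumes "0 \<le> \<alpha>" "\<alpha> \<le> \<beta>" "\<beta> + h \<le> T" "0 \<le> h"
  shows "integral {\<alpha>..\<beta>} (\<lambda>r. norm (\<xi> (r + h) - \<xi> r)) \<le> h * (G (\<beta> + h) - G \<alpha>)"
proof -
  note cont = H1_deriv_imp_continuous_on[OF H1]
  have int: "G integrable_on {a..b}" if "0 \<le> a" "b \<le> T" for a b
    using that by (intro integrable_continuous_real continuous_on_subset[OF G_continuous]) auto
  have "integral {\<alpha>..\<beta>} (\<lambda>r. norm (\<xi> (r + h) - \<xi> r)) \<le> integral {\<alpha>..\<beta>} (\<lambda>r. G (r + h) - G r)"
    using assms shift_continuous[OF assms(1,3,4) cont] shift_continuous[OF assms(1,3,4) G_continuous]
    by (intro integral_le integrable_continuous_real continuous_intros norm_diff_le_G) auto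
  also have "\<dots> = integral {\<beta>..\<beta> + h} G - integral {\<alpha>..\<alpha> + h} G"
    by (rule integral_shift_diff[OF assms G_continuous])
  also have "\<dots> \<le> integral {\<beta>..\<beta> + h} (\<lambda>_. G (\<beta> + h)) - integral {\<alpha>..\<alpha> + h} (\<lambda>_. G \<alpha>)"
    using assms by (intro diff_mono integral_le int G_mono) auto
  also have "\<dots> = h * (G (\<beta> + h) - G \<alpha>)"
    using assms by (simp add: algebra_simps)
  finally show ?thesis .
qed

lemma integral_norm_diff_bounded:
  obtains K where "0 < K"
    "\<And>\<beta> h. 0 \<le> \<beta> \<Longrightarrow> \<beta> + h \<le> T \<Longrightarrow> 0 \<le> h \<Longrightarrow>
      integral {0..\<beta>} (\<lambda>r. norm (\<xi> (r + h) - \<xi> r)) \<le> h * K"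
proof
  show "0 < \<bar>G T\<bar> + 1"
    by simp
  fix \<beta> h :: real assume *: "0 \<le> \<beta>" "\<beta> + h \<le> T" "0 \<le> h"
  have "integral {0..\<beta>} (\<lambda>r. norm (\<xi> (r + h) - \<xi> r)) \<le> h * (G (\<beta> + h) - G 0)"
    using * by (intro integral_norm_diff_le) auto
  also have "\<dots> \<le> h * (\<bar>G T\<bar> + 1)"
    using * G_mono[of "\<beta> + h" T] by (intro mult_left_mono) (auto simp: G_def[of 0])
  finally show "integral {0..\<beta>} (\<lambda>r. norm (\<xi> (r + h) - \<xi> r)) \<le> h * (\<bar>G T\<bar> + 1)" .
qed

text \<open>
  For constant \<open>c\<close> the limit is elementary.  On an interval on which \<open>c\<close> oscillates by at most \<open>\<eta>\<close> the
  error is therefore at most \<open>\<eta>\<close> times a multiple of the \<open>L\<^sup>1\<close> norm of \<open>g\<close>, and such bounds add up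
  over adjacent intervals.
\<close>

lemma difference_quotient_tendsto:
  assumes \<beta>: "0 \<le> \<beta>" "\<beta> < T" and c: "continuous_on {0..\<beta>} c"
  shows "((\<lambda>h. (1 / h) * integral {0..\<beta>} (\<lambda>r. (\<xi> (r + h) - \<xi> r) \<bullet> c r))
    \<longlongrightarrow> integral {0..\<beta>} (\<lambda>r. g r \<bullet> c r)) (at_right 0)"
proof -
  note \<xi> = H1_deriv_imp_continuous_on[OF H1] and g = H1_deriv_imp_integral(1)[OF H1]
  define D where "D h r = (1 / h) *\<^sub>R (\<xi> (r + h) - \<xi> r)" for h r
  define E where "E h a b = integral {a..b} (\<lambda>r. (D h r - g r) \<bullet> c r)" for h a b
  have ev: "\<forall>\<^sub>F h in at_right 0. 0 < h \<and> \<beta> + h \<le> T"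
    using eventually_at_right_real[of 0 "T - \<beta>"] \<beta> by (auto elim!: eventually_mono)
  have D: "continuous_on {a..b} (D h)" if "0 \<le> a" "b \<le> \<beta>" "0 < h" "\<beta> + h \<le> T" for a b h
  proof -
    have "continuous_on {a..b} (\<lambda>r. \<xi> (r + h))" "continuous_on {a..b} \<xi>"
      using shift_continuous[OF _ _ _ \<xi>, of a b h] that by auto
    then show ?thesis
      unfolding D_def by (intro continuous_intros)
  qed
  have c': "continuous_on {a..b} c" if "0 \<le> a" "b \<le> \<beta>" for a b
    using that by (intro continuous_on_subset[OF c]) auto
  have gi: "(\<lambda>r. g r \<bullet> k r) integrable_on {a..b}" if "0 \<le> a" "b \<le> \<beta>" "continuous_on {a..b} k" for a b k
    using that \<beta> by (intro L2_continuous_integrable_on[OF g]) auto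
  have int: "(\<lambda>r. (D h r - g r) \<bullet> k r) integrable_on {a..b}"
    if "0 \<le> a" "b \<le> \<beta>" "0 < h" "\<beta> + h \<le> T" "continuous_on {a..b} k" for a b h k
    unfolding inner_diff_left using that
    by (intro integrable_diff gi integrable_continuous_real continuous_on_inner D) auto
  have small: "\<forall>\<^sub>F h in at_right 0. \<bar>E h 0 \<beta>\<bar> \<le> \<eta> * (2 * (G \<beta> - G 0)) + e" if \<eta>: "0 < \<eta>" and "0 < e" for \<eta> e
  proof -
    define P where "P a b \<longleftrightarrow> (0 \<le> a \<longrightarrow> b \<le> \<beta> \<longrightarrow>
      (\<forall>e>0. \<forall>\<^sub>F h in at_right 0. \<bar>E h a b\<bar> \<le> \<eta> * (2 * (G b - G a)) + e))" for a b
    have "P 0 \<beta>"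
      using \<beta>(1)
    proof (induction rule: Bolzano)
      case (trans a b d)
      show ?case
        unfolding P_def
      proof (intro impI allI)
        fix e :: real assume *: "0 \<le> a" "d \<le> \<beta>" and "0 < e"
        then have "\<forall>\<^sub>F h in at_right 0. \<bar>E h a b\<bar> \<le> \<eta> * (2 * (G b - G a)) + e / 2"
          "\<forall>\<^sub>F h in at_right 0. \<bar>E h b d\<bar> \<le> \<eta> * (2 * (G d - G b)) + e / 2"
          using trans(1-4) \<open>0 < e\<close> unfolding P_def by (auto dest: spec[of _ "e / 2"])
        then show "\<forall>\<^sub>F h in at_right 0. \<bar>E h a d\<bar> \<le> \<eta> * (2 * (G d - G a)) + e"
          using ev
        proof eventually_elim
          case (elim h)
          have "E h a b + E h b d = E h a d"
            unfolding E_def using trans * elim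
            by (intro Henstock_Kurzweil_Integration.integral_combine int c') auto
          moreover have "\<eta> * (2 * (G b - G a)) + \<eta> * (2 * (G d - G b)) = \<eta> * (2 * (G d - G a))"
            by (simp add: algebra_simps)
          ultimately show ?case
            using elim by argo
        qed
      qed
    next
      case (local x)
      then have "\<exists>d>0. \<forall>r\<in>{0..\<beta>}. dist r x < d \<longrightarrow> dist (c r) (c x) < \<eta>"
        using c \<eta> unfolding continuous_on_iff by force
      then obtain d where d: "0 < d" "\<And>r. r \<in> {0..\<beta>} \<Longrightarrow> dist r x < d \<Longrightarrow> dist (c r) (c x) < \<eta>"
        by blast
      show ?case
        unfolding P_def
      proof (intro exI[of _ d] conjI allI impI d(1))
        fix a b e :: real
        assume ab: "a \<le> x \<and> x \<le> b \<and> b - a < d" "0 \<le> a" "b \<le> \<beta>" and "0 < e"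
        define S where "S h = ((1 / h) *\<^sub>R integral {b..b + h} \<xi> - (1 / h) *\<^sub>R integral {a..a + h} \<xi>) - (\<xi> b - \<xi> a)" for h
        have "(S \<longlongrightarrow> (\<xi> b - \<xi> a) - (\<xi> b - \<xi> a)) (at_right 0)"
          unfolding S_def using ab \<beta>
          by (intro tendsto_diff tendsto_const tendsto_average_continuous[OF \<xi>]) auto
        moreover have "((\<lambda>h. G (b + h)) \<longlongrightarrow> G b) (at_right 0)"
          using tendsto_at_right_continuous_on[OF G_continuous, of b] ab \<beta>
          unfolding filterlim_at_right_to_0[of _ _ b] by (simp add: add.commute)
        ultimately have "((\<lambda>h. \<eta> * ((G (b + h) - G a) + (G b - G a)) + \<bar>S h \<bullet> c x\<bar>)
            \<longlongrightarrow> \<eta> * ((G b - G a) + (G b - G a)) + \<bar>((\<xi> b - \<xi> a) - (\<xi> b - \<xi> a)) \<bullet> c x\<bar>) (at_right 0)"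
          by (intro tendsto_intros)
        then have "\<forall>\<^sub>F h in at_right 0. \<eta> * ((G (b + h) - G a) + (G b - G a)) + \<bar>S h \<bullet> c x\<bar> < \<eta> * (2 * (G b - G a)) + e"
          by (rule order_tendstoD) (use \<open>0 < e\<close> in \<open>simp add: algebra_simps\<close>)
        then show "\<forall>\<^sub>F h in at_right 0. \<bar>E h a b\<bar> \<le> \<eta> * (2 * (G b - G a)) + e"
          using ev
        proof eventually_elim
          case (elim h)
          have h: "0 < h" "\<beta> + h \<le> T"
            using elim by auto
          have ab': "a \<le> b" "b + h \<le> T"
            using ab h by auto
          note gL = L2_subinterval[OF g, of a b]
          have gLab: "g \<in> L2 a b"
            using ab \<beta> by (intro gL) auto
          have nD: "(\<lambda>r. norm (D h r)) integrable_on {a..b}"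
            using ab h by (intro integrable_continuous_real continuous_on_norm D) auto
          have "norm (integral {a..b} (\<lambda>r. (D h r - g r) \<bullet> (c r - c x)))
              \<le> integral {a..b} (\<lambda>r. \<eta> * (norm (D h r) + norm (g r)))"
          proof (rule integral_norm_bound_integral)
            show "(\<lambda>r. (D h r - g r) \<bullet> (c r - c x)) integrable_on {a..b}"
              using ab h by (intro int continuous_intros c') auto
            show "(\<lambda>r. \<eta> * (norm (D h r) + norm (g r))) integrable_on {a..b}"
              by (intro integrable_on_mult_right integrable_add L2_norm_integrable_on gLab nD)
            fix r assume r: "r \<in> {a..b}"
            have "r \<in> {0..\<beta>}" "dist r x < d"
              using r ab by (auto simp: dist_real_def abs_less_iff)
            then have "norm (c r - c x) \<le> \<eta>"
              using d(2)[of r] by (simp add: dist_norm)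
            then have "norm ((D h r - g r) \<bullet> (c r - c x)) \<le> norm (D h r - g r) * \<eta>"
              unfolding real_norm_def by (intro order_trans[OF Cauchy_Schwarz_ineq2] mult_left_mono) auto
            also have "\<dots> \<le> (norm (D h r) + norm (g r)) * \<eta>"
              using \<eta> by (intro mult_right_mono norm_triangle_ineq4) auto
            finally show "norm ((D h r - g r) \<bullet> (c r - c x)) \<le> \<eta> * (norm (D h r) + norm (g r))"
              by (simp add: mult.commute)
          qed
          also have "\<dots> = \<eta> * (integral {a..b} (\<lambda>r. norm (D h r)) + (G b - G a))"
            using nD ab ab' h by (simp add: integral_add L2_norm_integrable_on[OF gLab] G_diff)
          also have "integral {a..b} (\<lambda>r. norm (D h r)) = (1 / h) * integral {a..b} (\<lambda>r. norm (\<xi> (r + h) - \<xi> r))"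
            using h by (simp add: D_def)
          also have "\<dots> \<le> (1 / h) * (h * (G (b + h) - G a))"
            using ab ab' h by (intro mult_left_mono integral_norm_diff_le) auto
          also have "\<dots> = G (b + h) - G a"
            using h by simp
          finally have 1: "norm (integral {a..b} (\<lambda>r. (D h r - g r) \<bullet> (c r - c x)))
              \<le> \<eta> * ((G (b + h) - G a) + (G b - G a))"
            using \<eta> by simp
          have Dg: "(\<lambda>r. D h r - g r) integrable_on {a..b}"
            using ab h by (intro integrable_diff integrable_continuous_real D L2_integrable_on gLab) auto
          have "integral {a..b} (\<lambda>r. D h r - g r) = integral {a..b} (D h) - integral {a..b} g"
            using ab h by (intro integral_diff integrable_continuous_real D L2_integrable_on gLab) auto
          also have "integral {a..b} (D h) = (1 / h) *\<^sub>R (integral {b..b + h} \<xi> - integral {a..a + h} \<xi>)"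
            unfolding D_def using ab ab' h \<xi> by (simp add: integral_shift_diff)
          also have "integral {a..b} g = \<xi> b - \<xi> a"
            using ab ab' h by (intro H1_deriv_imp_integral(3)[OF H1, symmetric]) auto
          finally have S: "integral {a..b} (\<lambda>r. D h r - g r) = S h"
            by (simp add: S_def scaleR_diff_right)
          have "E h a b = integral {a..b} (\<lambda>r. (D h r - g r) \<bullet> (c r - c x) + (D h r - g r) \<bullet> c x)"
            unfolding E_def by (simp add: inner_diff_right)
          also have "\<dots> = integral {a..b} (\<lambda>r. (D h r - g r) \<bullet> (c r - c x)) + integral {a..b} (\<lambda>r. (D h r - g r) \<bullet> c x)"
            using ab h by (intro integral_add int continuous_intros c') auto
          also have "integral {a..b} (\<lambda>r. (D h r - g r) \<bullet> c x) = S h \<bullet> c x"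
            using integral_linear[OF Dg bounded_linear_inner_left[of "c x"]] S by (simp add: o_def)
          finally show ?case
            using 1 elim(1) by simp
        qed
      qed
    qed
    then show ?thesis
      using \<open>0 < e\<close> by (simp add: P_def)
  qed
  have "((\<lambda>h. E h 0 \<beta>) \<longlongrightarrow> 0) (at_right 0)"
  proof (rule tendstoI)
    fix e :: real assume "0 < e"
    define k where "k = 2 * (G \<beta> - G 0)"
    have "0 \<le> k"
      using G_mono[of 0 \<beta>] \<beta> by (simp add: k_def)
    then have "0 < e / (2 * (k + 1))" "e / (2 * (k + 1)) * k + e / 4 < e"
      using \<open>0 < e\<close> by (auto simp: field_simps add_pos_nonneg)
    moreover have "\<forall>\<^sub>F h in at_right 0. \<bar>E h 0 \<beta>\<bar> \<le> e / (2 * (k + 1)) * k + e / 4"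
      unfolding k_def by (rule small) (use calculation \<open>0 < e\<close> in \<open>auto simp: k_def\<close>)
    ultimately show "\<forall>\<^sub>F h in at_right 0. dist (E h 0 \<beta>) 0 < e"
      by (auto elim!: eventually_mono)
  qed
  then have "((\<lambda>h. E h 0 \<beta> + integral {0..\<beta>} (\<lambda>r. g r \<bullet> c r)) \<longlongrightarrow> 0 + integral {0..\<beta>} (\<lambda>r. g r \<bullet> c r)) (at_right 0)"
    by (intro tendsto_intros)
  then have "((\<lambda>h. E h 0 \<beta> + integral {0..\<beta>} (\<lambda>r. g r \<bullet> c r)) \<longlongrightarrow> integral {0..\<beta>} (\<lambda>r. g r \<bullet> c r)) (at_right 0)"
    by simp
  then show ?thesis
  proof (rule Lim_transform_eventually)
    show "\<forall>\<^sub>F h in at_right 0. E h 0 \<beta> + integral {0..\<beta>} (\<lambda>r. g r \<bullet> c r)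
        = (1 / h) * integral {0..\<beta>} (\<lambda>r. (\<xi> (r + h) - \<xi> r) \<bullet> c r)"
      using ev
    proof eventually_elim
      case (elim h)
      have "E h 0 \<beta> = integral {0..\<beta>} (\<lambda>r. D h r \<bullet> c r) - integral {0..\<beta>} (\<lambda>r. g r \<bullet> c r)"
        unfolding E_def inner_diff_left using elim
        by (intro integral_diff gi integrable_continuous_real continuous_on_inner D c) auto
      then show ?case
        by (simp add: D_def)
    qed
  qed
qed

end

section \<open>Trajectories\<close>

locale tracking_problem =
  fixes T :: real
    and A :: "real^'d::finite^'d"
    and B :: "real^'m::finite^'d"
    and C :: "real^'d^'p::finite"
    and N :: "real \<Rightarrow> real^'d^'d"
    and y :: "real \<Rightarrow> real^'p"
  assumes T_pos: "0 < T"
    and N_cont: "continuous_on {0..T} N"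
    and y_cont: "continuous_on {0..T} y"
begin

definition drift :: "(real \<Rightarrow> real^'d) \<Rightarrow> real \<Rightarrow> real^'d" where
  "drift W s = A *v W s + integral {0..s} (\<lambda>r. N (s - r) *v W r)"

lemma memory_continuous_on:
  assumes "continuous_on {0..T} W" "s \<in> {0..T}"
  shows "continuous_on {0..s} (\<lambda>r. N (s - r) *v W r)"
proof -
  have "continuous_on {0..s} (\<lambda>r. N (s - r))"
    by (rule continuous_on_compose2[OF N_cont]) (use assms(2) in \<open>auto intro!: continuous_intros\<close>)
  moreover have "continuous_on {0..s} W"
    by (rule continuous_on_subset[OF assms(1)]) (use assms(2) in auto)
  ultimately show ?thesis
    by (intro continuous_intros)
qed

lemmas memory_integrable = integrable_continuous_real[OF memory_continuous_on]

lemma drift_continuous_on: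
  assumes "continuous_on {0..T} W"
  shows "continuous_on {0..T} (drift W)"
proof -
  let ?S = "{(r, s). 0 \<le> r \<and> r \<le> s \<and> s \<le> T}"
  have "continuous_on ?S (\<lambda>x. N (snd x - fst x))"
    by (rule continuous_on_compose2[OF N_cont]) (auto intro!: continuous_intros)
  moreover have "continuous_on ?S (\<lambda>x. W (fst x))"
    by (rule continuous_on_compose2[OF assms]) (auto intro!: continuous_intros)
  ultimately have "continuous_on ?S (\<lambda>(r, s). N (s - r) *v W r)"
    unfolding case_prod_beta by (intro continuous_intros)
  then have "continuous_on {0..T} (\<lambda>s. integral {0..s} (\<lambda>r. N (s - r) *v W r))"
    by (rule continuous_on_integral_moving)
  then show ?thesis
    unfolding drift_def by (intro continuous_intros assms)
qed

lemma drift_integrable: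
  assumes "continuous_on {0..T} W" "{a..b} \<subseteq> {0..T}"
  shows "drift W integrable_on {a..b}"
  by (intro integrable_continuous_real continuous_on_subset[OF drift_continuous_on] assms)

lemma drift_add_scaleR:
  assumes "continuous_on {0..T} W" "continuous_on {0..T} Z" "s \<in> {0..T}"
  shows "drift (\<lambda>t. W t + c *\<^sub>R Z t) s = drift W s + c *\<^sub>R drift Z s"
proof -
  have "integral {0..s} (\<lambda>r. N (s - r) *v W r + c *\<^sub>R (N (s - r) *v Z r))
      = integral {0..s} (\<lambda>r. N (s - r) *v W r) + c *\<^sub>R integral {0..s} (\<lambda>r. N (s - r) *v Z r)"
    using memory_integrable[OF assms(1,3)] memory_integrable[OF assms(2,3)]
    by (subst integral_add) (auto intro: integrable_cmul)
  then show ?thesis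
    unfolding drift_def
    by (simp add: matrix_vector_right_distrib matrix_vector_mult_scaleR scaleR_add_right)
qed

lemma drift_bounded:
  obtains k where "k > 0"
    "\<And>W s D. continuous_on {0..T} W \<Longrightarrow> s \<in> {0..T} \<Longrightarrow> (\<And>r. r \<in> {0..s} \<Longrightarrow> norm (W r) \<le> D)
      \<Longrightarrow> norm (drift W s) \<le> k * D"
proof -
  obtain n where n: "n > 0" "\<And>t. t \<in> {0..T} \<Longrightarrow> norm (N t) \<le> n"
    by (rule bounded_on_interval[OF N_cont]) blast
  obtain c where c: "c > 0" "\<And>X (v::real^'d). norm ((X::real^'d^'d) *v v) \<le> norm X * norm v * c"
    using bounded_bilinear.pos_bounded[OF bounded_bilinear_matrix_vector_mult] by metis
  show thesis
  proof
    show "norm A * c + n * c * T + 1 > 0"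
      using n c T_pos by (intro add_nonneg_pos add_nonneg_nonneg mult_nonneg_nonneg) auto
    fix W :: "real \<Rightarrow> real^'d" and s D
    assume W: "continuous_on {0..T} W" and s: "s \<in> {0..T}"
      and D: "\<And>r. r \<in> {0..s} \<Longrightarrow> norm (W r) \<le> D"
    have D0: "0 \<le> D"
      using D[of s] s norm_ge_zero[of "W s"] by (simp del: norm_ge_zero)
    have "norm (A *v W s) \<le> norm A * D * c"
      using c(1) s D[of s] by (intro order_trans[OF c(2)] mult_right_mono mult_left_mono) auto
    moreover have "norm (integral {0..s} (\<lambda>r. N (s - r) *v W r)) \<le> n * D * c * (s - 0)"
    proof (rule integral_bound)
      show "norm (N (s - r) *v W r) \<le> n * D * c" if "r \<in> {0..s}" for r
        using c(1) n that s D[of r]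
        by (intro order_trans[OF c(2)] mult_right_mono mult_mono n(2)) auto
    qed (use s memory_continuous_on[OF W s] in auto)
    moreover have "n * D * c * (s - 0) \<le> n * D * c * T"
      using n(1) c(1) D0 s by (intro mult_left_mono) auto
    ultimately have "norm (drift W s) \<le> norm A * D * c + n * D * c * T"
      unfolding drift_def by (intro norm_triangle_le) linarith
    also have "\<dots> \<le> (norm A * c + n * c * T + 1) * D"
      using D0 by (simp add: algebra_simps)
    finally show "norm (drift W s) \<le> (norm A * c + n * c * T + 1) * D" .
  qed
qed

text \<open>
  The weight \<open>exp (2 k t)\<close> makes the integral operator a contraction on all of \<open>[0, T]\<close> at once.
\<close>

lemma integral_equation_solvable:
  assumes F: "continuous_on {0..T} F" and \<tau>: "0 \<le> \<tau>"
  obtains W where "continuous_on {0..T} W" "\<And>t. t \<in> {0..T} \<Longrightarrow> W t = F t + integral {\<tau>..t} (drift W)"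
proof -
  obtain k where k: "k > 0"
    "\<And>W s D. continuous_on {0..T} W \<Longrightarrow> s \<in> {0..T} \<Longrightarrow> (\<And>r. r \<in> {0..s} \<Longrightarrow> norm (W r) \<le> D)
      \<Longrightarrow> norm (drift W s) \<le> k * D"
    by (rule drift_bounded) blast
  define L where "L = 2 * k"
  define X :: "(real \<Rightarrow>\<^sub>C (real^'d)) \<Rightarrow> real \<Rightarrow> real^'d" where "X \<phi> s = exp (L * s) *\<^sub>R \<phi> s" for \<phi> s
  define G where "G \<phi> t = exp (- (L * t)) *\<^sub>R (F t + integral {\<tau>..t} (drift (X \<phi>)))" for \<phi> t
  define cl where "cl t = max 0 (min t T)" for t
  define E where "E \<phi> = Bcontfun (\<lambda>t. G \<phi> (cl t))" for \<phi>
  have X: "continuous_on S (X \<phi>)" for S \<phi>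
    unfolding X_def by (intro continuous_intros) auto
  have G: "continuous_on {0..T} (G \<phi>)" for \<phi>
  proof -
    have "continuous_on {0..T} (\<lambda>t. integral {\<tau>..t} (drift (X \<phi>)))"
      using \<tau> by (intro continuous_on_subset[OF continuous_on_indefinite_integral[where T=T]]
          drift_integrable X) auto
    then show ?thesis
      unfolding G_def by (intro continuous_intros F)
  qed
  have E: "E \<phi> t = G \<phi> (cl t)" for \<phi> t
  proof -
    have cl: "cl t \<in> {0..T}" for t
      using T_pos by (auto simp: cl_def)
    have "continuous_on UNIV (\<lambda>t. G \<phi> (cl t))"
      by (rule continuous_on_compose2[OF G]) (use cl in \<open>auto simp: cl_def intro!: continuous_intros\<close>)
    moreover have "bounded (range (\<lambda>t. G \<phi> (cl t)))"
      by (rule bounded_subset[OF compact_imp_bounded[OF compact_continuous_image[OF G]]])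
        (use cl in auto)
    ultimately show ?thesis
      unfolding E_def by (simp add: Bcontfun_inverse bcontfun_def)
  qed
  have contr: "norm (G \<phi> t - G \<psi> t) \<le> 1 / 2 * dist \<phi> \<psi>" if t: "t \<in> {0..T}" for \<phi> \<psi> t
  proof (cases "t < \<tau>")
    case False
    let ?D = "dist \<phi> \<psi>"
    have bd: "norm (drift (X \<phi>) s - drift (X \<psi>) s) \<le> k * ?D * exp (L * s)" if s: "s \<in> {\<tau>..t}" for s
    proof -
      have sT: "s \<in> {0..T}"
        using s t \<tau> by auto
      have "drift (X \<phi>) s - drift (X \<psi>) s = drift (\<lambda>t. X \<phi> t + (-1) *\<^sub>R X \<psi> t) s"
        by (subst drift_add_scaleR[OF X X sT]) simp
      also have "norm \<dots> \<le> k * (exp (L * s) * ?D)"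
      proof (rule k(2)[OF _ sT])
        show "continuous_on {0..T} (\<lambda>t. X \<phi> t + (-1) *\<^sub>R X \<psi> t)"
          by (intro continuous_intros X)
        fix r assume r: "r \<in> {0..s}"
        have "norm (X \<phi> r + (-1) *\<^sub>R X \<psi> r) = exp (L * r) * dist (\<phi> r) (\<psi> r)"
          by (simp add: X_def dist_norm flip: scaleR_diff_right)
        also have "\<dots> \<le> exp (L * s) * ?D"
          using r k(1) by (intro mult_mono dist_bounded) (auto simp: L_def)
        finally show "norm (X \<phi> r + (-1) *\<^sub>R X \<psi> r) \<le> exp (L * s) * ?D" .
      qed
      finally show ?thesis
        by (simp add: mult_ac)
    qed
    have int: "drift (X \<phi>) integrable_on {\<tau>..t}" for \<phi>
      using t \<tau> by (intro drift_integrable X) auto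
    have "((\<lambda>s. k * ?D * exp (L * s)) has_integral ?D / 2 * exp (L * t) - ?D / 2 * exp (L * \<tau>)) {\<tau>..t}"
      using False k(1)
      by (intro fundamental_theorem_of_calculus)
        (auto intro!: derivative_eq_intros simp: L_def simp flip: has_real_derivative_iff_has_vector_derivative)
    note ex = this
    have "norm (G \<phi> t - G \<psi> t)
        = exp (- (L * t)) * norm (integral {\<tau>..t} (\<lambda>s. drift (X \<phi>) s - drift (X \<psi>) s))"
      using int by (simp add: G_def integral_diff flip: scaleR_diff_right)
    also have "\<dots> \<le> exp (- (L * t)) * (?D / 2 * exp (L * t) - ?D / 2 * exp (L * \<tau>))"
      using integral_norm_bound_integral[OF integrable_diff[OF int int] has_integral_integrable[OF ex] bd]
      unfolding integral_unique[OF ex] by (rule mult_left_mono) auto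
    also have "\<dots> \<le> exp (- (L * t)) * (?D / 2 * exp (L * t))"
      by (intro mult_left_mono) auto
    also have "\<dots> = 1 / 2 * ?D"
      by (simp add: exp_minus)
    finally show ?thesis .
  qed (simp add: G_def)
  have "\<exists>!\<phi>. E \<phi> = \<phi>"
  proof (rule banach_fix_type[of "1 / 2"])
    show "\<forall>\<phi> \<psi>. dist (E \<phi>) (E \<psi>) \<le> 1 / 2 * dist \<phi> \<psi>"
    proof (intro allI dist_bound)
      fix \<phi> \<psi> t
      have "cl t \<in> {0..T}"
        using T_pos by (auto simp: cl_def)
      then show "dist (E \<phi> t) (E \<psi> t) \<le> 1 / 2 * dist \<phi> \<psi>"
        unfolding E dist_norm[of "G _ _"] by (rule contr)
    qed
  qed auto
  then obtain \<phi> where \<phi>: "E \<phi> = \<phi>"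
    by blast
  have eq: "X \<phi> t = F t + integral {\<tau>..t} (drift (X \<phi>))" if "t \<in> {0..T}" for t
  proof -
    have "\<phi> t = G \<phi> t"
      using E[of \<phi> t] that by (simp add: \<phi> cl_def)
    then have "X \<phi> t = exp (L * t) *\<^sub>R G \<phi> t"
      by (simp add: X_def)
    then show ?thesis
      by (simp add: G_def exp_minus)
  qed
  show thesis
    by (rule that[OF X eq])
qed

text \<open>
  Past and future of a trajectory are kept in one function on \<open>[0, T]\<close>: the state at time \<open>\<sigma>\<close> is
  \<open>W \<sigma>\<close> together with the restriction of \<open>W\<close> to \<open>[0, \<sigma>]\<close>, and both memory integrals of the state equation merge into \<^term>\<open>drift W\<close>.
\<close>

definition trajectory :: "real \<Rightarrow> (real \<Rightarrow> real^'m) \<Rightarrow> (real \<Rightarrow> real^'d) \<Rightarrow> bool" where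
  "trajectory \<sigma> u W \<longleftrightarrow> continuous_on {0..T} W \<and> u \<in> L2 \<sigma> T \<and>
     (\<forall>t\<in>{\<sigma>..T}. W t = W \<sigma> + integral {\<sigma>..t} (drift W) + integral {\<sigma>..t} (\<lambda>s. B *v u s))"

lemma trajectoryD:
  assumes "trajectory \<sigma> u W"
  shows "continuous_on {0..T} W" "u \<in> L2 \<sigma> T"
    "\<And>t. t \<in> {\<sigma>..T} \<Longrightarrow> W t = W \<sigma> + integral {\<sigma>..t} (drift W) + integral {\<sigma>..t} (\<lambda>s. B *v u s)"
  using assms unfolding trajectory_def by blast+

lemma control_integrable:
  "u \<in> L2 \<sigma> T \<Longrightarrow> {a..b} \<subseteq> {\<sigma>..T} \<Longrightarrow> (\<lambda>s. B *v u s) integrable_on {a..b}"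
  by (intro L2_integrable_on L2_subinterval[OF L2_matrix_vector_mult])

lemma trajectory_exists:
  assumes \<tau>: "\<tau> \<in> {0..T}" and u: "u \<in> L2 \<tau> T" and x: "continuous_on {0..\<tau>} x"
  obtains W where "trajectory \<tau> u W" "\<And>s. s \<in> {0..\<tau>} \<Longrightarrow> W s = x s"
proof -
  define F where "F t = x (min t \<tau>) + integral {\<tau>..t} (\<lambda>s. B *v u s)" for t
  have "continuous_on {0..T} F"
    unfolding F_def
  proof (intro continuous_intros)
    show "continuous_on {0..T} (\<lambda>t. x (min t \<tau>))"
      by (rule continuous_on_compose2[OF x]) (use \<tau> in \<open>auto intro!: continuous_intros\<close>)
    show "continuous_on {0..T} (\<lambda>t. integral {\<tau>..t} (\<lambda>s. B *v u s))"
      by (intro continuous_on_subset[OF continuous_on_indefinite_integral[where T=T]]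
          control_integrable[OF u]) auto
  qed
  moreover have "0 \<le> \<tau>"
    using \<tau> by simp
  ultimately obtain W where W: "continuous_on {0..T} W"
    "\<And>t. t \<in> {0..T} \<Longrightarrow> W t = F t + integral {\<tau>..t} (drift W)"
    by (rule integral_equation_solvable) blast
  have past: "W s = x s" if "s \<in> {0..\<tau>}" for s
    using W(2)[of s] that \<tau> by (cases "s = \<tau>") (auto simp: F_def)
  have "trajectory \<tau> u W"
    unfolding trajectory_def
  proof (intro conjI ballI W u)
    fix t assume t: "t \<in> {\<tau>..T}"
    then show "W t = W \<tau> + integral {\<tau>..t} (drift W) + integral {\<tau>..t} (\<lambda>s. B *v u s)"
      using W(2)[of t] \<tau> past[of \<tau>] by (simp add: F_def min_absorb2)
  qed
  with past show thesis
    using that by blast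
qed

lemma trajectory_add_scaleR:
  assumes \<sigma>: "0 \<le> \<sigma>" and W: "trajectory \<sigma> u W" and Z: "trajectory \<sigma> v Z"
  shows "trajectory \<sigma> (\<lambda>t. u t + c *\<^sub>R v t) (\<lambda>t. W t + c *\<^sub>R Z t)"
  unfolding trajectory_def
proof (intro conjI ballI L2_add_scaleR trajectoryD(2)[OF W] trajectoryD(2)[OF Z])
  note W' = trajectoryD[OF W] and Z' = trajectoryD[OF Z]
  show "continuous_on {0..T} (\<lambda>t. W t + c *\<^sub>R Z t)"
    by (intro continuous_intros W' Z')
  fix t assume t: "t \<in> {\<sigma>..T}"
  have "integral {\<sigma>..t} (drift (\<lambda>t. W t + c *\<^sub>R Z t))
      = integral {\<sigma>..t} (\<lambda>s. drift W s + c *\<^sub>R drift Z s)"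
    using t \<sigma> by (intro integral_cong drift_add_scaleR W' Z') auto
  also have "\<dots> = integral {\<sigma>..t} (drift W) + c *\<^sub>R integral {\<sigma>..t} (drift Z)"
    using t \<sigma> by (subst integral_add) (auto intro!: integrable_cmul drift_integrable W' Z')
  finally have 1: "integral {\<sigma>..t} (drift (\<lambda>t. W t + c *\<^sub>R Z t)) = \<dots>" .
  have "integral {\<sigma>..t} (\<lambda>s. B *v (u s + c *\<^sub>R v s))
      = integral {\<sigma>..t} (\<lambda>s. B *v u s + c *\<^sub>R (B *v v s))"
    by (simp add: matrix_vector_right_distrib matrix_vector_mult_scaleR)
  also have "\<dots> = integral {\<sigma>..t} (\<lambda>s. B *v u s) + c *\<^sub>R integral {\<sigma>..t} (\<lambda>s. B *v v s)"
    using t by (subst integral_add) (auto intro!: integrable_cmul control_integrable W' Z')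
  finally have 2: "integral {\<sigma>..t} (\<lambda>s. B *v (u s + c *\<^sub>R v s)) = \<dots>" .
  show "W t + c *\<^sub>R Z t = W \<sigma> + c *\<^sub>R Z \<sigma> + integral {\<sigma>..t} (drift (\<lambda>t. W t + c *\<^sub>R Z t)) +
      integral {\<sigma>..t} (\<lambda>s. B *v (u s + c *\<^sub>R v s))"
    unfolding 1 2 by (subst W'(3)[OF t], subst Z'(3)[OF t]) (simp only: scaleR_add_right add_ac)
qed

lemma trajectory_zero: "trajectory \<sigma> (\<lambda>_. 0) (\<lambda>_. 0)"
proof -
  have "(\<lambda>_. 0) \<in> L2 \<sigma> T"
    by (rule continuous_on_imp_L2) simp
  moreover have "drift (\<lambda>_. 0) = (\<lambda>_. 0)"
    by (simp add: drift_def fun_eq_iff)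
  ultimately show ?thesis
    by (simp add: trajectory_def)
qed

lemma trajectory_later:
  assumes "0 \<le> \<tau>" "\<tau> \<le> \<sigma>" "\<sigma> \<le> T" and W: "trajectory \<tau> u W"
  shows "trajectory \<sigma> u W"
  unfolding trajectory_def
proof (intro conjI ballI trajectoryD(1)[OF W] L2_subinterval[OF trajectoryD(2)[OF W]])
  note W' = trajectoryD[OF W]
  show "{\<sigma>..T} \<subseteq> {\<tau>..T}"
    using assms by auto
  fix t assume t: "t \<in> {\<sigma>..T}"
  have 1: "integral {\<tau>..\<sigma>} (drift W) + integral {\<sigma>..t} (drift W) = integral {\<tau>..t} (drift W)"
    using t assms
    by (intro Henstock_Kurzweil_Integration.integral_combine drift_integrable W') auto
  have 2: "integral {\<tau>..\<sigma>} (\<lambda>s. B *v u s) + integral {\<sigma>..t} (\<lambda>s. B *v u s)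
      = integral {\<tau>..t} (\<lambda>s. B *v u s)"
    using t assms
    by (intro Henstock_Kurzweil_Integration.integral_combine control_integrable[OF W'(2)]) auto
  have "t \<in> {\<tau>..T}" "\<sigma> \<in> {\<tau>..T}"
    using t assms(2,3) by auto
  from this[THEN W'(3)]
  show "W t = W \<sigma> + integral {\<sigma>..t} (drift W) + integral {\<sigma>..t} (\<lambda>s. B *v u s)"
    by (simp only: 1[symmetric] 2[symmetric] add_ac)
qed

lemma trajectory_earlier:
  assumes "0 \<le> \<tau>" "\<tau> \<le> \<sigma>" "\<sigma> \<le> T" and Z: "trajectory \<sigma> v Z" and past: "\<And>s. s \<in> {0..\<sigma>} \<Longrightarrow> Z s = 0"
  shows "trajectory \<tau> (\<lambda>t. if t < \<sigma> then 0 else v t) Z" (is "trajectory \<tau> ?v Z")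
  unfolding trajectory_def
proof (intro conjI ballI trajectoryD(1)[OF Z] L2_if_less trajectoryD(2)[OF Z] assms(2))
  note Z' = trajectoryD[OF Z]
  fix t assume t: "t \<in> {\<tau>..T}"
  have v: "?v \<in> L2 \<tau> T"
    by (intro L2_if_less Z' assms(2))
  have d0: "integral {\<tau>..r} (drift Z) = 0" if "r \<le> \<sigma>" for r
  proof -
    have "drift Z s = 0" if "s \<in> {\<tau>..r}" for s
    proof -
      have "integral {0..s} (\<lambda>q. N (s - q) *v Z q) = integral {0..s} (\<lambda>_. 0)"
        using that \<open>r \<le> \<sigma>\<close> assms(1) by (intro integral_cong) (auto simp: past)
      then show ?thesis
        using that \<open>r \<le> \<sigma>\<close> assms(1) past[of s] by (simp add: drift_def)
    qed
    then show ?thesis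
      using integral_cong[of "{\<tau>..r}" "drift Z" "\<lambda>_. 0"] by simp
  qed
  have c0: "integral {\<tau>..r} (\<lambda>s. B *v ?v s) = 0" if "r \<le> \<sigma>" for r
  proof -
    have "integral {\<tau>..r} (\<lambda>s. B *v ?v s) = integral {\<tau>..r} (\<lambda>_. 0)"
      by (rule integral_spike[of "{\<sigma>}"]) (use that in auto)
    then show ?thesis
      by simp
  qed
  have Z\<tau>: "Z \<tau> = 0"
    using past assms by auto
  show "Z t = Z \<tau> + integral {\<tau>..t} (drift Z) + integral {\<tau>..t} (\<lambda>s. B *v ?v s)"
  proof (cases "t \<le> \<sigma>")
    case True
    then show ?thesis
      using t past[of t] assms(1) by (simp add: Z\<tau> d0 c0)
  next
    case False
    have 1: "integral {\<tau>..\<sigma>} (drift Z) + integral {\<sigma>..t} (drift Z) = integral {\<tau>..t} (drift Z)"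
      using t assms False
      by (intro Henstock_Kurzweil_Integration.integral_combine drift_integrable Z') auto
    have 2: "integral {\<tau>..\<sigma>} (\<lambda>s. B *v ?v s) + integral {\<sigma>..t} (\<lambda>s. B *v ?v s)
        = integral {\<tau>..t} (\<lambda>s. B *v ?v s)"
      using t assms False
      by (intro Henstock_Kurzweil_Integration.integral_combine control_integrable[OF v]) auto
    have 3: "integral {\<sigma>..t} (\<lambda>s. B *v ?v s) = integral {\<sigma>..t} (\<lambda>s. B *v v s)"
      by (intro integral_cong) auto
    have "Z \<sigma> = 0" "t \<in> {\<sigma>..T}"
      using past assms t False by auto
    then show ?thesis
      unfolding 1[symmetric] 2[symmetric] 3 d0[OF order_refl] c0[OF order_refl] Z\<tau> using Z'(3)[of t] by (simp only: add_0_left)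
  qed
qed

lemma memory_split:
  assumes W: "continuous_on {0..T} W" and x: "\<And>s. s \<in> {0..\<tau>} \<Longrightarrow> W s = x s"
    and w: "\<And>s. s \<in> {\<tau>..T} \<Longrightarrow> W s = w s" and \<tau>: "0 \<le> \<tau>" and t: "t \<in> {\<tau>..T}"
  shows "drift W t = A *v w t + (LBINT s:{\<tau>..t}. N (t - s) *v w s) + (LBINT s:{0..\<tau>}. N (t - s) *v x s)"
proof -
  have c: "continuous_on {0..t} (\<lambda>s. N (t - s) *v W s)"
    using t \<tau> by (intro memory_continuous_on W) auto
  have conv: "(LBINT s:{a..b}. N (t - s) *v W s) = integral {a..b} (\<lambda>s. N (t - s) *v W s)"
    if "{a..b} \<subseteq> {0..t}" for a b
    by (intro set_borel_integral_eq_integral(2) borel_integrable_atLeastAtMost'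
        continuous_on_subset[OF c that])
  have "(LBINT s:{\<tau>..t}. N (t - s) *v w s) = (LBINT s:{\<tau>..t}. N (t - s) *v W s)"
    using t w by (intro set_lebesgue_integral_cong) auto
  also have "\<dots> = integral {\<tau>..t} (\<lambda>s. N (t - s) *v W s)"
    using \<tau> by (intro conv) auto
  finally have 1: "(LBINT s:{\<tau>..t}. N (t - s) *v w s) = \<dots>" .
  have "(LBINT s:{0..\<tau>}. N (t - s) *v x s) = (LBINT s:{0..\<tau>}. N (t - s) *v W s)"
    using x by (intro set_lebesgue_integral_cong) auto
  also have "\<dots> = integral {0..\<tau>} (\<lambda>s. N (t - s) *v W s)"
    using t by (intro conv) auto
  finally have 2: "(LBINT s:{0..\<tau>}. N (t - s) *v x s) = \<dots>" .
  have "integral {0..\<tau>} (\<lambda>s. N (t - s) *v W s) + integral {\<tau>..t} (\<lambda>s. N (t - s) *v W s)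
      = integral {0..t} (\<lambda>s. N (t - s) *v W s)"
    using t \<tau> by (intro Henstock_Kurzweil_Integration.integral_combine integrable_continuous_real c) auto
  then show ?thesis
    unfolding drift_def 1 2 using w[OF t] by (simp add: add_ac)
qed

lemma drift_control_L2:
  assumes "0 \<le> \<tau>" "continuous_on {0..T} W" "u \<in> L2 \<tau> T"
  shows "(\<lambda>s. drift W s + B *v u s) \<in> L2 \<tau> T"
proof -
  have "continuous_on {\<tau>..T} (drift W)"
    using assms(1) by (intro continuous_on_subset[OF drift_continuous_on] assms(2)) auto
  from L2_add_scaleR[OF continuous_on_imp_L2[OF this] L2_matrix_vector_mult[OF assms(3), of B], where c=1]
  show ?thesis
    by simp
qed

lemma drift_control_integral:
  assumes "0 \<le> \<tau>" "continuous_on {0..T} W" "u \<in> L2 \<tau> T" "t \<in> {\<tau>..T}"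
  shows "(LBINT s:{\<tau>..t}. drift W s + B *v u s)
    = integral {\<tau>..t} (drift W) + integral {\<tau>..t} (\<lambda>s. B *v u s)"
proof -
  have "(LBINT s:{\<tau>..t}. drift W s + B *v u s) = integral {\<tau>..t} (\<lambda>s. drift W s + B *v u s)"
    using assms(4) by (intro set_borel_integral_eq_integral(2) L2_imp_set_integrable
        L2_subinterval[OF drift_control_L2[OF assms(1-3)]]) auto
  also have "\<dots> = integral {\<tau>..t} (drift W) + integral {\<tau>..t} (\<lambda>s. B *v u s)"
    using assms by (intro integral_add drift_integrable control_integrable[OF assms(3)]) auto
  finally show ?thesis .
qed

lemma trajectory_imp_solution:
  assumes \<tau>: "\<tau> \<in> {0..T}" and W: "trajectory \<tau> u W" and x: "\<And>s. s \<in> {0..\<tau>} \<Longrightarrow> W s = x s"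
  shows "is_solution T A B N \<tau> (x \<tau>, x) u W"
  unfolding is_solution_def
proof (intro conjI exI[of _ "\<lambda>s. drift W s + B *v u s"])
  note W' = trajectoryD[OF W]
  show "W \<tau> = fst (x \<tau>, x)"
    using x \<tau> by auto
  show "H1_deriv \<tau> T W (\<lambda>s. drift W s + B *v u s)"
    unfolding H1_deriv_def
  proof (intro conjI ballI)
    show "(\<lambda>s. drift W s + B *v u s) \<in> L2 \<tau> T"
      using \<tau> by (intro drift_control_L2 W') auto
    fix t assume t: "t \<in> {\<tau>..T}"
    have "(LBINT s:{\<tau>..t}. drift W s + B *v u s)
        = integral {\<tau>..t} (drift W) + integral {\<tau>..t} (\<lambda>s. B *v u s)"
      using \<tau> t by (intro drift_control_integral W') auto
    then show "W t = W \<tau> + (LBINT s:{\<tau>..t}. drift W s + B *v u s)"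
      using W'(3)[OF t] by simp
  qed
  show "AE t\<in>{\<tau>..T} in lborel. drift W t + B *v u t =
      A *v W t + (LBINT s:{\<tau>..t}. N (t - s) *v W s) + B *v u t
      + (LBINT s:{0..\<tau>}. N (t - s) *v snd (x \<tau>, x) s)"
    using \<tau> x by (intro AE_I2 impI) (subst memory_split[OF W'(1), of \<tau> x W]; simp)
qed

lemma solution_imp_trajectory:
  assumes \<tau>: "\<tau> \<in> {0..T}" and u: "u \<in> L2 \<tau> T" and x: "continuous_on {0..\<tau>} x"
    and sol: "is_solution T A B N \<tau> (x \<tau>, x) u w"
  shows "trajectory \<tau> u (\<lambda>t. if t \<le> \<tau> then x t else w t)" (is "trajectory \<tau> u ?W")
proof -
  obtain w' where w': "w' \<in> L2 \<tau> T" "\<And>t. t \<in> {\<tau>..T} \<Longrightarrow> w t = w \<tau> + (LBINT s:{\<tau>..t}. w' s)"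
    and H1: "w \<in> H1 \<tau> T"
    and ae: "AE t\<in>{\<tau>..T} in lborel. w' t = A *v w t + (LBINT s:{\<tau>..t}. N (t - s) *v w s) + B *v u t
               + (LBINT s:{0..\<tau>}. N (t - s) *v x s)"
    and w\<tau>: "w \<tau> = x \<tau>"
    using sol unfolding is_solution_def H1_def H1_deriv_def fst_conv snd_conv mem_Collect_eq by blast
  have "continuous_on ({0..\<tau>} \<union> {\<tau>..T}) ?W"
    using H1_imp_continuous_on[OF H1] x w\<tau> by (intro continuous_on_If) auto
  moreover have "{0..\<tau>} \<union> {\<tau>..T} = {0..T}"
    using \<tau> by auto
  ultimately have W: "continuous_on {0..T} ?W"
    by simp
  have eq: "?W t = w t" if "t \<in> {\<tau>..T}" for t
    using that w\<tau> by auto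
  have "AE t\<in>{\<tau>..T} in lborel. w' t = drift ?W t + B *v u t"
    using ae
  proof eventually_elim
    case (elim t)
    show ?case
    proof
      assume t: "t \<in> {\<tau>..T}"
      show "w' t = drift ?W t + B *v u t"
        using elim t \<tau> w\<tau> by (subst memory_split[OF W, of \<tau> x w]) (auto simp: eq)
    qed
  qed
  note ae' = this
  show ?thesis
    unfolding trajectory_def
  proof (intro conjI ballI W u)
    fix t assume t: "t \<in> {\<tau>..T}"
    have "(LBINT s:{\<tau>..t}. w' s) = (LBINT s:{\<tau>..t}. drift ?W s + B *v u s)"
      unfolding set_lebesgue_integral_def
    proof (rule integral_cong_AE)
      have "w' \<in> L2 \<tau> t" "(\<lambda>s. drift ?W s + B *v u s) \<in> L2 \<tau> t"
        using t \<tau> by (auto intro!: L2_subinterval[OF w'(1)] L2_subinterval[OF drift_control_L2[OF _ W u]])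
      then show "(\<lambda>s. indicator {\<tau>..t} s *\<^sub>R w' s) \<in> borel_measurable lborel"
        "(\<lambda>s. indicator {\<tau>..t} s *\<^sub>R (drift ?W s + B *v u s)) \<in> borel_measurable lborel"
        by (simp_all only: L2_def set_borel_measurable_def mem_Collect_eq)
      show "AE s in lborel. indicator {\<tau>..t} s *\<^sub>R w' s = indicator {\<tau>..t} s *\<^sub>R (drift ?W s + B *v u s)"
        using ae' by eventually_elim (use t in \<open>auto simp: indicator_def\<close>)
    qed
    also have "\<dots> = integral {\<tau>..t} (drift ?W) + integral {\<tau>..t} (\<lambda>s. B *v u s)"
      using \<tau> t by (intro drift_control_integral W u) auto
    finally show "?W t = ?W \<tau> + integral {\<tau>..t} (drift ?W) + integral {\<tau>..t} (\<lambda>s. B *v u s)"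
      using w'(2)[OF t] eq[OF t] w\<tau> by simp
  qed
qed

end

lemma quadratic_nonneg_imp:
  fixes a g q :: real
  assumes "\<And>s. 0 \<le> a + 2 * s * g + s\<^sup>2 * q" "0 \<le> q"
  shows "\<bar>g\<bar> \<le> sqrt a * sqrt q"
proof -
  have "g\<^sup>2 \<le> a * q"
  proof (cases "q = 0")
    case True
    have "g = 0"
    proof (rule ccontr)
      assume "g \<noteq> 0"
      then show False
        using assms(1)[of "- (a + 1) / (2 * g)"] True by (simp add: field_simps)
    qed
    with True show ?thesis
      by simp
  next
    case False
    then have "0 < q"
      using assms(2) by simp
    have "0 \<le> a + 2 * (- g / q) * g + (- g / q)\<^sup>2 * q"
      by (rule assms(1))
    also have "\<dots> = a - g\<^sup>2 / q"
      using False by (simp add: power2_eq_square field_simps)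
    finally show ?thesis
      using \<open>0 < q\<close> by (simp add: field_simps)
  qed
  then have "sqrt (g\<^sup>2) \<le> sqrt (a * q)"
    by (rule real_sqrt_le_mono)
  then show ?thesis
    by (simp add: real_sqrt_mult)
qed

section \<open>The quadratic cost\<close>

context tracking_problem
begin

definition ip :: "real \<Rightarrow> (real \<Rightarrow> real^'m) \<Rightarrow> (real \<Rightarrow> real^'d) \<Rightarrow> (real \<Rightarrow> real^'m) \<Rightarrow> (real \<Rightarrow> real^'d) \<Rightarrow> real"
  where "ip \<sigma> u W v Z = integral {\<sigma>..T} (\<lambda>t. (C *v W t) \<bullet> (C *v Z t) + u t \<bullet> v t)"

definition lin :: "real \<Rightarrow> (real \<Rightarrow> real^'d) \<Rightarrow> real"
  where "lin \<sigma> W = - integral {\<sigma>..T} (\<lambda>t. (C *v W t) \<bullet> y t)"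

definition cst :: "real \<Rightarrow> real"
  where "cst \<sigma> = integral {\<sigma>..T} (\<lambda>t. y t \<bullet> y t)"

definition J :: "real \<Rightarrow> (real \<Rightarrow> real^'m) \<Rightarrow> (real \<Rightarrow> real^'d) \<Rightarrow> real"
  where "J \<sigma> u W = ip \<sigma> u W u W + 2 * lin \<sigma> W + cst \<sigma>"

lemma output_continuous_on:
  assumes "continuous_on {0..T} W" "{a..b} \<subseteq> {0..T}"
  shows "continuous_on {a..b} (\<lambda>t. C *v W t)"
  by (intro continuous_intros continuous_on_subset[OF assms])

lemma ip_integrable:
  assumes "0 \<le> \<sigma>" "trajectory \<sigma> u W" "trajectory \<sigma> v Z" "{a..b} \<subseteq> {\<sigma>..T}"
  shows "(\<lambda>t. (C *v W t) \<bullet> (C *v Z t) + u t \<bullet> v t) integrable_on {a..b}"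
proof (rule integrable_subinterval_real[OF _ assms(4)])
  have "{\<sigma>..T} \<subseteq> {0..T}"
    using assms(1) by auto
  then show "(\<lambda>t. (C *v W t) \<bullet> (C *v Z t) + u t \<bullet> v t) integrable_on {\<sigma>..T}"
    by (intro integrable_add L2_inner_integrable_on[OF trajectoryD(2)[OF assms(2)] trajectoryD(2)[OF assms(3)]]
        L2_inner_integrable_on[OF continuous_on_imp_L2 continuous_on_imp_L2]
        output_continuous_on trajectoryD(1)[OF assms(2)] trajectoryD(1)[OF assms(3)])
qed

lemma lin_integrable:
  assumes "continuous_on {0..T} W" "{a..b} \<subseteq> {0..T}"
  shows "(\<lambda>t. (C *v W t) \<bullet> y t) integrable_on {a..b}"
  by (intro integrable_continuous_real continuous_intros output_continuous_on assms
      continuous_on_subset[OF y_cont])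

lemma ip_commute: "ip \<sigma> u W v Z = ip \<sigma> v Z u W"
  by (simp add: ip_def inner_commute)

lemma ip_add_left:
  assumes "0 \<le> \<sigma>" "trajectory \<sigma> u W" "trajectory \<sigma> u' W'" "trajectory \<sigma> v Z"
  shows "ip \<sigma> (\<lambda>t. u t + c *\<^sub>R u' t) (\<lambda>t. W t + c *\<^sub>R W' t) v Z = ip \<sigma> u W v Z + c * ip \<sigma> u' W' v Z"
proof -
  have "ip \<sigma> (\<lambda>t. u t + c *\<^sub>R u' t) (\<lambda>t. W t + c *\<^sub>R W' t) v Z
      = integral {\<sigma>..T} (\<lambda>t. ((C *v W t) \<bullet> (C *v Z t) + u t \<bullet> v t)
          + c * ((C *v W' t) \<bullet> (C *v Z t) + u' t \<bullet> v t))"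
    unfolding ip_def
    by (simp add: matrix_vector_right_distrib matrix_vector_mult_scaleR inner_add_left algebra_simps)
  also have "\<dots> = ip \<sigma> u W v Z + c * ip \<sigma> u' W' v Z"
    unfolding ip_def
    by (subst integral_add) (auto intro!: integrable_cmul[where 'b=real, unfolded real_scaleR_def] ip_integrable assms)
  finally show ?thesis .
qed

lemma ip_add_right:
  assumes "0 \<le> \<sigma>" "trajectory \<sigma> u W" "trajectory \<sigma> u' W'" "trajectory \<sigma> v Z"
  shows "ip \<sigma> v Z (\<lambda>t. u t + c *\<^sub>R u' t) (\<lambda>t. W t + c *\<^sub>R W' t) = ip \<sigma> v Z u W + c * ip \<sigma> v Z u' W'"
  using ip_add_left[OF assms] by (simp add: ip_commute)

lemma ip_square:
  assumes "0 \<le> \<sigma>" "trajectory \<sigma> u W" "trajectory \<sigma> v Z"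
  shows "ip \<sigma> (\<lambda>t. u t + c *\<^sub>R v t) (\<lambda>t. W t + c *\<^sub>R Z t) (\<lambda>t. u t + c *\<^sub>R v t) (\<lambda>t. W t + c *\<^sub>R Z t)
    = ip \<sigma> u W u W + 2 * c * ip \<sigma> u W v Z + c\<^sup>2 * ip \<sigma> v Z v Z"
  unfolding ip_add_left[OF assms trajectory_add_scaleR[OF assms]]
    ip_add_right[OF assms assms(2)] ip_add_right[OF assms assms(3)] ip_commute[of \<sigma> v Z u W]
  by (simp add: algebra_simps power2_eq_square)

lemma ip_nonneg:
  assumes "0 \<le> \<sigma>" "trajectory \<sigma> u W"
  shows "0 \<le> ip \<sigma> u W u W"
  unfolding ip_def by (intro integral_nonneg ip_integrable[OF assms(1)] assms) auto

lemma ip_diff_le: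
  assumes "0 \<le> \<sigma>" "trajectory \<sigma> u W" "trajectory \<sigma> v Z"
  shows "ip \<sigma> (\<lambda>t. u t + (-1) *\<^sub>R v t) (\<lambda>t. W t + (-1) *\<^sub>R Z t) (\<lambda>t. u t + (-1) *\<^sub>R v t) (\<lambda>t. W t + (-1) *\<^sub>R Z t)
    \<le> 2 * ip \<sigma> u W u W + 2 * ip \<sigma> v Z v Z"
  using ip_nonneg[OF assms(1) trajectory_add_scaleR[OF assms, of 1]]
  unfolding ip_square[OF assms] by simp

lemma lin_add:
  assumes "0 \<le> \<sigma>" "trajectory \<sigma> u W" "trajectory \<sigma> v Z"
  shows "lin \<sigma> (\<lambda>t. W t + c *\<^sub>R Z t) = lin \<sigma> W + c * lin \<sigma> Z"
proof -
  have sub: "{\<sigma>..T} \<subseteq> {0..T}"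
    using assms(1) by auto
  have "integral {\<sigma>..T} (\<lambda>t. (C *v (W t + c *\<^sub>R Z t)) \<bullet> y t)
      = integral {\<sigma>..T} (\<lambda>t. (C *v W t) \<bullet> y t + c * ((C *v Z t) \<bullet> y t))"
    by (simp add: matrix_vector_right_distrib matrix_vector_mult_scaleR inner_add_left)
  also have "\<dots> = integral {\<sigma>..T} (\<lambda>t. (C *v W t) \<bullet> y t) + c * integral {\<sigma>..T} (\<lambda>t. (C *v Z t) \<bullet> y t)"
    by (subst integral_add)
      (auto intro!: integrable_cmul[where 'b=real, unfolded real_scaleR_def] lin_integrable[OF _ sub] trajectoryD(1)[OF assms(2)]
        trajectoryD(1)[OF assms(3)])
  finally show ?thesis
    by (simp add: lin_def)
qed

lemma J_add:
  assumes "0 \<le> \<sigma>" "trajectory \<sigma> u W" "trajectory \<sigma> v Z"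
  shows "J \<sigma> (\<lambda>t. u t + c *\<^sub>R v t) (\<lambda>t. W t + c *\<^sub>R Z t)
    = J \<sigma> u W + 2 * c * (ip \<sigma> u W v Z + lin \<sigma> Z) + c\<^sup>2 * ip \<sigma> v Z v Z"
  unfolding J_def ip_square[OF assms] lin_add[OF assms] by (simp add: algebra_simps)

lemma J_eq_integral:
  assumes "0 \<le> \<sigma>" "trajectory \<sigma> u W"
  shows "((\<lambda>t. (norm (C *v W t - y t))\<^sup>2 + (norm (u t))\<^sup>2) has_integral J \<sigma> u W) {\<sigma>..T}"
proof -
  have sub: "{\<sigma>..T} \<subseteq> {0..T}"
    using assms(1) by auto
  have "((\<lambda>t. ((C *v W t) \<bullet> (C *v W t) + u t \<bullet> u t) + 2 * - ((C *v W t) \<bullet> y t) + y t \<bullet> y t)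
      has_integral (ip \<sigma> u W u W + 2 * lin \<sigma> W + cst \<sigma>)) {\<sigma>..T}"
    unfolding ip_def lin_def cst_def
    by (intro has_integral_add has_integral_mult_right has_integral_neg integrable_integral
        ip_integrable[OF assms(1)] lin_integrable sub trajectoryD(1)[OF assms(2)] assms order_refl
        integrable_continuous_real continuous_intros continuous_on_subset[OF y_cont])
  then show ?thesis
    unfolding J_def
    by (rule has_integral_eq[rotated])
      (simp add: power2_norm_eq_inner inner_diff_left inner_diff_right inner_commute)
qed

lemma cost_eq:
  assumes "0 \<le> \<sigma>" "trajectory \<sigma> u W"
  shows "cost T C y \<sigma> u W = J \<sigma> u W"
proof -
  have sub: "{\<sigma>..T} \<subseteq> {0..T}"
    using assms(1) by auto
  have "set_integrable lborel {\<sigma>..T} (\<lambda>t. (norm (u t))\<^sup>2)"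
    using trajectoryD(2)[OF assms(2)] by (simp add: L2_def)
  then have "set_integrable lborel {\<sigma>..T} (\<lambda>t. (norm (C *v W t - y t))\<^sup>2 + (norm (u t))\<^sup>2)"
    by (intro set_integral_add(1) borel_integrable_atLeastAtMost'[where f="\<lambda>t. (norm (C *v W t - y t))\<^sup>2"]
        continuous_intros output_continuous_on
        continuous_on_subset[OF y_cont] sub trajectoryD(1)[OF assms(2)])
  from set_borel_integral_eq_integral(2)[OF this] show ?thesis
    unfolding cost_def using J_eq_integral[OF assms] by (simp add: integral_unique)
qed

lemma J_nonneg: "0 \<le> \<sigma> \<Longrightarrow> trajectory \<sigma> u W \<Longrightarrow> 0 \<le> J \<sigma> u W"
  by (rule has_integral_nonneg[OF J_eq_integral]) auto

lemma cst_integrable: "{a..b} \<subseteq> {0..T} \<Longrightarrow> (\<lambda>t. y t \<bullet> y t) integrable_on {a..b}"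
  by (intro integrable_continuous_real continuous_intros continuous_on_subset[OF y_cont])

lemma cst_nonneg: "0 \<le> \<sigma> \<Longrightarrow> 0 \<le> cst \<sigma>"
  unfolding cst_def by (intro integral_nonneg cst_integrable) auto

lemma cst_antimono: "0 \<le> \<sigma> \<Longrightarrow> cst \<sigma> \<le> cst 0"
  unfolding cst_def by (intro integral_subset_le cst_integrable) auto

lemma ip_le_J:
  assumes "0 \<le> \<sigma>" "trajectory \<sigma> u W"
  shows "ip \<sigma> u W u W \<le> 2 * J \<sigma> u W + 2 * cst \<sigma>"
proof (rule has_integral_le)
  have sub: "{\<sigma>..T} \<subseteq> {0..T}"
    using assms(1) by auto
  show "((\<lambda>t. (C *v W t) \<bullet> (C *v W t) + u t \<bullet> u t) has_integral ip \<sigma> u W u W) {\<sigma>..T}"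
    unfolding ip_def by (intro integrable_integral ip_integrable[OF assms(1)] assms order_refl)
  show "((\<lambda>t. 2 * ((norm (C *v W t - y t))\<^sup>2 + (norm (u t))\<^sup>2) + 2 * (y t \<bullet> y t))
      has_integral (2 * J \<sigma> u W + 2 * cst \<sigma>)) {\<sigma>..T}"
    unfolding cst_def
    by (intro has_integral_add has_integral_mult_right J_eq_integral assms integrable_integral
        cst_integrable sub)
  fix t
  have "0 \<le> (C *v W t - 2 *\<^sub>R y t) \<bullet> (C *v W t - 2 *\<^sub>R y t)"
    by simp
  moreover have "0 \<le> u t \<bullet> u t"
    by simp
  ultimately show "(C *v W t) \<bullet> (C *v W t) + u t \<bullet> u t
      \<le> 2 * ((norm (C *v W t - y t))\<^sup>2 + (norm (u t))\<^sup>2) + 2 * (y t \<bullet> y t)"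
    unfolding power2_norm_eq_inner by (simp add: inner_diff_left inner_diff_right inner_commute)
qed

subsection \<open>The value and nearly optimal controls\<close>

definition V :: "real \<Rightarrow> (real \<Rightarrow> real^'d) \<Rightarrow> real"
  where "V \<sigma> x = optimal_value T A B C N y \<sigma> (x \<sigma>, x)"

lemma cost_nonneg: "0 \<le> cost T C y \<sigma> u w"
  unfolding cost_def set_lebesgue_integral_def by (intro Bochner_Integration.integral_nonneg) simp

lemma V_le_J:
  assumes "\<sigma> \<in> {0..T}" "trajectory \<sigma> u W" "\<And>s. s \<in> {0..\<sigma>} \<Longrightarrow> W s = x s"
  shows "V \<sigma> x \<le> J \<sigma> u W"
proof -
  have "V \<sigma> x \<le> cost T C y \<sigma> u W"
    unfolding V_def optimal_value_def
  proof (rule cInf_lower)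
    show "cost T C y \<sigma> u W \<in> {cost T C y \<sigma> u w |u w. u \<in> L2 \<sigma> T \<and> is_solution T A B N \<sigma> (x \<sigma>, x) u w}"
      using trajectory_imp_solution[OF assms] trajectoryD(2)[OF assms(2)] by blast
    show "bdd_below {cost T C y \<sigma> u w |u w. u \<in> L2 \<sigma> T \<and> is_solution T A B N \<sigma> (x \<sigma>, x) u w}"
      by (intro bdd_belowI[of _ 0]) (auto simp: cost_nonneg)
  qed
  then show ?thesis
    using assms by (simp add: cost_eq)
qed

lemma V_near:
  assumes \<sigma>: "\<sigma> \<in> {0..T}" and x: "continuous_on {0..\<sigma>} x" and "0 < e"
  obtains u W where "trajectory \<sigma> u W" "\<And>s. s \<in> {0..\<sigma>} \<Longrightarrow> W s = x s" "J \<sigma> u W \<le> V \<sigma> x + e"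
proof -
  let ?S = "{cost T C y \<sigma> u w |u w. u \<in> L2 \<sigma> T \<and> is_solution T A B N \<sigma> (x \<sigma>, x) u w}"
  have z: "(\<lambda>_. 0 :: real^'m) \<in> L2 \<sigma> T"
    by (rule continuous_on_imp_L2) simp
  obtain W where "trajectory \<sigma> (\<lambda>_. 0) W" "\<And>s. s \<in> {0..\<sigma>} \<Longrightarrow> W s = x s"
    by (rule trajectory_exists[OF \<sigma> z x]) blast
  then have "is_solution T A B N \<sigma> (x \<sigma>, x) (\<lambda>_. 0) W"
    by (rule trajectory_imp_solution[OF \<sigma>])
  then have "?S \<noteq> {}"
    using z by blast
  moreover have "Inf ?S < V \<sigma> x + e"
    using \<open>0 < e\<close> by (simp add: V_def optimal_value_def)
  ultimately have "\<exists>c\<in>?S. c < V \<sigma> x + e"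
    by (rule cInf_lessD)
  then obtain u w where u: "u \<in> L2 \<sigma> T" and sol: "is_solution T A B N \<sigma> (x \<sigma>, x) u w"
    and c: "cost T C y \<sigma> u w < V \<sigma> x + e"
    by blast
  let ?W = "\<lambda>t. if t \<le> \<sigma> then x t else w t"
  have W: "trajectory \<sigma> u ?W"
    by (rule solution_imp_trajectory[OF \<sigma> u x sol])
  have "w \<sigma> = x \<sigma>"
    using sol by (simp add: is_solution_def)
  then have "cost T C y \<sigma> u w = cost T C y \<sigma> u ?W"
    unfolding cost_def by (intro set_lebesgue_integral_cong) (auto simp: order.antisym)
  also have "\<dots> = J \<sigma> u ?W"
    using \<sigma> by (intro cost_eq W) auto
  finally have "J \<sigma> u ?W \<le> V \<sigma> x + e"
    using c by simp
  then show thesis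
    by (rule that[OF W, rotated]) simp
qed

lemma V_nonneg:
  assumes "\<sigma> \<in> {0..T}" "continuous_on {0..\<sigma>} x"
  shows "0 \<le> V \<sigma> x"
proof (rule field_le_epsilon)
  fix e :: real assume "0 < e"
  then obtain u W where "trajectory \<sigma> u W" "J \<sigma> u W \<le> V \<sigma> x + e"
    using V_near[OF assms] by blast
  then show "0 \<le> V \<sigma> x + e"
    using J_nonneg[of \<sigma> u W] assms(1) by auto
qed

definition null_past :: "real \<Rightarrow> (real \<Rightarrow> real^'d) \<Rightarrow> bool"
  where "null_past \<sigma> Z \<longleftrightarrow> (\<forall>s\<in>{0..\<sigma>}. Z s = 0)"

definition near_critical :: "real \<Rightarrow> (real \<Rightarrow> real^'m) \<Rightarrow> (real \<Rightarrow> real^'d) \<Rightarrow> real \<Rightarrow> bool"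
  where "near_critical \<sigma> u W \<delta> \<longleftrightarrow> (\<forall>v Z. trajectory \<sigma> v Z \<and> null_past \<sigma> Z \<longrightarrow>
    \<bar>ip \<sigma> u W v Z + lin \<sigma> Z\<bar> \<le> \<delta> * sqrt (ip \<sigma> v Z v Z))"

definition near_orthogonal :: "real \<Rightarrow> (real \<Rightarrow> real^'m) \<Rightarrow> (real \<Rightarrow> real^'d) \<Rightarrow> real \<Rightarrow> bool"
  where "near_orthogonal \<sigma> u W \<delta> \<longleftrightarrow> (\<forall>v Z. trajectory \<sigma> v Z \<and> null_past \<sigma> Z \<longrightarrow>
    \<bar>ip \<sigma> u W v Z\<bar> \<le> \<delta> * sqrt (ip \<sigma> v Z v Z))"

lemma near_optimal_imp_near_critical:
  assumes \<sigma>: "\<sigma> \<in> {0..T}" and W: "trajectory \<sigma> u W" and x: "\<And>s. s \<in> {0..\<sigma>} \<Longrightarrow> W s = x s"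
    and opt: "J \<sigma> u W \<le> V \<sigma> x + \<delta>\<^sup>2" and \<delta>: "0 \<le> \<delta>"
  shows "near_critical \<sigma> u W \<delta>"
  unfolding near_critical_def
proof (intro allI impI, elim conjE)
  fix v Z assume Z: "trajectory \<sigma> v Z" and past: "null_past \<sigma> Z"
  have \<sigma>0: "0 \<le> \<sigma>"
    using \<sigma> by simp
  have "\<bar>ip \<sigma> u W v Z + lin \<sigma> Z\<bar> \<le> sqrt (\<delta>\<^sup>2) * sqrt (ip \<sigma> v Z v Z)"
  proof (rule quadratic_nonneg_imp)
    show "0 \<le> ip \<sigma> v Z v Z"
      by (rule ip_nonneg[OF \<sigma>0 Z])
    fix c
    have "V \<sigma> x \<le> J \<sigma> (\<lambda>t. u t + c *\<^sub>R v t) (\<lambda>t. W t + c *\<^sub>R Z t)"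
      using past x by (intro V_le_J[OF \<sigma> trajectory_add_scaleR[OF \<sigma>0 W Z]]) (auto simp: null_past_def)
    then show "0 \<le> \<delta>\<^sup>2 + 2 * c * (ip \<sigma> u W v Z + lin \<sigma> Z) + c\<^sup>2 * ip \<sigma> v Z v Z"
      using opt unfolding J_add[OF \<sigma>0 W Z] by linarith
  qed
  then show "\<bar>ip \<sigma> u W v Z + lin \<sigma> Z\<bar> \<le> \<delta> * sqrt (ip \<sigma> v Z v Z)"
    using \<delta> by simp
qed

lemma near_critical_imp_near_optimal:
  assumes \<sigma>: "\<sigma> \<in> {0..T}" and W: "trajectory \<sigma> u W" and x: "\<And>s. s \<in> {0..\<sigma>} \<Longrightarrow> W s = x s"
    and crit: "near_critical \<sigma> u W \<delta>"
  shows "J \<sigma> u W \<le> V \<sigma> x + \<delta>\<^sup>2"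
proof (rule field_le_epsilon)
  fix e :: real assume "0 < e"
  have \<sigma>0: "0 \<le> \<sigma>"
    using \<sigma> by simp
  have "continuous_on {0..\<sigma>} W"
    using \<sigma> by (intro continuous_on_subset[OF trajectoryD(1)[OF W]]) auto
  then have "continuous_on {0..\<sigma>} x"
    by (rule continuous_on_eq) (rule x)
  then obtain u' W' where W': "trajectory \<sigma> u' W'" and x': "\<And>s. s \<in> {0..\<sigma>} \<Longrightarrow> W' s = x s"
    and e: "J \<sigma> u' W' \<le> V \<sigma> x + e"
    using V_near[OF \<sigma> _ \<open>0 < e\<close>] by metis
  define v where "v = (\<lambda>t. u' t + (-1) *\<^sub>R u t)"
  define Z where "Z = (\<lambda>t. W' t + (-1) *\<^sub>R W t)"
  have Z: "trajectory \<sigma> v Z"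
    unfolding v_def Z_def by (rule trajectory_add_scaleR[OF \<sigma>0 W' W])
  have "null_past \<sigma> Z"
    using x x' by (simp add: null_past_def Z_def)
  then have crit': "\<bar>ip \<sigma> u W v Z + lin \<sigma> Z\<bar> \<le> \<delta> * sqrt (ip \<sigma> v Z v Z)"
    using crit Z by (simp add: near_critical_def)
  have "u' = (\<lambda>t. u t + 1 *\<^sub>R v t)" "W' = (\<lambda>t. W t + 1 *\<^sub>R Z t)"
    by (simp_all add: v_def Z_def)
  then have "J \<sigma> u' W' = J \<sigma> u W + 2 * (ip \<sigma> u W v Z + lin \<sigma> Z) + (sqrt (ip \<sigma> v Z v Z))\<^sup>2"
    using J_add[OF \<sigma>0 W Z, of 1] ip_nonneg[OF \<sigma>0 Z] by simp
  moreover have "2 * (\<delta> * sqrt (ip \<sigma> v Z v Z)) \<le> \<delta>\<^sup>2 + (sqrt (ip \<sigma> v Z v Z))\<^sup>2"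
    using zero_le_power2[of "\<delta> - sqrt (ip \<sigma> v Z v Z)"] unfolding power2_diff by linarith
  moreover note e abs_le_D2[OF crit']
  ultimately show "J \<sigma> u W \<le> V \<sigma> x + \<delta>\<^sup>2 + e"
    by (simp add: algebra_simps)
qed

text \<open>
  The difference of nearly optimal pairs for the data \<open>x\<close> and \<open>0\<close> is nearly optimal for the data
  \<open>x\<close> and the target \<open>y = 0\<close>.
\<close>

lemma near_orthogonal_exists:
  assumes \<sigma>: "\<sigma> \<in> {0..T}" and x: "continuous_on {0..\<sigma>} x" and \<delta>: "0 < \<delta>" "\<delta> \<le> 1"
  obtains u W where "trajectory \<sigma> u W" "\<And>s. s \<in> {0..\<sigma>} \<Longrightarrow> W s = x s" "near_orthogonal \<sigma> u W \<delta>"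
    "ip \<sigma> u W u W \<le> 4 * (V \<sigma> x + V \<sigma> (\<lambda>_. 0)) + 8 * cst \<sigma> + 8"
proof -
  have \<sigma>0: "0 \<le> \<sigma>"
    using \<sigma> by simp
  have e: "0 < (\<delta> / 2)\<^sup>2" "(\<delta> / 2)\<^sup>2 \<le> 1"
    using \<delta> power_le_one[of "\<delta> / 2" 2] by auto
  obtain u1 W1 where W1: "trajectory \<sigma> u1 W1" "\<And>s. s \<in> {0..\<sigma>} \<Longrightarrow> W1 s = x s"
      "J \<sigma> u1 W1 \<le> V \<sigma> x + (\<delta> / 2)\<^sup>2"
    using V_near[OF \<sigma> x e(1)] by metis
  obtain u0 W0 where W0: "trajectory \<sigma> u0 W0" "\<And>s. s \<in> {0..\<sigma>} \<Longrightarrow> W0 s = 0"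
      "J \<sigma> u0 W0 \<le> V \<sigma> (\<lambda>_. 0) + (\<delta> / 2)\<^sup>2"
    using V_near[OF \<sigma> continuous_on_const e(1)] by metis
  have crit: "near_critical \<sigma> u1 W1 (\<delta> / 2)" "near_critical \<sigma> u0 W0 (\<delta> / 2)"
    using near_optimal_imp_near_critical[OF \<sigma> W1] near_optimal_imp_near_critical[OF \<sigma> W0] \<delta> by auto
  let ?u = "\<lambda>t. u1 t + (-1) *\<^sub>R u0 t" and ?W = "\<lambda>t. W1 t + (-1) *\<^sub>R W0 t"
  have "near_orthogonal \<sigma> ?u ?W \<delta>"
    unfolding near_orthogonal_def
  proof (intro allI impI, elim conjE)
    fix v Z assume Z: "trajectory \<sigma> v Z" and past: "null_past \<sigma> Z"
    have "\<bar>ip \<sigma> u1 W1 v Z + lin \<sigma> Z\<bar> \<le> \<delta> / 2 * sqrt (ip \<sigma> v Z v Z)"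
      "\<bar>ip \<sigma> u0 W0 v Z + lin \<sigma> Z\<bar> \<le> \<delta> / 2 * sqrt (ip \<sigma> v Z v Z)"
      using crit Z past unfolding near_critical_def by blast+
    then show "\<bar>ip \<sigma> ?u ?W v Z\<bar> \<le> \<delta> * sqrt (ip \<sigma> v Z v Z)"
      unfolding ip_add_left[OF \<sigma>0 W1(1) W0(1) Z] by arith
  qed
  moreover have "ip \<sigma> ?u ?W ?u ?W \<le> 4 * (V \<sigma> x + V \<sigma> (\<lambda>_. 0)) + 8 * cst \<sigma> + 8"
    using ip_diff_le[OF \<sigma>0 W1(1) W0(1)] ip_le_J[OF \<sigma>0 W1(1)] ip_le_J[OF \<sigma>0 W0(1)]
      order_trans[OF W1(3) add_left_mono[OF e(2)]] order_trans[OF W0(3) add_left_mono[OF e(2)]]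
    by argo
  moreover have "?W s = x s" if "s \<in> {0..\<sigma>}" for s
    using W1(2)[OF that] W0(2)[OF that] by simp
  ultimately show thesis
    using that[of ?u ?W] trajectory_add_scaleR[OF \<sigma>0 W1(1) W0(1)] by blast
qed

lemma ip_earlier:
  assumes "0 \<le> \<tau>" "\<tau> \<le> \<sigma>" "\<sigma> \<le> T" "trajectory \<sigma> v Z" "null_past \<sigma> Z"
  shows "ip \<tau> u W (\<lambda>t. if t < \<sigma> then 0 else v t) Z = ip \<sigma> u W v Z"
proof -
  let ?f = "\<lambda>t. (C *v W t) \<bullet> (C *v Z t) + u t \<bullet> v t"
  have "ip \<tau> u W (\<lambda>t. if t < \<sigma> then 0 else v t) Z
      = integral {\<tau>..T} (\<lambda>t. if t \<in> {\<sigma>..T} then ?f t else 0)"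
    unfolding ip_def using assms by (intro integral_cong) (auto simp: null_past_def)
  also have "\<dots> = ip \<sigma> u W v Z"
    unfolding ip_def using assms by (subst integral_restrict_Int) (simp add: Int_absorb1)
  finally show ?thesis .
qed

lemma near_orthogonal_later:
  assumes "0 \<le> \<tau>" "\<tau> \<le> \<sigma>" "\<sigma> \<le> T" and orth: "near_orthogonal \<tau> u W \<delta>"
  shows "near_orthogonal \<sigma> u W \<delta>"
  unfolding near_orthogonal_def
proof (intro allI impI, elim conjE)
  fix v Z assume Z: "trajectory \<sigma> v Z" and past: "null_past \<sigma> Z"
  let ?v = "\<lambda>t. if t < \<sigma> then 0 else v t"
  have "trajectory \<tau> ?v Z"
    using past by (intro trajectory_earlier[OF assms(1-3) Z]) (auto simp: null_past_def)
  moreover have "null_past \<tau> Z"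
    using past assms by (auto simp: null_past_def)
  ultimately have "\<bar>ip \<tau> u W ?v Z\<bar> \<le> \<delta> * sqrt (ip \<tau> ?v Z ?v Z)"
    using orth by (simp add: near_orthogonal_def)
  moreover have "ip \<sigma> ?v Z v Z = ip \<sigma> v Z v Z"
    unfolding ip_def by (intro integral_cong) auto
  ultimately show "\<bar>ip \<sigma> u W v Z\<bar> \<le> \<delta> * sqrt (ip \<sigma> v Z v Z)"
    by (simp add: ip_earlier[OF assms(1-3) Z past])
qed

end

lemma integral_add_scaleR:
  fixes f g :: "'n::euclidean_space \<Rightarrow> 'b::real_normed_vector"
  assumes "f integrable_on S" "g integrable_on S"
  shows "integral S (\<lambda>x. f x + c *\<^sub>R g x) = integral S f + c *\<^sub>R integral S g"
  using assms by (subst integral_add) (auto intro: integrable_cmul)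

context tracking_problem
begin

definition rate :: real where
  "rate = (SOME k. k > 0 \<and> (\<forall>W s D. continuous_on {0..T} W \<longrightarrow> s \<in> {0..T} \<longrightarrow>
     (\<forall>r\<in>{0..s}. norm (W r) \<le> D) \<longrightarrow> norm (drift W s) \<le> k * D))"

lemma rate_pos: "rate > 0"
  and norm_drift_le: "continuous_on {0..T} W \<Longrightarrow> s \<in> {0..T} \<Longrightarrow> (\<And>r. r \<in> {0..s} \<Longrightarrow> norm (W r) \<le> D)
    \<Longrightarrow> norm (drift W s) \<le> rate * D"
proof -
  obtain k where "k > 0"
    "\<And>W s D. continuous_on {0..T} W \<Longrightarrow> s \<in> {0..T} \<Longrightarrow> (\<And>r. r \<in> {0..s} \<Longrightarrow> norm (W r) \<le> D)
      \<Longrightarrow> norm (drift W s) \<le> k * D"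
    by (rule drift_bounded) blast
  then have "\<exists>k. k > 0 \<and> (\<forall>W s D. continuous_on {0..T} W \<longrightarrow> s \<in> {0..T} \<longrightarrow>
     (\<forall>r\<in>{0..s}. norm (W r) \<le> D) \<longrightarrow> norm (drift W s) \<le> k * D)"
    by blast
  from someI_ex[OF this, folded rate_def]
  show "rate > 0" "continuous_on {0..T} W \<Longrightarrow> s \<in> {0..T} \<Longrightarrow> (\<And>r. r \<in> {0..s} \<Longrightarrow> norm (W r) \<le> D)
    \<Longrightarrow> norm (drift W s) \<le> rate * D"
    by blast+
qed

text \<open>On short intervals, Gronwall's inequality can be replaced by absorbing the maximum.\<close>

lemma trajectory_short_bound:
  assumes "0 \<le> \<tau>" "\<tau> \<le> \<sigma>" "\<sigma> \<le> T" and short: "rate * (\<sigma> - \<tau>) \<le> 1 / 2"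
    and W: "trajectory \<tau> u W" and X: "\<And>s. s \<in> {0..\<tau>} \<Longrightarrow> norm (W s) \<le> X"
    and U: "\<And>t. t \<in> {\<tau>..\<sigma>} \<Longrightarrow> norm (integral {\<tau>..t} (\<lambda>s. B *v u s)) \<le> U" and t: "t \<in> {0..\<sigma>}"
  shows "norm (W t) \<le> 2 * (X + U)"
proof -
  note W' = trajectoryD[OF W]
  have "\<exists>r\<in>{0..\<sigma>}. \<forall>s\<in>{0..\<sigma>}. norm (W s) \<le> norm (W r)"
    using assms(1-3)
    by (intro continuous_attains_sup continuous_on_norm continuous_on_subset[OF W'(1)]) auto
  then obtain r where r: "r \<in> {0..\<sigma>}" "\<And>s. s \<in> {0..\<sigma>} \<Longrightarrow> norm (W s) \<le> norm (W r)"
    by blast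
  have X0: "0 \<le> X" and U0: "0 \<le> U"
    using X[of \<tau>] U[of \<tau>] assms(1,2) norm_ge_zero[of "W \<tau>"] by (auto simp del: norm_ge_zero)
  have "norm (W r) \<le> 2 * (X + U)"
  proof (cases "r \<le> \<tau>")
    case True
    then show ?thesis
      using X[of r] r(1) X0 U0 by auto
  next
    case False
    have "norm (integral {\<tau>..r} (drift W)) \<le> (rate * norm (W r)) * (r - \<tau>)"
    proof (rule integral_bound)
      show "continuous_on {\<tau>..r} (drift W)"
        using r assms(1-3) by (intro continuous_on_subset[OF drift_continuous_on[OF W'(1)]]) auto
      show "norm (drift W s) \<le> rate * norm (W r)" if "s \<in> {\<tau>..r}" for s
        using r that assms(1-3) by (intro norm_drift_le W'(1)) auto
    qed (use False in simp)
    also have "\<dots> = (rate * (r - \<tau>)) * norm (W r)"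
      by simp
    also have "\<dots> \<le> 1 / 2 * norm (W r)"
    proof (rule mult_right_mono)
      have "rate * (r - \<tau>) \<le> rate * (\<sigma> - \<tau>)"
        using rate_pos r by (intro mult_left_mono) auto
      then show "rate * (r - \<tau>) \<le> 1 / 2"
        using short by simp
    qed simp
    finally have 1: "norm (integral {\<tau>..r} (drift W)) \<le> 1 / 2 * norm (W r)" .
    have eq: "W r = W \<tau> + integral {\<tau>..r} (drift W) + integral {\<tau>..r} (\<lambda>s. B *v u s)"
      using r False assms(1-3) by (intro W'(3)) auto
    have "norm (W r) \<le> norm (W \<tau>) + norm (integral {\<tau>..r} (drift W)) + norm (integral {\<tau>..r} (\<lambda>s. B *v u s))"
      by (subst eq) (rule order_trans[OF norm_triangle_ineq add_right_mono[OF norm_triangle_ineq]])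
    moreover have "norm (W \<tau>) \<le> X"
      using X assms(1) by auto
    moreover have "norm (integral {\<tau>..r} (\<lambda>s. B *v u s)) \<le> U"
      using U r False by auto
    ultimately show ?thesis
      using 1 by argo
  qed
  then show ?thesis
    using r(2)[OF t] by linarith
qed

lemma trajectory_short_increment:
  assumes "0 \<le> \<tau>" "\<tau> \<le> \<sigma>" "\<sigma> \<le> T" and W: "trajectory \<tau> u W"
    and D: "\<And>s. s \<in> {0..\<sigma>} \<Longrightarrow> norm (W s) \<le> D" and t: "t \<in> {\<tau>..\<sigma>}"
  shows "norm (W t - W \<tau> - integral {\<tau>..t} (\<lambda>s. B *v u s)) \<le> rate * D * (t - \<tau>)"
proof -
  note W' = trajectoryD[OF W]
  have "norm (integral {\<tau>..t} (drift W)) \<le> (rate * D) * (t - \<tau>)"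
  proof (rule integral_bound)
    show "continuous_on {\<tau>..t} (drift W)"
      using t assms(1-3) by (intro continuous_on_subset[OF drift_continuous_on[OF W'(1)]]) auto
    show "norm (drift W s) \<le> rate * D" if "s \<in> {\<tau>..t}" for s
      using t that assms(1-3) by (intro norm_drift_le W'(1) D) auto
  qed (use t in simp)
  moreover have "W t = W \<tau> + integral {\<tau>..t} (drift W) + integral {\<tau>..t} (\<lambda>s. B *v u s)"
    using t assms(1-3) by (intro W'(3)) auto
  then have "W t - W \<tau> - integral {\<tau>..t} (\<lambda>s. B *v u s) = integral {\<tau>..t} (drift W)"
    by (simp add: algebra_simps)
  ultimately show ?thesis
    by simp
qed

end

section \<open>The coefficients of the value function\<close>

locale tracking_coefficients = tracking_problem T A B C N y
  for T :: real
    and A :: "real^'d::finite^'d"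
    and B :: "real^'m::finite^'d"
    and C :: "real^'d^'p::finite"
    and N :: "real \<Rightarrow> real^'d^'d"
    and y :: "real \<Rightarrow> real^'p" +
  fixes P0 :: "real \<Rightarrow> real^'d^'d"
    and P1 :: "real \<Rightarrow> real \<Rightarrow> real^'d^'d"
    and P2 :: "real \<Rightarrow> real \<Rightarrow> real \<Rightarrow> real^'d^'d"
    and d1 :: "real \<Rightarrow> real^'d"
    and d2 :: "real \<Rightarrow> real \<Rightarrow> real^'d"
    and M :: "real \<Rightarrow> real"
  assumes coefficients: "value_coefficients T A B C N y P0 P1 P2 d1 d2 M"
begin

lemma P0_cont: "continuous_on {0..T} P0"
  and P1_cont: "continuous_on {(s, \<tau>). 0 \<le> s \<and> s \<le> \<tau> \<and> \<tau> \<le> T} (\<lambda>(s, \<tau>). P1 s \<tau>)"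
  and P2_cont: "continuous_on {(s, \<nu>, \<tau>). 0 \<le> s \<and> s \<le> \<tau> \<and> 0 \<le> \<nu> \<and> \<nu> \<le> \<tau> \<and> \<tau> \<le> T} (\<lambda>(s, \<nu>, \<tau>). P2 s \<nu> \<tau>)"
  and d1_cont: "continuous_on {0..T} d1"
  and d2_cont: "continuous_on {(s, \<tau>). 0 \<le> s \<and> s \<le> \<tau> \<and> \<tau> \<le> T} (\<lambda>(s, \<tau>). d2 s \<tau>)"
  using coefficients by (simp_all add: value_coefficients_def)

lemma P0_symmetric: "\<sigma> \<in> {0..T} \<Longrightarrow> x \<bullet> (P0 \<sigma> *v z) = z \<bullet> (P0 \<sigma> *v x)"
proof -
  assume "\<sigma> \<in> {0..T}"
  then have "P0 \<sigma> = transpose (P0 \<sigma>)"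
    using coefficients unfolding value_coefficients_def by blast
  then have "x \<bullet> (P0 \<sigma> *v z) = (P0 \<sigma> *v x) \<bullet> z"
    by (metis dot_lmul_matrix transpose_matrix_vector)
  then show ?thesis
    by (simp add: inner_commute)
qed

lemma P1_continuous_on: "\<sigma> \<in> {0..T} \<Longrightarrow> continuous_on {0..\<sigma>} (\<lambda>s. P1 s \<sigma>)"
  by (rule continuous_on_compose2[OF P1_cont, of _ "\<lambda>s. (s, \<sigma>)", simplified])
    (auto intro!: continuous_intros)

lemma d2_continuous_on: "\<sigma> \<in> {0..T} \<Longrightarrow> continuous_on {0..\<sigma>} (\<lambda>s. d2 s \<sigma>)"
  by (rule continuous_on_compose2[OF d2_cont, of _ "\<lambda>s. (s, \<sigma>)", simplified])
    (auto intro!: continuous_intros)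

lemma P2_continuous_on: "\<sigma> \<in> {0..T} \<Longrightarrow> continuous_on ({0..\<sigma>} \<times> {0..\<sigma>}) (\<lambda>z. P2 (fst z) (snd z) \<sigma>)"
  by (rule continuous_on_compose2[OF P2_cont, of _ "\<lambda>z. (fst z, snd z, \<sigma>)", simplified])
    (auto intro!: continuous_intros)

definition past1 :: "real \<Rightarrow> (real \<Rightarrow> real^'d) \<Rightarrow> real^'d"
  where "past1 \<sigma> x = integral {0..\<sigma>} (\<lambda>s. P1 s \<sigma> *v x s)"

definition past2 :: "real \<Rightarrow> (real \<Rightarrow> real^'d) \<Rightarrow> (real \<Rightarrow> real^'d) \<Rightarrow> real"
  where "past2 \<sigma> x z = integral {0..\<sigma>} (\<lambda>s. integral {0..\<sigma>} (\<lambda>\<nu>. x s \<bullet> (P2 s \<nu> \<sigma> *v z \<nu>)))"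

definition l :: "real \<Rightarrow> (real \<Rightarrow> real^'d) \<Rightarrow> real"
  where "l \<sigma> x = x \<sigma> \<bullet> d1 \<sigma> + integral {0..\<sigma>} (\<lambda>s. x s \<bullet> d2 s \<sigma>)"

definition q :: "real \<Rightarrow> (real \<Rightarrow> real^'d) \<Rightarrow> real"
  where "q \<sigma> x = x \<sigma> \<bullet> (P0 \<sigma> *v x \<sigma>) + 2 * (x \<sigma> \<bullet> past1 \<sigma> x) + past2 \<sigma> x x"

definition b :: "real \<Rightarrow> (real \<Rightarrow> real^'d) \<Rightarrow> (real \<Rightarrow> real^'d) \<Rightarrow> real"
  where "b \<sigma> x z = z \<sigma> \<bullet> (P0 \<sigma> *v x \<sigma> + past1 \<sigma> x) + x \<sigma> \<bullet> past1 \<sigma> z + (past2 \<sigma> x z + past2 \<sigma> z x) / 2"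

lemma past1_continuous: "\<sigma> \<in> {0..T} \<Longrightarrow> continuous_on {0..\<sigma>} x \<Longrightarrow> continuous_on {0..\<sigma>} (\<lambda>s. P1 s \<sigma> *v x s)"
  by (intro continuous_intros P1_continuous_on)

lemma past1_add:
  assumes "\<sigma> \<in> {0..T}" "continuous_on {0..\<sigma>} x" "continuous_on {0..\<sigma>} z"
  shows "past1 \<sigma> (\<lambda>s. x s + c *\<^sub>R z s) = past1 \<sigma> x + c *\<^sub>R past1 \<sigma> z"
  unfolding past1_def matrix_vector_right_distrib matrix_vector_mult_scaleR
  by (intro integral_add_scaleR integrable_continuous_real past1_continuous assms)

lemma l_continuous: "\<sigma> \<in> {0..T} \<Longrightarrow> continuous_on {0..\<sigma>} x \<Longrightarrow> continuous_on {0..\<sigma>} (\<lambda>s. x s \<bullet> d2 s \<sigma>)"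
  by (intro continuous_intros d2_continuous_on)

lemma l_add:
  assumes "\<sigma> \<in> {0..T}" "continuous_on {0..\<sigma>} x" "continuous_on {0..\<sigma>} z"
  shows "l \<sigma> (\<lambda>s. x s + c *\<^sub>R z s) = l \<sigma> x + c * l \<sigma> z"
proof -
  have "integral {0..\<sigma>} (\<lambda>s. x s \<bullet> d2 s \<sigma> + c *\<^sub>R (z s \<bullet> d2 s \<sigma>))
      = integral {0..\<sigma>} (\<lambda>s. x s \<bullet> d2 s \<sigma>) + c *\<^sub>R integral {0..\<sigma>} (\<lambda>s. z s \<bullet> d2 s \<sigma>)"
    by (intro integral_add_scaleR integrable_continuous_real l_continuous assms)
  then show ?thesis
    unfolding l_def by (simp add: inner_add_left algebra_simps)
qed

lemma past2_continuous:
  assumes "\<sigma> \<in> {0..T}" "continuous_on {0..\<sigma>} x" "continuous_on {0..\<sigma>} z"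
  shows "continuous_on ({0..\<sigma>} \<times> {0..\<sigma>}) (\<lambda>p. x (fst p) \<bullet> (P2 (fst p) (snd p) \<sigma> *v z (snd p)))"
  by (intro continuous_intros P2_continuous_on assms(1) continuous_on_compose2[OF assms(2)]
      continuous_on_compose2[OF assms(3)]) auto

lemma past2_inner_continuous:
  assumes "\<sigma> \<in> {0..T}" "continuous_on {0..\<sigma>} x" "continuous_on {0..\<sigma>} z" "s \<in> {0..\<sigma>}"
  shows "continuous_on {0..\<sigma>} (\<lambda>\<nu>. x s \<bullet> (P2 s \<nu> \<sigma> *v z \<nu>))"
  by (rule continuous_on_compose2[OF past2_continuous[OF assms(1-3)], of _ "\<lambda>\<nu>. (s, \<nu>)", simplified])
    (use assms(4) in \<open>auto intro!: continuous_intros\<close>)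

lemma past2_outer_continuous:
  assumes "\<sigma> \<in> {0..T}" "continuous_on {0..\<sigma>} x" "continuous_on {0..\<sigma>} z"
  shows "continuous_on {0..\<sigma>} (\<lambda>s. integral {0..\<sigma>} (\<lambda>\<nu>. x s \<bullet> (P2 s \<nu> \<sigma> *v z \<nu>)))"
  using integral_continuous_on_param[of "{0..\<sigma>}" 0 \<sigma> "\<lambda>s \<nu>. x s \<bullet> (P2 s \<nu> \<sigma> *v z \<nu>)"]
    past2_continuous[OF assms] by (simp add: case_prod_beta)

lemma past2_add_left:
  assumes "\<sigma> \<in> {0..T}" "continuous_on {0..\<sigma>} x" "continuous_on {0..\<sigma>} x'" "continuous_on {0..\<sigma>} z"
  shows "past2 \<sigma> (\<lambda>s. x s + c *\<^sub>R x' s) z = past2 \<sigma> x z + c * past2 \<sigma> x' z"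
proof -
  have "past2 \<sigma> (\<lambda>s. x s + c *\<^sub>R x' s) z = integral {0..\<sigma>} (\<lambda>s.
      integral {0..\<sigma>} (\<lambda>\<nu>. x s \<bullet> (P2 s \<nu> \<sigma> *v z \<nu>)) + c *\<^sub>R integral {0..\<sigma>} (\<lambda>\<nu>. x' s \<bullet> (P2 s \<nu> \<sigma> *v z \<nu>)))"
    unfolding past2_def
  proof (rule integral_cong)
    fix s assume s: "s \<in> {0..\<sigma>}"
    have "integral {0..\<sigma>} (\<lambda>\<nu>. (x s + c *\<^sub>R x' s) \<bullet> (P2 s \<nu> \<sigma> *v z \<nu>))
        = integral {0..\<sigma>} (\<lambda>\<nu>. x s \<bullet> (P2 s \<nu> \<sigma> *v z \<nu>) + c *\<^sub>R (x' s \<bullet> (P2 s \<nu> \<sigma> *v z \<nu>)))"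
      by (simp add: inner_add_left)
    also have "\<dots> = integral {0..\<sigma>} (\<lambda>\<nu>. x s \<bullet> (P2 s \<nu> \<sigma> *v z \<nu>))
        + c *\<^sub>R integral {0..\<sigma>} (\<lambda>\<nu>. x' s \<bullet> (P2 s \<nu> \<sigma> *v z \<nu>))"
      by (intro integral_add_scaleR integrable_continuous_real past2_inner_continuous assms s)
    finally show "integral {0..\<sigma>} (\<lambda>\<nu>. (x s + c *\<^sub>R x' s) \<bullet> (P2 s \<nu> \<sigma> *v z \<nu>)) = \<dots>" .
  qed
  also have "\<dots> = past2 \<sigma> x z + c * past2 \<sigma> x' z"
    unfolding past2_def
    by (subst integral_add_scaleR) (auto intro!: integrable_continuous_real past2_outer_continuous assms)
  finally show ?thesis .
qed

lemma past2_add_right: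
  assumes "\<sigma> \<in> {0..T}" "continuous_on {0..\<sigma>} x" "continuous_on {0..\<sigma>} x'" "continuous_on {0..\<sigma>} z"
  shows "past2 \<sigma> z (\<lambda>s. x s + c *\<^sub>R x' s) = past2 \<sigma> z x + c * past2 \<sigma> z x'"
proof -
  have "past2 \<sigma> z (\<lambda>s. x s + c *\<^sub>R x' s) = integral {0..\<sigma>} (\<lambda>s.
      integral {0..\<sigma>} (\<lambda>\<nu>. z s \<bullet> (P2 s \<nu> \<sigma> *v x \<nu>)) + c *\<^sub>R integral {0..\<sigma>} (\<lambda>\<nu>. z s \<bullet> (P2 s \<nu> \<sigma> *v x' \<nu>)))"
    unfolding past2_def
  proof (rule integral_cong)
    fix s assume s: "s \<in> {0..\<sigma>}"
    have "integral {0..\<sigma>} (\<lambda>\<nu>. z s \<bullet> (P2 s \<nu> \<sigma> *v (x \<nu> + c *\<^sub>R x' \<nu>)))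
        = integral {0..\<sigma>} (\<lambda>\<nu>. z s \<bullet> (P2 s \<nu> \<sigma> *v x \<nu>) + c *\<^sub>R (z s \<bullet> (P2 s \<nu> \<sigma> *v x' \<nu>)))"
      by (simp add: matrix_vector_right_distrib matrix_vector_mult_scaleR inner_add_right)
    also have "\<dots> = integral {0..\<sigma>} (\<lambda>\<nu>. z s \<bullet> (P2 s \<nu> \<sigma> *v x \<nu>))
        + c *\<^sub>R integral {0..\<sigma>} (\<lambda>\<nu>. z s \<bullet> (P2 s \<nu> \<sigma> *v x' \<nu>))"
      by (intro integral_add_scaleR integrable_continuous_real past2_inner_continuous assms s)
    finally show "integral {0..\<sigma>} (\<lambda>\<nu>. z s \<bullet> (P2 s \<nu> \<sigma> *v (x \<nu> + c *\<^sub>R x' \<nu>))) = \<dots>" .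
  qed
  also have "\<dots> = past2 \<sigma> z x + c * past2 \<sigma> z x'"
    unfolding past2_def
    by (subst integral_add_scaleR) (auto intro!: integrable_continuous_real past2_outer_continuous assms)
  finally show ?thesis .
qed

lemma q_add:
  assumes \<sigma>: "\<sigma> \<in> {0..T}" and x: "continuous_on {0..\<sigma>} x" and z: "continuous_on {0..\<sigma>} z"
  shows "q \<sigma> (\<lambda>s. x s + c *\<^sub>R z s) = q \<sigma> x + 2 * c * b \<sigma> x z + c\<^sup>2 * q \<sigma> z"
proof -
  have xz: "continuous_on {0..\<sigma>} (\<lambda>s. x s + c *\<^sub>R z s)"
    by (intro continuous_intros x z)
  show ?thesis
    unfolding q_def b_def past1_add[OF \<sigma> x z] past2_add_left[OF \<sigma> x z xz]
      past2_add_right[OF \<sigma> x z x] past2_add_right[OF \<sigma> x z z]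
    using P0_symmetric[OF \<sigma>, of "x \<sigma>" "z \<sigma>"]
    by (simp add: inner_add_left inner_add_right matrix_vector_right_distrib matrix_vector_mult_scaleR
        algebra_simps power2_eq_square)
qed

lemma q_zero: "q \<sigma> (\<lambda>_. 0) = 0"
  by (simp add: q_def past2_def)

lemma l_zero: "l \<sigma> (\<lambda>_. 0) = 0"
  by (simp add: l_def)

lemma V_eq:
  assumes \<sigma>: "\<sigma> \<in> {0<..<T}" and x: "continuous_on {0..\<sigma>} x"
  shows "V \<sigma> x = q \<sigma> x + 2 * l \<sigma> x + M \<sigma>"
proof -
  have \<sigma>': "\<sigma> \<in> {0..T}"
    using \<sigma> by simp
  have conv: "(LBINT s:{0..\<sigma>}. f s) = integral {0..\<sigma>} f" if "continuous_on {0..\<sigma>} f"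
    for f :: "real \<Rightarrow> 'e::euclidean_space"
    by (intro set_borel_integral_eq_integral(2) borel_integrable_atLeastAtMost' that)
  have "(x \<sigma>, x) \<in> M2 \<sigma>"
    using continuous_on_imp_L2[OF x] by (simp add: M2_def)
  then have "V \<sigma> x = x \<sigma> \<bullet> (P0 \<sigma> *v x \<sigma>)
          + 2 * (x \<sigma> \<bullet> (LBINT s:{0..\<sigma>}. P1 s \<sigma> *v x s))
          + (LBINT s:{0..\<sigma>}. LBINT \<nu>:{0..\<sigma>}. x s \<bullet> (P2 s \<nu> \<sigma> *v x \<nu>))
          + 2 * (x \<sigma> \<bullet> d1 \<sigma>)
          + 2 * (LBINT s:{0..\<sigma>}. x s \<bullet> d2 s \<sigma>)
          + M \<sigma>"
    using coefficients \<sigma> unfolding value_coefficients_def V_def by blast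
  also have "(LBINT s:{0..\<sigma>}. P1 s \<sigma> *v x s) = past1 \<sigma> x"
    unfolding past1_def by (intro conv past1_continuous \<sigma>' x)
  also have "(LBINT s:{0..\<sigma>}. x s \<bullet> d2 s \<sigma>) = integral {0..\<sigma>} (\<lambda>s. x s \<bullet> d2 s \<sigma>)"
    by (intro conv l_continuous \<sigma>' x)
  also have "(LBINT s:{0..\<sigma>}. LBINT \<nu>:{0..\<sigma>}. x s \<bullet> (P2 s \<nu> \<sigma> *v x \<nu>))
      = (LBINT s:{0..\<sigma>}. integral {0..\<sigma>} (\<lambda>\<nu>. x s \<bullet> (P2 s \<nu> \<sigma> *v x \<nu>)))"
    by (intro set_lebesgue_integral_cong) (auto intro!: conv past2_inner_continuous \<sigma>' x)
  also have "\<dots> = past2 \<sigma> x x"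
    unfolding past2_def by (intro conv past2_outer_continuous \<sigma>' x)
  finally show ?thesis
    by (simp add: q_def l_def)
qed

lemma trajectory_continuous_on: "trajectory \<sigma> u W \<Longrightarrow> \<sigma> \<in> {0..T} \<Longrightarrow> continuous_on {0..\<sigma>} W"
  by (rule continuous_on_subset[OF trajectoryD(1)]) auto

lemma V_zero_plus:
  assumes "\<sigma> \<in> {0<..<T}" "continuous_on {0..\<sigma>} x"
  shows "V \<sigma> (\<lambda>s. 0 + c *\<^sub>R x s) = c\<^sup>2 * q \<sigma> x + 2 * c * l \<sigma> x + V \<sigma> (\<lambda>_. 0)"
proof -
  have \<sigma>': "\<sigma> \<in> {0..T}"
    using assms by simp
  have "continuous_on {0..\<sigma>} (\<lambda>s. 0 + c *\<^sub>R x s)"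
    by (intro continuous_intros assms)
  from V_eq[OF assms(1) this] show ?thesis
    unfolding V_eq[OF assms(1) continuous_on_const] q_add[OF \<sigma>' continuous_on_const assms(2)]
      l_add[OF \<sigma>' continuous_on_const assms(2)]
    by (simp add: q_zero l_zero b_def past1_def past2_def)
qed

lemma q_le_ip:
  assumes \<sigma>: "\<sigma> \<in> {0<..<T}" and W: "trajectory \<sigma> u W"
  shows "q \<sigma> W \<le> ip \<sigma> u W u W"
proof (rule field_le_epsilon)
  fix e :: real assume "0 < e"
  have \<sigma>': "\<sigma> \<in> {0..T}" "0 \<le> \<sigma>"
    using \<sigma> by auto
  obtain v Z where Z: "trajectory \<sigma> v Z" "\<And>s. s \<in> {0..\<sigma>} \<Longrightarrow> Z s = 0" "J \<sigma> v Z \<le> V \<sigma> (\<lambda>_. 0) + e"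
    using V_near[OF \<sigma>'(1) continuous_on_const \<open>0 < e\<close>] by metis
  have "V \<sigma> (\<lambda>s. 0 + c *\<^sub>R W s) \<le> J \<sigma> (\<lambda>t. v t + c *\<^sub>R u t) (\<lambda>t. Z t + c *\<^sub>R W t)" for c
    using Z(2) by (intro V_le_J[OF \<sigma>'(1) trajectory_add_scaleR[OF \<sigma>'(2) Z(1) W]]) auto
  from this[of 1] this[of "-1"] show "q \<sigma> W \<le> ip \<sigma> u W u W + e"
    unfolding V_zero_plus[OF \<sigma> trajectory_continuous_on[OF W \<sigma>'(1)]] J_add[OF \<sigma>'(2) Z(1) W]
    using Z(3) by simp
qed

lemma near_orthogonal_value:
  assumes \<sigma>: "\<sigma> \<in> {0<..<T}" and W: "trajectory \<sigma> u W" and orth: "near_orthogonal \<sigma> u W \<delta>"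
    and \<delta>: "0 < \<delta>" "\<delta> \<le> 1"
  shows "ip \<sigma> u W u W \<le> q \<sigma> W + 4 * \<delta>\<^sup>2"
    and "\<bar>l \<sigma> W - lin \<sigma> W\<bar> \<le> \<delta> * (1 + sqrt (4 * cst 0 + 2))"
proof -
  have \<sigma>': "\<sigma> \<in> {0..T}" "0 \<le> \<sigma>"
    using \<sigma> by auto
  have \<delta>2: "0 < \<delta>\<^sup>2" "\<delta>\<^sup>2 \<le> \<delta>" "\<delta>\<^sup>2 \<le> 1"
    using \<delta> power_le_one[of \<delta> 2] mult_left_le[of \<delta> \<delta>] by (auto simp: power2_eq_square)
  obtain v Z where Z: "trajectory \<sigma> v Z" "\<And>s. s \<in> {0..\<sigma>} \<Longrightarrow> Z s = 0"
      "J \<sigma> v Z \<le> V \<sigma> (\<lambda>_. 0) + \<delta>\<^sup>2"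
    using V_near[OF \<sigma>'(1) continuous_on_const \<delta>2(1)] by metis
  have crit: "near_critical \<sigma> v Z \<delta>"
    using near_optimal_imp_near_critical[OF \<sigma>'(1) Z] \<delta> by simp
  have up: "J \<sigma> (\<lambda>t. v t + c *\<^sub>R u t) (\<lambda>t. Z t + c *\<^sub>R W t) \<le> V \<sigma> (\<lambda>s. 0 + c *\<^sub>R W s) + (2 * \<delta>)\<^sup>2"
    if c: "\<bar>c\<bar> = 1" for c
  proof (rule near_critical_imp_near_optimal[OF \<sigma>'(1) trajectory_add_scaleR[OF \<sigma>'(2) Z(1) W]])
    show "near_critical \<sigma> (\<lambda>t. v t + c *\<^sub>R u t) (\<lambda>t. Z t + c *\<^sub>R W t) (2 * \<delta>)"
      unfolding near_critical_def
    proof (intro allI impI, elim conjE)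
      fix v' Z' assume Z': "trajectory \<sigma> v' Z'" "null_past \<sigma> Z'"
      have "\<bar>ip \<sigma> v Z v' Z' + lin \<sigma> Z'\<bar> \<le> \<delta> * sqrt (ip \<sigma> v' Z' v' Z')"
        "\<bar>c * ip \<sigma> u W v' Z'\<bar> \<le> \<delta> * sqrt (ip \<sigma> v' Z' v' Z')"
        using crit orth Z' c unfolding near_critical_def near_orthogonal_def abs_mult by auto
      then show "\<bar>ip \<sigma> (\<lambda>t. v t + c *\<^sub>R u t) (\<lambda>t. Z t + c *\<^sub>R W t) v' Z' + lin \<sigma> Z'\<bar>
          \<le> 2 * \<delta> * sqrt (ip \<sigma> v' Z' v' Z')"
        unfolding ip_add_left[OF \<sigma>'(2) Z(1) W Z'(1)] by arith
    qed
  qed (use Z(2) in simp)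
  have low: "V \<sigma> (\<lambda>s. 0 + c *\<^sub>R W s) \<le> J \<sigma> (\<lambda>t. v t + c *\<^sub>R u t) (\<lambda>t. Z t + c *\<^sub>R W t)" for c
    using Z(2) by (intro V_le_J[OF \<sigma>'(1) trajectory_add_scaleR[OF \<sigma>'(2) Z(1) W]]) auto
  note expand = V_zero_plus[OF \<sigma> trajectory_continuous_on[OF W \<sigma>'(1)]] J_add[OF \<sigma>'(2) Z(1) W]
  have V0: "V \<sigma> (\<lambda>_. 0) \<le> J \<sigma> v Z"
    using Z(2) by (intro V_le_J[OF \<sigma>'(1) Z(1)])
  note bounds = low[of 1, unfolded expand] low[of "-1", unfolded expand]
    up[of 1, unfolded expand] up[of "-1", unfolded expand]
  show "ip \<sigma> u W u W \<le> q \<sigma> W + 4 * \<delta>\<^sup>2"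
    using bounds(3,4) V0 by (simp add: power_mult_distrib)
  have "\<bar>l \<sigma> W - (ip \<sigma> v Z u W + lin \<sigma> W)\<bar> \<le> \<delta>\<^sup>2"
    using bounds by (simp add: power_mult_distrib abs_le_iff)
  moreover have "\<bar>ip \<sigma> u W v Z\<bar> \<le> \<delta> * sqrt (ip \<sigma> v Z v Z)"
    using orth Z by (simp add: near_orthogonal_def null_past_def)
  moreover have "\<delta> * sqrt (ip \<sigma> v Z v Z) \<le> \<delta> * sqrt (4 * cst 0 + 2)"
  proof (intro mult_left_mono real_sqrt_le_mono)
    have "V \<sigma> (\<lambda>_. 0) \<le> J \<sigma> (\<lambda>_. 0) (\<lambda>_. 0)"
      by (intro V_le_J[OF \<sigma>'(1) trajectory_zero]) simp
    also have "\<dots> = cst \<sigma>"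
      by (simp add: J_def ip_def lin_def)
    finally show "ip \<sigma> v Z v Z \<le> 4 * cst 0 + 2"
      using ip_le_J[OF \<sigma>'(2) Z(1)] Z(3) \<delta>2(3) cst_antimono[OF \<sigma>'(2)] by argo
  qed (use \<delta> in simp)
  ultimately show "\<bar>l \<sigma> W - lin \<sigma> W\<bar> \<le> \<delta> * (1 + sqrt (4 * cst 0 + 2))"
    unfolding ip_commute[of \<sigma> u W v Z] distrib_left using \<delta>2(2) by (simp add: abs_le_iff)
qed

lemma near_orthogonal_bilinear:
  assumes \<sigma>: "\<sigma> \<in> {0<..<T}" and W: "trajectory \<sigma> u W" and orth: "near_orthogonal \<sigma> u W \<delta>"
    and \<delta>: "0 < \<delta>" "\<delta> \<le> 1" and Z: "trajectory \<sigma> v Z"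
  shows "\<bar>ip \<sigma> u W v Z - b \<sigma> W Z\<bar> \<le> 2 * \<delta> * sqrt (ip \<sigma> v Z v Z - q \<sigma> Z)"
proof -
  have \<sigma>': "\<sigma> \<in> {0..T}" "0 \<le> \<sigma>"
    using \<sigma> by auto
  have "\<bar>ip \<sigma> u W v Z - b \<sigma> W Z\<bar> \<le> sqrt (4 * \<delta>\<^sup>2) * sqrt (ip \<sigma> v Z v Z - q \<sigma> Z)"
  proof (rule quadratic_nonneg_imp)
    show "0 \<le> ip \<sigma> v Z v Z - q \<sigma> Z"
      using q_le_ip[OF \<sigma> Z] by simp
    fix c
    have "q \<sigma> (\<lambda>t. W t + c *\<^sub>R Z t) \<le> ip \<sigma> (\<lambda>t. u t + c *\<^sub>R v t) (\<lambda>t. W t + c *\<^sub>R Z t)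
        (\<lambda>t. u t + c *\<^sub>R v t) (\<lambda>t. W t + c *\<^sub>R Z t)"
      by (rule q_le_ip[OF \<sigma> trajectory_add_scaleR[OF \<sigma>'(2) W Z]])
    then show "0 \<le> 4 * \<delta>\<^sup>2 + 2 * c * (ip \<sigma> u W v Z - b \<sigma> W Z) + c\<^sup>2 * (ip \<sigma> v Z v Z - q \<sigma> Z)"
      using near_orthogonal_value(1)[OF \<sigma> W orth \<delta>]
      unfolding ip_square[OF \<sigma>'(2) W Z]
        q_add[OF \<sigma>'(1) trajectory_continuous_on[OF W \<sigma>'(1)] trajectory_continuous_on[OF Z \<sigma>'(1)]]
      by (simp add: algebra_simps)
  qed
  then show ?thesis
    using \<delta> by (simp add: real_sqrt_mult)
qed

end

lemma integral_reflect_interval: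
  fixes F :: "real \<Rightarrow> 'a::euclidean_space"
  assumes "continuous_on {0..\<tau>} F"
  shows "integral {0..\<tau>} (\<lambda>s. F (\<tau> - s)) = integral {0..\<tau>} F"
proof -
  have "integral {0..\<tau>} (\<lambda>s. F (\<tau> - s)) = integral {- \<tau>..- 0} (\<lambda>s. F (\<tau> - (- s)))"
    by (rule sym, rule Henstock_Kurzweil_Integration.integral_reflect_real[where a=0 and b=\<tau> and f="\<lambda>s. F (\<tau> - s)"])
  also have "\<dots> = integral {- \<tau>..0} (F \<circ> (\<lambda>s. s + \<tau>))"
    by (simp add: o_def add.commute)
  also have "\<dots> = integral {0..\<tau>} F"
    using integral_shift[of "- \<tau>" \<tau> 0 F] assms by simp
  finally show ?thesis .
qed

lemma inner_integral_le:
  fixes f c :: "real \<Rightarrow> 'a::euclidean_space"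
  assumes "(\<lambda>s. f s \<bullet> c s) integrable_on S" "(\<lambda>s. norm (f s)) integrable_on S"
    and "\<And>s. s \<in> S \<Longrightarrow> norm (c s) \<le> e" "integral S (\<lambda>s. norm (f s)) \<le> K" "0 \<le> e"
  shows "\<bar>integral S (\<lambda>s. f s \<bullet> c s)\<bar> \<le> e * K"
proof -
  have "norm (integral S (\<lambda>s. f s \<bullet> c s)) \<le> integral S (\<lambda>s. e * norm (f s))"
  proof (rule integral_norm_bound_integral[OF assms(1)])
    show "(\<lambda>s. e * norm (f s)) integrable_on S"
      by (intro integrable_on_mult_right assms)
    fix s assume "s \<in> S"
    have "norm (f s \<bullet> c s) \<le> norm (f s) * norm (c s)"
      unfolding real_norm_def by (rule Cauchy_Schwarz_ineq2)
    also have "\<dots> \<le> norm (f s) * e"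
      by (intro mult_left_mono assms(3) \<open>s \<in> S\<close>) simp
    finally show "norm (f s \<bullet> c s) \<le> e * norm (f s)"
      by (simp add: mult.commute)
  qed
  also have "\<dots> \<le> e * K"
    using assms by (simp add: mult_left_mono)
  finally show ?thesis
    by simp
qed

lemma uniform_in_parameter:
  fixes e :: "real \<Rightarrow> real \<Rightarrow> 'a::metric_space"
  assumes "continuous_on ({a..b} \<times> {c..d}) (\<lambda>(\<tau>, s). e \<tau> s)" "\<tau> \<in> {a..b}" "0 < \<epsilon>"
  shows "\<forall>\<^sub>F \<sigma> in at \<tau> within {a..b}. \<forall>s\<in>{c..d}. dist (e \<sigma> s) (e \<tau> s) < \<epsilon>"
proof -
  have "uniformly_continuous_on ({a..b} \<times> {c..d}) (\<lambda>(\<tau>, s). e \<tau> s)"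
    by (intro compact_uniformly_continuous assms compact_Times) auto
  then obtain \<delta> where \<delta>: "0 < \<delta>" "\<And>p p'. p \<in> {a..b} \<times> {c..d} \<Longrightarrow> p' \<in> {a..b} \<times> {c..d} \<Longrightarrow> dist p' p < \<delta> \<Longrightarrow>
      dist (case p' of (\<tau>, s) \<Rightarrow> e \<tau> s) (case p of (\<tau>, s) \<Rightarrow> e \<tau> s) < \<epsilon>"
    using \<open>0 < \<epsilon>\<close> unfolding uniformly_continuous_on_def by meson
  show ?thesis
    unfolding eventually_at
  proof (intro exI[of _ \<delta>] conjI ballI impI \<delta>(1))
    fix \<sigma> s assume "\<sigma> \<in> {a..b}" "\<sigma> \<noteq> \<tau> \<and> dist \<sigma> \<tau> < \<delta>" "s \<in> {c..d}"
    then show "dist (e \<sigma> s) (e \<tau> s) < \<epsilon>"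
      using \<delta>(2)[of "(\<tau>, s)" "(\<sigma>, s)"] assms(2) by (simp add: dist_Pair_Pair)
  qed
qed

lemma continuous_on_integral_moving_L2:
  fixes g :: "real \<Rightarrow> 'a::euclidean_space"
  assumes g: "g \<in> L2 0 T" and e: "continuous_on ({0..T} \<times> {0..T}) (\<lambda>(\<tau>, s). e \<tau> s)"
  shows "continuous_on {0..T} (\<lambda>\<tau>. integral {0..\<tau>} (\<lambda>s. g s \<bullet> e \<tau> s))"
  unfolding continuous_on_def
proof
  fix \<tau> assume \<tau>: "\<tau> \<in> {0..T}"
  have e1: "continuous_on {0..T} (e \<sigma>)" if "\<sigma> \<in> {0..T}" for \<sigma>
    by (rule continuous_on_compose2[OF e, of _ "\<lambda>s. (\<sigma>, s)", simplified])
      (use that in \<open>auto intro!: continuous_intros\<close>)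
  have int: "(\<lambda>s. g s \<bullet> k s) integrable_on {0..\<sigma>}" if "continuous_on {0..T} k" "\<sigma> \<in> {0..T}" for k \<sigma>
    using that by (intro L2_continuous_integrable_on[OF g] continuous_on_subset[OF that(1)]) auto
  define K where "K = integral {0..T} (\<lambda>s. norm (g s))"
  have K: "0 \<le> K"
    unfolding K_def by (intro integral_nonneg L2_norm_integrable_on g) auto
  have "((\<lambda>\<sigma>. integral {0..\<sigma>} (\<lambda>s. g s \<bullet> (e \<sigma> s - e \<tau> s))) \<longlongrightarrow> 0) (at \<tau> within {0..T})"
  proof (rule tendstoI)
    fix \<epsilon> :: real assume "0 < \<epsilon>"
    define \<eta> where "\<eta> = \<epsilon> / (K + 1)"
    have \<eta>: "0 < \<eta>" "\<eta> * K < \<epsilon>"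
      using \<open>0 < \<epsilon>\<close> K by (auto simp: \<eta>_def field_simps add_pos_nonneg)
    have "\<forall>\<^sub>F \<sigma> in at \<tau> within {0..T}. \<sigma> \<in> {0..T}"
      by (simp add: eventually_at_filter)
    with uniform_in_parameter[OF e \<tau> \<eta>(1)]
    show "\<forall>\<^sub>F \<sigma> in at \<tau> within {0..T}. dist (integral {0..\<sigma>} (\<lambda>s. g s \<bullet> (e \<sigma> s - e \<tau> s))) 0 < \<epsilon>"
    proof eventually_elim
      case (elim \<sigma>)
      have "\<bar>integral {0..\<sigma>} (\<lambda>s. g s \<bullet> (e \<sigma> s - e \<tau> s))\<bar> \<le> \<eta> * K"
      proof (rule inner_integral_le)
        show "(\<lambda>s. g s \<bullet> (e \<sigma> s - e \<tau> s)) integrable_on {0..\<sigma>}"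
          by (intro int continuous_intros e1 elim(2) \<tau>)
        show n: "(\<lambda>s. norm (g s)) integrable_on {0..\<sigma>}"
          using elim by (intro L2_norm_integrable_on L2_subinterval[OF g]) auto
        show "integral {0..\<sigma>} (\<lambda>s. norm (g s)) \<le> K"
          unfolding K_def using elim by (intro integral_subset_le n L2_norm_integrable_on g) auto
        show "norm (e \<sigma> s - e \<tau> s) \<le> \<eta>" if "s \<in> {0..\<sigma>}" for s
          using elim that by (auto simp: dist_norm less_imp_le)
      qed (use \<eta> in simp)
      then show ?case
        using \<eta> by simp
    qed
  qed
  moreover have "((\<lambda>\<sigma>. integral {0..\<sigma>} (\<lambda>s. g s \<bullet> e \<tau> s)) \<longlongrightarrow> integral {0..\<tau>} (\<lambda>s. g s \<bullet> e \<tau> s)) (at \<tau> within {0..T})"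
    using indefinite_integral_continuous_1[OF int[OF e1[OF \<tau>], of T]] \<tau> by (auto simp: continuous_on_def)
  ultimately have "((\<lambda>\<sigma>. integral {0..\<sigma>} (\<lambda>s. g s \<bullet> (e \<sigma> s - e \<tau> s)) + integral {0..\<sigma>} (\<lambda>s. g s \<bullet> e \<tau> s))
      \<longlongrightarrow> 0 + integral {0..\<tau>} (\<lambda>s. g s \<bullet> e \<tau> s)) (at \<tau> within {0..T})"
    by (rule tendsto_add)
  then have lim: "((\<lambda>\<sigma>. integral {0..\<sigma>} (\<lambda>s. g s \<bullet> (e \<sigma> s - e \<tau> s)) + integral {0..\<sigma>} (\<lambda>s. g s \<bullet> e \<tau> s))
      \<longlongrightarrow> integral {0..\<tau>} (\<lambda>s. g s \<bullet> e \<tau> s)) (at \<tau> within {0..T})"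
    by simp
  show "((\<lambda>\<tau>. integral {0..\<tau>} (\<lambda>s. g s \<bullet> e \<tau> s)) \<longlongrightarrow> integral {0..\<tau>} (\<lambda>s. g s \<bullet> e \<tau> s)) (at \<tau> within {0..T})"
  proof (rule Lim_transform_eventually[OF lim])
    have "\<forall>\<^sub>F \<sigma> in at \<tau> within {0..T}. \<sigma> \<in> {0..T}"
      by (simp add: eventually_at_filter)
    then show "\<forall>\<^sub>F \<sigma> in at \<tau> within {0..T}.
        integral {0..\<sigma>} (\<lambda>s. g s \<bullet> (e \<sigma> s - e \<tau> s)) + integral {0..\<sigma>} (\<lambda>s. g s \<bullet> e \<tau> s)
        = integral {0..\<sigma>} (\<lambda>s. g s \<bullet> e \<sigma> s)"
    proof eventually_elim
      case (elim \<sigma>)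
      have "integral {0..\<sigma>} (\<lambda>s. g s \<bullet> (e \<sigma> s - e \<tau> s))
          = integral {0..\<sigma>} (\<lambda>s. g s \<bullet> e \<sigma> s) - integral {0..\<sigma>} (\<lambda>s. g s \<bullet> e \<tau> s)"
        unfolding inner_diff_right by (intro integral_diff int e1 elim \<tau>)
      then show ?case
        by simp
    qed
  qed
qed

context tracking_problem
begin

lemma ip_split:
  assumes "0 \<le> \<tau>" "\<tau> \<le> \<sigma>" "\<sigma> \<le> T" "trajectory \<tau> u W" "trajectory \<tau> v Z"
  shows "ip \<tau> u W v Z = integral {\<tau>..\<sigma>} (\<lambda>t. (C *v W t) \<bullet> (C *v Z t) + u t \<bullet> v t) + ip \<sigma> u W v Z"
  unfolding ip_def using assms
  by (intro Henstock_Kurzweil_Integration.integral_combine[symmetric] ip_integrable[OF assms(1,4,5)]) auto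

lemma lin_split:
  assumes "0 \<le> \<tau>" "\<tau> \<le> \<sigma>" "\<sigma> \<le> T" "trajectory \<tau> u W"
  shows "lin \<tau> W = - integral {\<tau>..\<sigma>} (\<lambda>t. (C *v W t) \<bullet> y t) + lin \<sigma> W"
proof -
  have "integral {\<tau>..\<sigma>} (\<lambda>t. (C *v W t) \<bullet> y t) + integral {\<sigma>..T} (\<lambda>t. (C *v W t) \<bullet> y t)
      = integral {\<tau>..T} (\<lambda>t. (C *v W t) \<bullet> y t)"
    using assms by (intro Henstock_Kurzweil_Integration.integral_combine
        lin_integrable[OF trajectoryD(1)[OF assms(4)]]) auto
  then show ?thesis
    by (simp add: lin_def)
qed

lemma control_square_integral_le:
  assumes "0 \<le> \<tau>" "trajectory \<tau> u W" "t \<in> {\<tau>..T}"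
  shows "(\<lambda>s. u s \<bullet> u s) integrable_on {\<tau>..t}" "integral {\<tau>..t} (\<lambda>s. u s \<bullet> u s) \<le> ip \<tau> u W u W"
proof -
  have int: "(\<lambda>s. u s \<bullet> u s) integrable_on {\<tau>..r}" if "r \<le> T" for r
    using that by (intro L2_inner_integrable_on L2_subinterval[OF trajectoryD(2)[OF assms(2)]]) auto
  then show "(\<lambda>s. u s \<bullet> u s) integrable_on {\<tau>..t}"
    using assms by simp
  have "integral {\<tau>..t} (\<lambda>s. u s \<bullet> u s) \<le> integral {\<tau>..T} (\<lambda>s. u s \<bullet> u s)"
    using assms by (intro integral_subset_le int) auto
  also have "\<dots> \<le> ip \<tau> u W u W"
    unfolding ip_def by (intro integral_le int ip_integrable[OF assms(1,2,2)]) auto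
  finally show "integral {\<tau>..t} (\<lambda>s. u s \<bullet> u s) \<le> ip \<tau> u W u W" .
qed

lemma control_short_bound:
  assumes "0 \<le> \<tau>" "\<tau> < \<sigma>" "\<sigma> \<le> T" "trajectory \<tau> u W" "ip \<tau> u W u W \<le> K" "t \<in> {\<tau>..\<sigma>}"
    and \<beta>: "0 \<le> \<beta>" "\<And>x. norm (B *v x) \<le> \<beta> * norm x"
  shows "norm (integral {\<tau>..t} (\<lambda>s. B *v u s)) \<le> \<beta> / 2 * (K + 1) * sqrt (\<sigma> - \<tau>)"
proof -
  define r where "r = sqrt (\<sigma> - \<tau>)"
  have r: "0 < r" "r * r = \<sigma> - \<tau>"
    using assms by (auto simp: r_def)
  note sq = control_square_integral_le[OF assms(1,4), of t]
  have t: "t \<in> {\<tau>..T}"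
    using assms by auto
  have int: "(\<lambda>s. \<beta> / 2 * (r * (u s \<bullet> u s) + 1 / r)) integrable_on {\<tau>..t}"
    using sq(1)[OF t] by (intro integrable_on_mult_right integrable_add) auto
  have "norm (integral {\<tau>..t} (\<lambda>s. B *v u s)) \<le> integral {\<tau>..t} (\<lambda>s. \<beta> / 2 * (r * (u s \<bullet> u s) + 1 / r))"
  proof (rule integral_norm_bound_integral[OF control_integrable[OF trajectoryD(2)[OF assms(4)]] int])
    fix s
    have "0 \<le> (r * norm (u s) - 1)\<^sup>2 / r"
      using r by simp
    also have "\<dots> = r * (norm (u s))\<^sup>2 + 1 / r - 2 * norm (u s)"
      using r by (simp add: power2_eq_square field_simps)
    finally have "norm (u s) \<le> 1 / 2 * (r * (norm (u s))\<^sup>2 + 1 / r)"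
      by simp
    then have "\<beta> * norm (u s) \<le> \<beta> * (1 / 2 * (r * (norm (u s))\<^sup>2 + 1 / r))"
      by (rule mult_left_mono[OF _ \<beta>(1)])
    then show "norm (B *v u s) \<le> \<beta> / 2 * (r * (u s \<bullet> u s) + 1 / r)"
      using \<beta>(2)[of "u s"] by (simp add: power2_norm_eq_inner)
  qed (use t in auto)
  also have "\<dots> = \<beta> / 2 * (r * integral {\<tau>..t} (\<lambda>s. u s \<bullet> u s) + (t - \<tau>) / r)"
    using integral_add[OF integrable_on_mult_right[OF sq(1)[OF t]] integrable_const_ivl] assms by simp
  also have "\<dots> \<le> \<beta> / 2 * (r * K + (\<sigma> - \<tau>) / r)"
    using sq(2)[OF t] assms r by (intro mult_left_mono add_mono divide_right_mono) auto
  also have "(\<sigma> - \<tau>) / r = r"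
    using r by (simp add: field_simps)
  finally show ?thesis
    by (simp add: r_def algebra_simps)
qed

end

context tracking_coefficients
begin

lemma l_cong: "0 \<le> \<sigma> \<Longrightarrow> (\<And>s. s \<in> {0..\<sigma>} \<Longrightarrow> x s = z s) \<Longrightarrow> l \<sigma> x = l \<sigma> z"
  unfolding l_def by (auto intro!: arg_cong2[of _ _ _ _ "(+)"] integral_cong)

text \<open>
  The last two conclusions are the dynamic programming identity for \<open>l\<close> on \<open>[\<tau>, \<sigma>]\<close> and
  stationarity in the direction \<open>(v, Z)\<close>.
\<close>

lemma optimality_step:
  assumes \<tau>: "0 < \<tau>" "\<tau> < \<sigma>" "\<sigma> < T" and x: "continuous_on {0..\<tau>} x"
    and Z: "trajectory \<tau> v Z" "null_past \<tau> Z" "\<And>t. t \<in> {\<sigma>..T} \<Longrightarrow> v t = 0" and "0 < \<epsilon>"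
  obtains u W where "trajectory \<tau> u W" "\<And>s. s \<in> {0..\<tau>} \<Longrightarrow> W s = x s"
    "ip \<tau> u W u W \<le> 4 * (V \<tau> x + V \<tau> (\<lambda>_. 0)) + 8 * cst \<tau> + 8"
    "\<bar>l \<tau> W - l \<sigma> W + integral {\<tau>..\<sigma>} (\<lambda>t. (C *v W t) \<bullet> y t)\<bar> \<le> \<epsilon>"
    "\<bar>integral {\<tau>..\<sigma>} (\<lambda>t. (C *v W t) \<bullet> (C *v Z t) + u t \<bullet> v t) + b \<sigma> W Z\<bar> \<le> \<epsilon>"
proof -
  define K1 where "K1 = 1 + sqrt (4 * cst 0 + 2)"
  define K2 where "K2 = sqrt (ip \<tau> v Z v Z) + 2 * sqrt (ip \<sigma> v Z v Z - q \<sigma> Z)"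
  have Z\<sigma>: "trajectory \<sigma> v Z"
    using \<tau> by (intro trajectory_later[OF _ _ _ Z(1)]) auto
  have "0 \<le> K1"
    using cst_nonneg[of 0] by (simp add: K1_def)
  moreover have "0 \<le> K2"
    using q_le_ip[OF _ Z\<sigma>] ip_nonneg[OF _ Z(1)] \<tau> by (simp add: K2_def)
  ultimately have K: "0 < 1 + 2 * K1 + K2"
    by simp
  define \<delta> where "\<delta> = min 1 (\<epsilon> / (1 + 2 * K1 + K2))"
  have \<delta>: "0 < \<delta>" "\<delta> \<le> 1"
    using \<open>0 < \<epsilon>\<close> K by (auto simp: \<delta>_def)
  have "\<delta> \<le> \<epsilon> / (1 + 2 * K1 + K2)"
    by (simp add: \<delta>_def)
  then have "\<delta> * (1 + 2 * K1 + K2) \<le> \<epsilon>"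
    by (simp only: pos_le_divide_eq[OF K])
  moreover have "0 \<le> \<delta> * K1" "0 \<le> \<delta> * K2"
    using \<open>0 \<le> K1\<close> \<open>0 \<le> K2\<close> \<delta> by auto
  ultimately have \<epsilon>: "2 * (\<delta> * K1) \<le> \<epsilon>" "\<delta> * K2 \<le> \<epsilon>"
    using \<delta>(1) by (auto simp: distrib_left)
  have \<tau>': "\<tau> \<in> {0..T}" "0 \<le> \<tau>" "\<tau> \<in> {0<..<T}" "\<sigma> \<in> {0<..<T}" "\<tau> \<le> \<sigma>" "\<sigma> \<le> T"
    using \<tau> by auto
  obtain u W where W: "trajectory \<tau> u W" "\<And>s. s \<in> {0..\<tau>} \<Longrightarrow> W s = x s" "near_orthogonal \<tau> u W \<delta>"
    "ip \<tau> u W u W \<le> 4 * (V \<tau> x + V \<tau> (\<lambda>_. 0)) + 8 * cst \<tau> + 8"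
    by (rule near_orthogonal_exists[OF \<tau>'(1) x \<delta>]) blast
  note W\<sigma> = trajectory_later[OF \<tau>'(2,5,6) W(1)]
  note orth\<sigma> = near_orthogonal_later[OF \<tau>'(2,5,6) W(3)]
  have "\<bar>l \<tau> W - lin \<tau> W\<bar> \<le> \<delta> * K1" "\<bar>l \<sigma> W - lin \<sigma> W\<bar> \<le> \<delta> * K1"
    unfolding K1_def
    using near_orthogonal_value(2)[OF \<tau>'(3) W(1,3) \<delta>] near_orthogonal_value(2)[OF \<tau>'(4) W\<sigma> orth\<sigma> \<delta>]
    by auto
  then have 1: "\<bar>l \<tau> W - l \<sigma> W + integral {\<tau>..\<sigma>} (\<lambda>t. (C *v W t) \<bullet> y t)\<bar> \<le> \<epsilon>"
    using \<epsilon>(1) unfolding lin_split[OF \<tau>'(2,5,6) W(1)] by arith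
  have "\<bar>ip \<tau> u W v Z\<bar> \<le> \<delta> * sqrt (ip \<tau> v Z v Z)"
    using W(3) Z(1,2) by (simp add: near_orthogonal_def)
  moreover have "\<bar>ip \<sigma> u W v Z - b \<sigma> W Z\<bar> \<le> 2 * \<delta> * sqrt (ip \<sigma> v Z v Z - q \<sigma> Z)"
    by (rule near_orthogonal_bilinear[OF \<tau>'(4) W\<sigma> orth\<sigma> \<delta> Z\<sigma>])
  moreover have "\<delta> * sqrt (ip \<tau> v Z v Z) + 2 * \<delta> * sqrt (ip \<sigma> v Z v Z - q \<sigma> Z) \<le> \<epsilon>"
    using \<epsilon>(2) by (simp add: K2_def distrib_left)
  ultimately have "\<bar>integral {\<tau>..\<sigma>} (\<lambda>t. (C *v W t) \<bullet> (C *v Z t) + u t \<bullet> v t) + b \<sigma> W Z\<bar> \<le> \<epsilon>"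
    unfolding ip_split[OF \<tau>'(2,5,6) W(1) Z(1)] by arith
  with that[OF W(1,2,4) 1] show thesis
    by blast
qed

end

lemma tendsto_wedge_diagonal:
  assumes "((\<lambda>p. \<phi> (fst p) (snd p)) \<longlongrightarrow> c) (wedge \<tau>)"
  shows "((\<lambda>\<sigma>. \<phi> \<sigma> \<sigma>) \<longlongrightarrow> c) (at_right \<tau>)"
proof (rule topological_tendstoI)
  fix S assume "open S" "c \<in> S"
  then have "\<forall>\<^sub>F p in wedge \<tau>. \<phi> (fst p) (snd p) \<in> S"
    using assms by (rule topological_tendstoD[rotated])
  then have "\<forall>\<^sub>F \<sigma> in at_right \<tau>. \<forall>s\<in>{\<tau>..\<sigma>}. \<phi> \<sigma> s \<in> S"
    by (simp add: eventually_wedge)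
  then show "\<forall>\<^sub>F \<sigma> in at_right \<tau>. \<phi> \<sigma> \<sigma> \<in> S"
    using eventually_at_right_less[of \<tau>] by eventually_elim auto
qed

lemma tendsto_wedge_triangle:
  assumes f: "continuous_on {(s, \<sigma>). 0 \<le> s \<and> s \<le> \<sigma> \<and> \<sigma> \<le> T} (\<lambda>(s, \<sigma>). f s \<sigma>)" and \<tau>: "0 < \<tau>" "\<tau> < T"
  shows "((\<lambda>p. f (snd p) (fst p)) \<longlongrightarrow> f \<tau> \<tau>) (wedge \<tau>)"
proof -
  have "((\<lambda>p. (\<lambda>(s, \<sigma>). f s \<sigma>) (snd p, fst p)) \<longlongrightarrow> (\<lambda>(s, \<sigma>). f s \<sigma>) (\<tau>, \<tau>)) (wedge \<tau>)"
  proof (rule continuous_on_tendsto_compose[OF f])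
    show "((\<lambda>p. (snd p, fst p)) \<longlongrightarrow> (\<tau>, \<tau>)) (wedge \<tau>)"
      by (intro tendsto_Pair tendsto_wedge_ident)
    show "\<forall>\<^sub>F p in wedge \<tau>. (snd p, fst p) \<in> {(s, \<sigma>). 0 \<le> s \<and> s \<le> \<sigma> \<and> \<sigma> \<le> T}"
      using eventually_wedge_less[OF \<tau>(2)] by eventually_elim (use \<tau> in auto)
  qed (use \<tau> in auto)
  then show ?thesis
    by simp
qed

context tracking_coefficients
begin

lemma P1_bounded: obtains p where "0 < p"
  "\<And>s \<sigma> x. 0 \<le> s \<Longrightarrow> s \<le> \<sigma> \<Longrightarrow> \<sigma> \<le> T \<Longrightarrow> norm (P1 s \<sigma> *v x) \<le> p * norm x"
proof -
  have "closed {p. 0 \<le> fst p \<and> fst p \<le> snd p \<and> snd p \<le> T}"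
    by (intro closed_Collect_conj closed_Collect_le continuous_intros)
  moreover have "bounded {p::real \<times> real. 0 \<le> fst p \<and> fst p \<le> snd p \<and> snd p \<le> T}"
    by (rule bounded_subset[OF bounded_Times[OF bounded_closed_interval[of 0 T] bounded_closed_interval[of 0 T]]]) auto
  ultimately have "compact {p. 0 \<le> fst p \<and> fst p \<le> snd p \<and> snd p \<le> T}"
    by (simp add: compact_eq_bounded_closed)
  then have "bounded ((\<lambda>p. P1 (fst p) (snd p)) ` {p. 0 \<le> fst p \<and> fst p \<le> snd p \<and> snd p \<le> T})"
    using P1_cont by (intro compact_imp_bounded compact_continuous_image) (simp_all add: case_prod_beta')
  then obtain k where k: "0 < k" "\<And>s \<sigma>. 0 \<le> s \<Longrightarrow> s \<le> \<sigma> \<Longrightarrow> \<sigma> \<le> T \<Longrightarrow> norm (P1 s \<sigma>) \<le> k"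
    unfolding bounded_pos by auto
  obtain c where c: "c > 0" "\<And>X (v::real^'d). norm ((X::real^'d^'d) *v v) \<le> norm X * norm v * c"
    using bounded_bilinear.pos_bounded[OF bounded_bilinear_matrix_vector_mult] by metis
  show thesis
  proof
    show "0 < k * c"
      using k c by simp
    fix s \<sigma> :: real and x :: "real^'d" assume "0 \<le> s" "s \<le> \<sigma>" "\<sigma> \<le> T"
    then have "norm (P1 s \<sigma>) * norm x * c \<le> k * norm x * c"
      using k c by (intro mult_right_mono) auto
    then show "norm (P1 s \<sigma> *v x) \<le> k * c * norm x"
      using c(2)[of "P1 s \<sigma>" x] by (simp add: mult_ac)
  qed
qed

lemma P2_bounded: obtains p where "0 < p"
  "\<And>s \<nu> \<sigma> x. 0 \<le> s \<Longrightarrow> s \<le> \<sigma> \<Longrightarrow> 0 \<le> \<nu> \<Longrightarrow> \<nu> \<le> \<sigma> \<Longrightarrow> \<sigma> \<le> T \<Longrightarrow> norm (P2 s \<nu> \<sigma> *v x) \<le> p * norm x"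
proof -
  let ?S = "{p::real \<times> real \<times> real. 0 \<le> fst p \<and> fst p \<le> snd (snd p) \<and> 0 \<le> fst (snd p) \<and> fst (snd p) \<le> snd (snd p) \<and> snd (snd p) \<le> T}"
  have "closed ?S"
    by (intro closed_Collect_conj closed_Collect_le continuous_intros)
  moreover have "bounded ?S"
    by (rule bounded_subset[OF bounded_Times[OF bounded_closed_interval[of 0 T]
      bounded_Times[OF bounded_closed_interval[of 0 T] bounded_closed_interval[of 0 T]]]]) auto
  ultimately have "compact ?S"
    by (simp add: compact_eq_bounded_closed)
  then have "bounded ((\<lambda>p. P2 (fst p) (fst (snd p)) (snd (snd p))) ` ?S)"
    using P2_cont by (intro compact_imp_bounded compact_continuous_image) (simp_all add: case_prod_beta')
  then obtain k where k: "0 < k"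
    "\<And>s \<nu> \<sigma>. 0 \<le> s \<Longrightarrow> s \<le> \<sigma> \<Longrightarrow> 0 \<le> \<nu> \<Longrightarrow> \<nu> \<le> \<sigma> \<Longrightarrow> \<sigma> \<le> T \<Longrightarrow> norm (P2 s \<nu> \<sigma>) \<le> k"
    unfolding bounded_pos by auto
  obtain c where c: "c > 0" "\<And>X (v::real^'d). norm ((X::real^'d^'d) *v v) \<le> norm X * norm v * c"
    using bounded_bilinear.pos_bounded[OF bounded_bilinear_matrix_vector_mult] by metis
  show thesis
  proof
    show "0 < k * c"
      using k c by simp
    fix s \<nu> \<sigma> :: real and x :: "real^'d" assume "0 \<le> s" "s \<le> \<sigma>" "0 \<le> \<nu>" "\<nu> \<le> \<sigma>" "\<sigma> \<le> T"
    then have "norm (P2 s \<nu> \<sigma>) * norm x * c \<le> k * norm x * c"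
      using k c by (intro mult_right_mono) auto
    then show "norm (P2 s \<nu> \<sigma> *v x) \<le> k * c * norm x"
      using c(2)[of "P2 s \<nu> \<sigma>" x] by (simp add: mult_ac)
  qed
qed

lemma past1_moving_continuous:
  assumes "continuous_on {0..T} x"
  shows "continuous_on {0..T} (\<lambda>\<sigma>. past1 \<sigma> x)"
  unfolding past1_def
proof (rule continuous_on_integral_moving)
  show "continuous_on {(r, s). 0 \<le> r \<and> r \<le> s \<and> s \<le> T} (\<lambda>(r, s). P1 r s *v x r)"
    using P1_cont unfolding case_prod_beta
    by (intro continuous_intros continuous_on_compose2[OF assms]) auto
qed

lemma past2_short:
  assumes \<sigma>: "0 \<le> \<tau>" "\<tau> \<le> \<sigma>" "\<sigma> \<le> T" and x: "continuous_on {0..T} x" and z: "continuous_on {0..T} z"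
    and null: "null_past \<tau> z" and D: "\<And>s. s \<in> {0..\<sigma>} \<Longrightarrow> norm (x s) \<le> D" and Z: "\<And>s. s \<in> {0..\<sigma>} \<Longrightarrow> norm (z s) \<le> Z"
    and p: "0 < p" "\<And>s \<nu> \<sigma> w. 0 \<le> s \<Longrightarrow> s \<le> \<sigma> \<Longrightarrow> 0 \<le> \<nu> \<Longrightarrow> \<nu> \<le> \<sigma> \<Longrightarrow> \<sigma> \<le> T \<Longrightarrow> norm (P2 s \<nu> \<sigma> *v w) \<le> p * norm w"
  shows "\<bar>past2 \<sigma> x z\<bar> \<le> (\<sigma> - \<tau>) * (T * (p * D * Z))" "\<bar>past2 \<sigma> z x\<bar> \<le> (\<sigma> - \<tau>) * (T * (p * D * Z))"
proof -
  have \<sigma>': "\<sigma> \<in> {0..T}"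
    using \<sigma> by auto
  have c: "continuous_on {0..\<sigma>} x" "continuous_on {0..\<sigma>} z"
    using \<sigma> by (auto intro: continuous_on_subset[OF x] continuous_on_subset[OF z])
  have D0: "0 \<le> D" and Z0: "0 \<le> Z"
    using D[of 0] Z[of 0] \<sigma> norm_ge_zero[of "x 0"] norm_ge_zero[of "z 0"] by (auto simp del: norm_ge_zero)
  have drop: "integral {0..\<sigma>} f = integral {\<tau>..\<sigma>} f"
    if "continuous_on {0..\<sigma>} f" "\<And>s. s \<in> {0..\<tau>} \<Longrightarrow> f s = 0" for f :: "real \<Rightarrow> real"
  proof -
    have "integral {0..\<tau>} f + integral {\<tau>..\<sigma>} f = integral {0..\<sigma>} f"
      using \<sigma> by (intro Henstock_Kurzweil_Integration.integral_combine integrable_continuous_real that) auto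
    moreover have "integral {0..\<tau>} f = integral {0..\<tau>} (\<lambda>_. 0)"
      by (intro integral_cong that)
    ultimately show ?thesis
      by simp
  qed
  have pt: "norm (x' s \<bullet> (P2 s \<nu> \<sigma> *v z' \<nu>)) \<le> p * D * Z"
    if "norm (x' s) * norm (z' \<nu>) \<le> D * Z" "s \<in> {0..\<sigma>}" "\<nu> \<in> {0..\<sigma>}" for x' z' :: "real \<Rightarrow> real^'d" and s \<nu>
  proof -
    have "norm (x' s \<bullet> (P2 s \<nu> \<sigma> *v z' \<nu>)) \<le> norm (x' s) * norm (P2 s \<nu> \<sigma> *v z' \<nu>)"
      unfolding real_norm_def by (rule Cauchy_Schwarz_ineq2)
    also have "\<dots> \<le> norm (x' s) * (p * norm (z' \<nu>))"
      using that \<sigma> by (intro mult_left_mono p(2)) auto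
    also have "\<dots> = p * (norm (x' s) * norm (z' \<nu>))"
      by simp
    also have "\<dots> \<le> p * (D * Z)"
      using that p by (intro mult_left_mono) auto
    finally show ?thesis
      by (simp add: mult.assoc)
  qed
  have pD: "0 \<le> p * D * Z"
    using p D0 Z0 by simp
  have "norm (past2 \<sigma> x z) \<le> (p * D * Z * (\<sigma> - \<tau>)) * (\<sigma> - 0)"
    unfolding past2_def
  proof (rule integral_bound[OF _ past2_outer_continuous[OF \<sigma>' c]])
    fix s assume s: "s \<in> {0..\<sigma>}"
    have cont: "continuous_on {0..\<sigma>} (\<lambda>\<nu>. x s \<bullet> (P2 s \<nu> \<sigma> *v z \<nu>))"
      by (rule past2_inner_continuous[OF \<sigma>' c s])
    have "integral {0..\<sigma>} (\<lambda>\<nu>. x s \<bullet> (P2 s \<nu> \<sigma> *v z \<nu>)) = integral {\<tau>..\<sigma>} (\<lambda>\<nu>. x s \<bullet> (P2 s \<nu> \<sigma> *v z \<nu>))"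
      using null by (intro drop cont) (auto simp: null_past_def)
    also have "norm \<dots> \<le> p * D * Z * (\<sigma> - \<tau>)"
      using \<sigma> s D Z D0 by (intro integral_bound continuous_on_subset[OF cont] pt mult_mono) auto
    finally show "norm (integral {0..\<sigma>} (\<lambda>\<nu>. x s \<bullet> (P2 s \<nu> \<sigma> *v z \<nu>))) \<le> p * D * Z * (\<sigma> - \<tau>)" .
  qed (use \<sigma> in auto)
  also have "\<dots> \<le> (p * D * Z * (\<sigma> - \<tau>)) * T"
    using pD \<sigma> by (intro mult_left_mono) auto
  finally show "\<bar>past2 \<sigma> x z\<bar> \<le> (\<sigma> - \<tau>) * (T * (p * D * Z))"
    by (simp add: mult_ac)
  have cont: "continuous_on {0..\<sigma>} (\<lambda>s. integral {0..\<sigma>} (\<lambda>\<nu>. z s \<bullet> (P2 s \<nu> \<sigma> *v x \<nu>)))"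
    by (rule past2_outer_continuous[OF \<sigma>' c(2,1)])
  have "past2 \<sigma> z x = integral {\<tau>..\<sigma>} (\<lambda>s. integral {0..\<sigma>} (\<lambda>\<nu>. z s \<bullet> (P2 s \<nu> \<sigma> *v x \<nu>)))"
    unfolding past2_def using null by (intro drop cont) (auto simp: null_past_def)
  also have "norm \<dots> \<le> (p * D * Z * (\<sigma> - 0)) * (\<sigma> - \<tau>)"
  proof (rule integral_bound[OF _ continuous_on_subset[OF cont]])
    fix s assume s: "s \<in> {\<tau>..\<sigma>}"
    have DZ: "norm (z s) * norm (x \<nu>) \<le> D * Z" if "\<nu> \<in> {0..\<sigma>}" for \<nu>
      using mult_mono[OF D[OF that] Z[of s] D0] s \<sigma> by (simp add: mult.commute)
    show "norm (integral {0..\<sigma>} (\<lambda>\<nu>. z s \<bullet> (P2 s \<nu> \<sigma> *v x \<nu>))) \<le> p * D * Z * (\<sigma> - 0)"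
      using \<sigma> s by (intro integral_bound past2_inner_continuous[OF \<sigma>' c(2,1)] pt DZ) auto
  qed (use \<sigma> in auto)
  also have "\<dots> \<le> (p * D * Z * T) * (\<sigma> - \<tau>)"
    using pD \<sigma> by (intro mult_right_mono mult_left_mono) auto
  finally show "\<bar>past2 \<sigma> z x\<bar> \<le> (\<sigma> - \<tau>) * (T * (p * D * Z))"
    by (simp add: mult_ac)
qed

lemma kernel_quotient_tendsto:
  assumes H1: "H1_deriv 0 T \<xi> g" and \<tau>: "0 < \<tau>" "\<tau> < T"
  shows "((\<lambda>\<sigma>. (1 / (\<sigma> - \<tau>)) * integral {0..\<tau>} (\<lambda>s. (\<xi> (\<sigma> - s) - \<xi> (\<tau> - s)) \<bullet> d2 s \<sigma>))
    \<longlongrightarrow> integral {0..\<tau>} (\<lambda>s. g s \<bullet> d2 (\<tau> - s) \<tau>)) (at_right \<tau>)"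
proof -
  note \<xi> = H1_deriv_imp_continuous_on[OF H1]
  have d: "continuous_on {0..\<tau>} (\<lambda>r. d2 (\<tau> - r) \<sigma>)" if "\<tau> \<le> \<sigma>" "\<sigma> \<le> T" for \<sigma>
    by (rule continuous_on_compose2[OF d2_cont, of _ "\<lambda>r. (\<tau> - r, \<sigma>)", simplified])
      (use that \<tau> in \<open>auto intro!: continuous_intros\<close>)
  define I1 where "I1 \<sigma> = (1 / (\<sigma> - \<tau>)) * integral {0..\<tau>} (\<lambda>r. (\<xi> (r + (\<sigma> - \<tau>)) - \<xi> r) \<bullet> d2 (\<tau> - r) \<tau>)" for \<sigma>
  define I2 where "I2 \<sigma> = (1 / (\<sigma> - \<tau>)) * integral {0..\<tau>} (\<lambda>r. (\<xi> (r + (\<sigma> - \<tau>)) - \<xi> r) \<bullet> (d2 (\<tau> - r) \<sigma> - d2 (\<tau> - r) \<tau>))" for \<sigma>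
  have ev: "\<forall>\<^sub>F \<sigma> in at_right \<tau>. \<sigma> \<in> {\<tau><..<T}"
    by (rule eventually_at_right_real[OF \<tau>(2)])
  have shift: "continuous_on {0..\<tau>} (\<lambda>r. \<xi> (r + (\<sigma> - \<tau>)) - \<xi> r)" if "\<sigma> \<in> {\<tau><..<T}" for \<sigma>
    by (intro continuous_intros continuous_on_compose2[OF \<xi>]) (use that \<tau> in auto)
  have "(I1 \<longlongrightarrow> integral {0..\<tau>} (\<lambda>s. g s \<bullet> d2 (\<tau> - s) \<tau>)) (at_right \<tau>)"
    unfolding filterlim_at_right_to_0[of _ _ \<tau>]
    using difference_quotient_tendsto[OF H1 less_imp_le[OF \<tau>(1)] \<tau>(2) d[of \<tau>]] \<tau> by (simp add: I1_def)
  moreover have "(I2 \<longlongrightarrow> 0) (at_right \<tau>)"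
  proof (rule tendstoI)
    fix \<epsilon> :: real assume "0 < \<epsilon>"
    obtain K where K: "0 < K" "\<And>\<beta> h. 0 \<le> \<beta> \<Longrightarrow> \<beta> + h \<le> T \<Longrightarrow> 0 \<le> h \<Longrightarrow>
        integral {0..\<beta>} (\<lambda>r. norm (\<xi> (r + h) - \<xi> r)) \<le> h * K"
      by (rule integral_norm_diff_bounded[OF H1]) blast
    have \<eta>: "0 < \<epsilon> / (2 * K)"
      using \<open>0 < \<epsilon>\<close> K by simp
    have "continuous_on ({\<tau>..T} \<times> {0..\<tau>}) (\<lambda>p. (\<lambda>(s, \<sigma>). d2 s \<sigma>) (\<tau> - snd p, fst p))"
      by (rule continuous_on_compose2[OF d2_cont]) (use \<tau> in \<open>auto intro!: continuous_intros\<close>)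
    then have "continuous_on ({\<tau>..T} \<times> {0..\<tau>}) (\<lambda>(\<sigma>, r). d2 (\<tau> - r) \<sigma>)"
      by (simp add: case_prod_beta)
    from uniform_in_parameter[OF this _ \<eta>, of \<tau>]
    have "\<forall>\<^sub>F \<sigma> in at_right \<tau>. \<forall>r\<in>{0..\<tau>}. dist (d2 (\<tau> - r) \<sigma>) (d2 (\<tau> - r) \<tau>) < \<epsilon> / (2 * K)"
      using \<tau> at_within_Icc_at_right[OF \<tau>(2)] by simp
    then show "\<forall>\<^sub>F \<sigma> in at_right \<tau>. dist (I2 \<sigma>) 0 < \<epsilon>"
      using ev
    proof eventually_elim
      case (elim \<sigma>)
      have "\<bar>integral {0..\<tau>} (\<lambda>r. (\<xi> (r + (\<sigma> - \<tau>)) - \<xi> r) \<bullet> (d2 (\<tau> - r) \<sigma> - d2 (\<tau> - r) \<tau>))\<bar>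
          \<le> \<epsilon> / (2 * K) * ((\<sigma> - \<tau>) * K)"
      proof (rule inner_integral_le)
        show "(\<lambda>r. (\<xi> (r + (\<sigma> - \<tau>)) - \<xi> r) \<bullet> (d2 (\<tau> - r) \<sigma> - d2 (\<tau> - r) \<tau>)) integrable_on {0..\<tau>}"
          using elim by (intro integrable_continuous_real continuous_on_inner shift continuous_on_diff d) auto
        show "(\<lambda>r. norm (\<xi> (r + (\<sigma> - \<tau>)) - \<xi> r)) integrable_on {0..\<tau>}"
          using elim by (intro integrable_continuous_real continuous_on_norm shift) auto
        show "integral {0..\<tau>} (\<lambda>r. norm (\<xi> (r + (\<sigma> - \<tau>)) - \<xi> r)) \<le> (\<sigma> - \<tau>) * K"
          using elim \<tau> by (intro K(2)) auto
        show "norm (d2 (\<tau> - r) \<sigma> - d2 (\<tau> - r) \<tau>) \<le> \<epsilon> / (2 * K)" if "r \<in> {0..\<tau>}" for r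
          using elim that by (auto simp: dist_norm less_imp_le)
      qed (use \<eta> in simp)
      also have "\<dots> = (\<sigma> - \<tau>) * (\<epsilon> / 2)"
        using K by simp
      finally have "\<bar>I2 \<sigma>\<bar> \<le> (1 / (\<sigma> - \<tau>)) * ((\<sigma> - \<tau>) * (\<epsilon> / 2))"
        unfolding I2_def abs_mult using elim by (intro mult_mono) auto
      then show ?case
        using elim \<open>0 < \<epsilon>\<close> by simp
    qed
  qed
  ultimately have "((\<lambda>\<sigma>. I1 \<sigma> + I2 \<sigma>) \<longlongrightarrow> integral {0..\<tau>} (\<lambda>s. g s \<bullet> d2 (\<tau> - s) \<tau>) + 0) (at_right \<tau>)"
    by (rule tendsto_add)
  then have lim: "((\<lambda>\<sigma>. I1 \<sigma> + I2 \<sigma>) \<longlongrightarrow> integral {0..\<tau>} (\<lambda>s. g s \<bullet> d2 (\<tau> - s) \<tau>)) (at_right \<tau>)"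
    by simp
  show ?thesis
  proof (rule Lim_transform_eventually[OF lim])
    show "\<forall>\<^sub>F \<sigma> in at_right \<tau>. I1 \<sigma> + I2 \<sigma>
        = (1 / (\<sigma> - \<tau>)) * integral {0..\<tau>} (\<lambda>s. (\<xi> (\<sigma> - s) - \<xi> (\<tau> - s)) \<bullet> d2 s \<sigma>)"
      using ev
    proof eventually_elim
      case (elim \<sigma>)
      let ?F = "\<lambda>r. (\<xi> (r + (\<sigma> - \<tau>)) - \<xi> r) \<bullet> d2 (\<tau> - r) \<sigma>"
      have F: "continuous_on {0..\<tau>} ?F"
        using elim by (intro continuous_on_inner shift d) auto
      have "integral {0..\<tau>} (\<lambda>s. (\<xi> (\<sigma> - s) - \<xi> (\<tau> - s)) \<bullet> d2 s \<sigma>) = integral {0..\<tau>} (\<lambda>s. ?F (\<tau> - s))"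
        by (simp add: algebra_simps)
      also have "\<dots> = integral {0..\<tau>} ?F"
        by (rule integral_reflect_interval[OF F])
      also have "\<dots> = integral {0..\<tau>} (\<lambda>r. (\<xi> (r + (\<sigma> - \<tau>)) - \<xi> r) \<bullet> d2 (\<tau> - r) \<tau>
          + (\<xi> (r + (\<sigma> - \<tau>)) - \<xi> r) \<bullet> (d2 (\<tau> - r) \<sigma> - d2 (\<tau> - r) \<tau>))"
        by (simp add: inner_diff_right)
      also have "\<dots> = integral {0..\<tau>} (\<lambda>r. (\<xi> (r + (\<sigma> - \<tau>)) - \<xi> r) \<bullet> d2 (\<tau> - r) \<tau>)
          + integral {0..\<tau>} (\<lambda>r. (\<xi> (r + (\<sigma> - \<tau>)) - \<xi> r) \<bullet> (d2 (\<tau> - r) \<sigma> - d2 (\<tau> - r) \<tau>))"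
        using elim by (intro integral_add integrable_continuous_real continuous_on_inner shift continuous_on_diff d) auto
      finally show ?case
        by (simp add: I1_def I2_def distrib_left)
    qed
  qed
qed

lemma increment_estimate:
  assumes \<tau>: "0 < \<tau>" "\<tau> < \<sigma>" "\<sigma> < T" and \<xi>: "continuous_on {0..T} \<xi>"
    and W: "trajectory \<tau> u W" "\<And>s. s \<in> {0..\<tau>} \<Longrightarrow> W s = \<xi> (\<tau> - s)"
    and Z: "trajectory \<tau> v Z" and v: "\<And>t. t < \<sigma> \<Longrightarrow> v t = transpose B *v d1 \<sigma>"
    and 1: "\<bar>l \<tau> W - l \<sigma> W + integral {\<tau>..\<sigma>} (\<lambda>t. (C *v W t) \<bullet> y t)\<bar> \<le> \<epsilon>"
    and 2: "\<bar>integral {\<tau>..\<sigma>} (\<lambda>t. (C *v W t) \<bullet> (C *v Z t) + u t \<bullet> v t) + b \<sigma> W Z\<bar> \<le> \<epsilon>"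
  shows "\<bar>(l \<sigma> (\<lambda>s. \<xi> (\<sigma> - s)) - l \<tau> (\<lambda>s. \<xi> (\<tau> - s)))
    - (integral {\<tau>..\<sigma>} (\<lambda>t. (C *v W t) \<bullet> y t) - integral {\<tau>..\<sigma>} (\<lambda>t. d1 \<sigma> \<bullet> drift W t)
       + integral {\<tau>..\<sigma>} (\<lambda>t. (C *v W t) \<bullet> (C *v Z t)) + b \<sigma> W Z
       + integral {\<tau>..\<sigma>} (\<lambda>s. (\<xi> (\<sigma> - s) - W s) \<bullet> d2 s \<sigma>)
       + integral {0..\<tau>} (\<lambda>s. (\<xi> (\<sigma> - s) - \<xi> (\<tau> - s)) \<bullet> d2 s \<sigma>))\<bar> \<le> 2 * \<epsilon>"
proof -
  have \<sigma>': "\<sigma> \<in> {0..T}" and sub: "{\<tau>..\<sigma>} \<subseteq> {0..T}" "{\<tau>..\<sigma>} \<subseteq> {\<tau>..T}"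
    using \<tau> by auto
  note W' = trajectoryD[OF W(1)] and Z' = trajectoryD[OF Z]
  have \<xi>\<sigma>: "continuous_on {0..\<sigma>} (\<lambda>s. \<xi> (\<sigma> - s))"
    by (rule continuous_on_compose2[OF \<xi>]) (use \<tau> in \<open>auto intro!: continuous_intros\<close>)
  have W\<sigma>: "continuous_on {0..\<sigma>} W"
    using \<tau> by (intro continuous_on_subset[OF W'(1)]) auto
  have l\<tau>: "l \<tau> (\<lambda>s. \<xi> (\<tau> - s)) = l \<tau> W"
    using \<tau> W(2) by (intro l_cong) auto
  define Bu where "Bu = integral {\<tau>..\<sigma>} (\<lambda>s. B *v u s)"
  have Bu: "(\<lambda>s. B *v u s) integrable_on {\<tau>..\<sigma>}"
    by (rule control_integrable[OF W'(2) sub(2)])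
  have dr: "drift W integrable_on {\<tau>..\<sigma>}"
    by (rule drift_integrable[OF W'(1) sub(1)])
  have "W \<sigma> = W \<tau> + integral {\<tau>..\<sigma>} (drift W) + Bu"
    unfolding Bu_def using \<tau> by (intro W'(3)) auto
  moreover have "W \<tau> = \<xi> 0"
    using W(2)[of \<tau>] \<tau> by simp
  ultimately have W\<sigma>eq: "W \<sigma> = \<xi> 0 + integral {\<tau>..\<sigma>} (drift W) + Bu"
    by simp
  have ue: "u s \<bullet> (transpose B *v d1 \<sigma>) = (B *v u s) \<bullet> d1 \<sigma>" for s
    by (metis dot_lmul_matrix inner_commute transpose_matrix_vector)
  have "Bu \<bullet> d1 \<sigma> = integral {\<tau>..\<sigma>} (\<lambda>s. u s \<bullet> (transpose B *v d1 \<sigma>))"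
    unfolding ue Bu_def using integral_linear[OF Bu bounded_linear_inner_left[of "d1 \<sigma>"]] by (simp add: o_def)
  also have "\<dots> = integral {\<tau>..\<sigma>} (\<lambda>s. u s \<bullet> v s)"
    by (rule integral_spike[of "{\<sigma>}"]) (use v in auto)
  finally have 3: "Bu \<bullet> d1 \<sigma> = integral {\<tau>..\<sigma>} (\<lambda>s. u s \<bullet> v s)" .
  have 4: "integral {\<tau>..\<sigma>} (drift W) \<bullet> d1 \<sigma> = integral {\<tau>..\<sigma>} (\<lambda>t. d1 \<sigma> \<bullet> drift W t)"
    using integral_linear[OF dr bounded_linear_inner_left[of "d1 \<sigma>"]] by (simp add: o_def inner_commute)
  have 5: "integral {\<tau>..\<sigma>} (\<lambda>t. (C *v W t) \<bullet> (C *v Z t) + u t \<bullet> v t)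
      = integral {\<tau>..\<sigma>} (\<lambda>t. (C *v W t) \<bullet> (C *v Z t)) + integral {\<tau>..\<sigma>} (\<lambda>s. u s \<bullet> v s)"
    by (intro integral_add integrable_continuous_real continuous_on_inner output_continuous_on W' Z' sub
        L2_inner_integrable_on L2_subinterval[OF W'(2)] L2_subinterval[OF Z'(2)])
  let ?k = "\<lambda>s. (\<xi> (\<sigma> - s) - W s) \<bullet> d2 s \<sigma>"
  have kc: "continuous_on {0..\<sigma>} ?k"
    by (intro continuous_intros \<xi>\<sigma> W\<sigma> d2_continuous_on \<sigma>')
  have "integral {0..\<tau>} ?k + integral {\<tau>..\<sigma>} ?k = integral {0..\<sigma>} ?k"
    using \<tau> by (intro Henstock_Kurzweil_Integration.integral_combine integrable_continuous_real kc) auto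
  moreover have "integral {0..\<tau>} ?k = integral {0..\<tau>} (\<lambda>s. (\<xi> (\<sigma> - s) - \<xi> (\<tau> - s)) \<bullet> d2 s \<sigma>)"
    using W(2) by (intro integral_cong) auto
  moreover have "l \<sigma> (\<lambda>s. \<xi> (\<sigma> - s)) - l \<sigma> W = l \<sigma> (\<lambda>s. \<xi> (\<sigma> - s) + (-1) *\<^sub>R W s)"
    unfolding l_add[OF \<sigma>' \<xi>\<sigma> W\<sigma>] by simp
  moreover have "\<dots> = (\<xi> 0 - W \<sigma>) \<bullet> d1 \<sigma> + integral {0..\<sigma>} ?k"
    by (simp add: l_def)
  moreover have "(\<xi> 0 - W \<sigma>) \<bullet> d1 \<sigma> = - (integral {\<tau>..\<sigma>} (\<lambda>t. d1 \<sigma> \<bullet> drift W t)) - integral {\<tau>..\<sigma>} (\<lambda>s. u s \<bullet> v s)"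
    unfolding W\<sigma>eq 3[symmetric] 4[symmetric] by (simp add: inner_diff_left inner_add_left)
  ultimately show ?thesis
    using 1 2 unfolding 5 l\<tau> by arith
qed

subsection \<open>The derivative of the linear part\<close>

lemma l_right_derivative:
  assumes H1: "H1_deriv 0 T \<xi> g" and \<tau>: "0 < \<tau>" "\<tau> < T"
  defines "xe \<equiv> \<lambda>r. \<xi> (max 0 (\<tau> - r))"
  shows "((\<lambda>\<sigma>. (l \<sigma> (\<lambda>s. \<xi> (\<sigma> - s)) - l \<tau> (\<lambda>s. \<xi> (\<tau> - s))) / (\<sigma> - \<tau>)) \<longlongrightarrow>
    (C *v \<xi> 0) \<bullet> y \<tau> - d1 \<tau> \<bullet> drift xe \<tau>
    + (B *v (transpose B *v d1 \<tau>)) \<bullet> (P0 \<tau> *v \<xi> 0 + past1 \<tau> xe)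
    + integral {0..\<tau>} (\<lambda>s. g s \<bullet> d2 (\<tau> - s) \<tau>)) (at_right \<tau>)"
proof -
  have \<tau>': "\<tau> \<in> {0..T}" "0 \<le> \<tau>"
    using \<tau> by auto
  note \<xi> = H1_deriv_imp_continuous_on[OF H1]
  have xe: "continuous_on {0..T} xe"
    unfolding xe_def by (rule continuous_on_compose2[OF \<xi>]) (use \<tau> in \<open>auto intro!: continuous_intros\<close>)
  have xe_past: "continuous_on {0..\<tau>} xe"
    by (rule continuous_on_subset[OF xe]) (use \<tau> in auto)
  define e where "e \<sigma> = transpose B *v d1 \<sigma>" for \<sigma>
  have e: "continuous_on {0..T} e"
    unfolding e_def by (intro continuous_intros d1_cont)
  define v where "v \<sigma> t = (if t < \<sigma> then e \<sigma> else 0)" for \<sigma> t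
  define K where "K = 4 * (V \<tau> xe + V \<tau> (\<lambda>_. 0)) + 8 * cst \<tau> + 8"
  have K: "0 \<le> K"
    using V_nonneg[OF \<tau>'(1) xe_past] V_nonneg[OF \<tau>'(1) continuous_on_const] cst_nonneg[OF \<tau>'(2)]
    by (simp add: K_def)
  define Q where "Q \<sigma> u W Z \<longleftrightarrow> trajectory \<tau> (v \<sigma>) Z \<and> null_past \<tau> Z \<and> trajectory \<tau> u W \<and>
      (\<forall>s\<in>{0..\<tau>}. W s = xe s) \<and> ip \<tau> u W u W \<le> K \<and>
      \<bar>l \<tau> W - l \<sigma> W + integral {\<tau>..\<sigma>} (\<lambda>t. (C *v W t) \<bullet> y t)\<bar> \<le> (\<sigma> - \<tau>)\<^sup>2 \<and>
      \<bar>integral {\<tau>..\<sigma>} (\<lambda>t. (C *v W t) \<bullet> (C *v Z t) + u t \<bullet> v \<sigma> t) + b \<sigma> W Z\<bar> \<le> (\<sigma> - \<tau>)\<^sup>2"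
    for \<sigma> u W Z
  have "\<forall>\<sigma>\<in>{\<tau><..<T}. \<exists>p. Q \<sigma> (fst p) (fst (snd p)) (snd (snd p))"
  proof
    fix \<sigma> assume \<sigma>: "\<sigma> \<in> {\<tau><..<T}"
    have ce: "(\<lambda>_. e \<sigma>) \<in> L2 a T" for a
      by (rule continuous_on_imp_L2) simp
    have "(\<lambda>t. e \<sigma> + (-1) *\<^sub>R (if t < \<sigma> then 0 else e \<sigma>)) \<in> L2 \<tau> T"
      using \<sigma> by (intro L2_add_scaleR L2_if_less ce) auto
    moreover have "(\<lambda>t. e \<sigma> + (-1) *\<^sub>R (if t < \<sigma> then 0 else e \<sigma>)) = v \<sigma>"
      by (auto simp: v_def)
    ultimately have "v \<sigma> \<in> L2 \<tau> T"
      by simp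
    then obtain Z where Z: "trajectory \<tau> (v \<sigma>) Z" "\<And>s. s \<in> {0..\<tau>} \<Longrightarrow> Z s = 0"
      by (rule trajectory_exists[OF \<tau>'(1) _ continuous_on_const]) blast
    have np: "null_past \<tau> Z"
      using Z(2) by (simp add: null_past_def)
    have v0: "v \<sigma> t = 0" if "t \<in> {\<sigma>..T}" for t
      using that by (simp add: v_def)
    have s: "\<tau> < \<sigma>" "\<sigma> < T" "0 < (\<sigma> - \<tau>)\<^sup>2"
      using \<sigma> by auto
    show "\<exists>p. Q \<sigma> (fst p) (fst (snd p)) (snd (snd p))"
    proof (rule optimality_step[OF \<tau>(1) s(1,2) xe_past Z(1) np v0 s(3)])
      fix u W
      assume "trajectory \<tau> u W" "\<And>s. s \<in> {0..\<tau>} \<Longrightarrow> W s = xe s"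
      "ip \<tau> u W u W \<le> 4 * (V \<tau> xe + V \<tau> (\<lambda>_. 0)) + 8 * cst \<tau> + 8"
      "\<bar>l \<tau> W - l \<sigma> W + integral {\<tau>..\<sigma>} (\<lambda>t. (C *v W t) \<bullet> y t)\<bar> \<le> (\<sigma> - \<tau>)\<^sup>2"
      "\<bar>integral {\<tau>..\<sigma>} (\<lambda>t. (C *v W t) \<bullet> (C *v Z t) + u t \<bullet> v \<sigma> t) + b \<sigma> W Z\<bar> \<le> (\<sigma> - \<tau>)\<^sup>2"
      then have "Q \<sigma> u W Z"
        using Z(1) np unfolding Q_def K_def by blast
      then show ?thesis
        by (intro exI[of _ "(u, W, Z)"]) simp
    qed
  qed
  from bchoice[OF this] obtain sel where sel:
    "\<forall>\<sigma>\<in>{\<tau><..<T}. Q \<sigma> (fst (sel \<sigma>)) (fst (snd (sel \<sigma>))) (snd (snd (sel \<sigma>)))"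
    by blast
  define u where "u \<sigma> = fst (sel \<sigma>)" for \<sigma>
  define W where "W \<sigma> = fst (snd (sel \<sigma>))" for \<sigma>
  define Z where "Z \<sigma> = snd (snd (sel \<sigma>))" for \<sigma>
  have Q: "trajectory \<tau> (v \<sigma>) (Z \<sigma>)" "null_past \<tau> (Z \<sigma>)" "trajectory \<tau> (u \<sigma>) (W \<sigma>)"
      "\<And>s. s \<in> {0..\<tau>} \<Longrightarrow> W \<sigma> s = xe s" "ip \<tau> (u \<sigma>) (W \<sigma>) (u \<sigma>) (W \<sigma>) \<le> K"
      "\<bar>l \<tau> (W \<sigma>) - l \<sigma> (W \<sigma>) + integral {\<tau>..\<sigma>} (\<lambda>t. (C *v W \<sigma> t) \<bullet> y t)\<bar> \<le> (\<sigma> - \<tau>)\<^sup>2"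
      "\<bar>integral {\<tau>..\<sigma>} (\<lambda>t. (C *v W \<sigma> t) \<bullet> (C *v Z \<sigma> t) + u \<sigma> t \<bullet> v \<sigma> t) + b \<sigma> (W \<sigma>) (Z \<sigma>)\<bar> \<le> (\<sigma> - \<tau>)\<^sup>2"
    if "\<sigma> \<in> {\<tau><..<T}" for \<sigma>
    using sel that unfolding Q_def u_def W_def Z_def by blast+

  obtain X where X: "0 < X" "\<And>s. s \<in> {0..T} \<Longrightarrow> norm (xe s) \<le> X"
    by (rule bounded_on_interval[OF xe]) blast
  obtain E where E: "0 < E" "\<And>s. s \<in> {0..T} \<Longrightarrow> norm (e s) \<le> E"
    by (rule bounded_on_interval[OF e]) blast
  obtain \<beta> where "\<And>x. norm (B *v x) \<le> norm x * \<beta>" "0 \<le> \<beta>"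
    using bounded_linear.nonneg_bounded[OF matrix_vector_mul_bounded_linear] by blast
  then have \<beta>: "0 \<le> \<beta>" "\<And>x. norm (B *v x) \<le> \<beta> * norm x"
    by (simp_all add: mult.commute)
  define cU where "cU = \<beta> / 2 * (K + 1)"
  have cU: "0 \<le> cU"
    using \<beta> K by (simp add: cU_def)
  define D where "D = 2 * (X + cU * sqrt T)"
  define \<rho> where "\<rho> \<sigma> = rate * D * (\<sigma> - \<tau>) + cU * sqrt (\<sigma> - \<tau>)" for \<sigma>
  define \<zeta> where "\<zeta> \<sigma> = 2 * (\<beta> * E * (\<sigma> - \<tau>))" for \<sigma>
  define good where "good \<sigma> \<longleftrightarrow> \<sigma> \<in> {\<tau><..<T} \<and> rate * (\<sigma> - \<tau>) \<le> 1 / 2" for \<sigma>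
  have ev: "\<forall>\<^sub>F \<sigma> in at_right \<tau>. good \<sigma>"
  proof -
    have "\<tau> < min T (\<tau> + 1 / (2 * rate))"
      using \<tau> rate_pos by simp
    from eventually_at_right_real[OF this] show ?thesis
      by eventually_elim (use rate_pos in \<open>auto simp: good_def field_simps\<close>)
  qed
  then have evw: "\<forall>\<^sub>F p in wedge \<tau>. good (fst p) \<and> snd p \<in> {\<tau>..fst p}"
    unfolding eventually_wedge by eventually_elim auto
  have good: "\<tau> < \<sigma>" "\<sigma> < T" "\<tau> \<le> \<sigma>" "\<sigma> \<le> T" "\<sigma> \<in> {\<tau><..<T}" "\<sigma> \<in> {0..T}" "{\<tau>..\<sigma>} \<subseteq> {0..T}" "rate * (\<sigma> - \<tau>) \<le> 1 / 2"
    if "good \<sigma>" for \<sigma>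
    using that \<tau> by (auto simp: good_def)
  have \<rho>: "(\<rho> \<longlongrightarrow> 0) (at_right \<tau>)" and \<zeta>: "(\<zeta> \<longlongrightarrow> 0) (at_right \<tau>)"
    unfolding \<rho>_def \<zeta>_def by (auto intro!: tendsto_eq_intros)

  have Wb: "norm (W \<sigma> s) \<le> D" if "good \<sigma>" "s \<in> {0..\<sigma>}" for \<sigma> s
  proof -
    note g = good[OF that(1)]
    have "norm (W \<sigma> s) \<le> 2 * (X + cU * sqrt (\<sigma> - \<tau>))"
    proof (rule trajectory_short_bound[OF \<tau>'(2) g(3,4,8) Q(3)[OF g(5)]])
      show "norm (W \<sigma> s) \<le> X" if "s \<in> {0..\<tau>}" for s
        using Q(4)[OF g(5) that] X(2)[of s] that \<tau> by auto
      show "norm (integral {\<tau>..t} (\<lambda>s. B *v u \<sigma> s)) \<le> cU * sqrt (\<sigma> - \<tau>)" if "t \<in> {\<tau>..\<sigma>}" for t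
        unfolding cU_def by (rule control_short_bound[OF \<tau>'(2) g(1,4) Q(3,5)[OF g(5)] that \<beta>])
    qed (use that in auto)
    also have "\<dots> \<le> D"
      unfolding D_def using g \<tau> cU by (intro mult_left_mono add_left_mono real_sqrt_le_mono) auto
    finally show ?thesis .
  qed
  have Wi: "norm (W \<sigma> s - \<xi> 0) \<le> \<rho> \<sigma>" if "good \<sigma>" "s \<in> {\<tau>..\<sigma>}" for \<sigma> s
  proof -
    note g = good[OF that(1)]
    let ?I = "integral {\<tau>..s} (\<lambda>s. B *v u \<sigma> s)"
    have "W \<sigma> \<tau> = \<xi> 0"
      using Q(4)[OF g(5), of \<tau>] \<tau> by (simp add: xe_def)
    then have "norm (W \<sigma> s - \<xi> 0 - ?I) \<le> rate * D * (s - \<tau>)"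
      using trajectory_short_increment[OF \<tau>'(2) g(3,4) Q(3)[OF g(5)] Wb[OF that(1)] that(2)] by simp
    also have "\<dots> \<le> rate * D * (\<sigma> - \<tau>)"
      using that X cU rate_pos T_pos by (intro mult_left_mono) (auto simp: D_def)
    finally have "norm (W \<sigma> s - \<xi> 0 - ?I) \<le> rate * D * (\<sigma> - \<tau>)" .
    moreover have "norm ?I \<le> cU * sqrt (\<sigma> - \<tau>)"
      unfolding cU_def by (rule control_short_bound[OF \<tau>'(2) g(1,4) Q(3,5)[OF g(5)] that(2) \<beta>])
    ultimately show ?thesis
      unfolding \<rho>_def using norm_triangle_ineq[of "W \<sigma> s - \<xi> 0 - ?I" ?I] by simp
  qed
  have Zb: "norm (Z \<sigma> s) \<le> \<zeta> \<sigma>" if "good \<sigma>" "s \<in> {0..\<sigma>}" for \<sigma> s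
  proof -
    note g = good[OF that(1)]
    have "norm (Z \<sigma> s) \<le> 2 * (0 + \<beta> * E * (\<sigma> - \<tau>))"
    proof (rule trajectory_short_bound[OF \<tau>'(2) g(3,4,8) Q(1)[OF g(5)]])
      show "norm (Z \<sigma> s) \<le> 0" if "s \<in> {0..\<tau>}" for s
        using Q(2)[OF g(5)] that by (simp add: null_past_def)
      show "norm (integral {\<tau>..t} (\<lambda>s. B *v v \<sigma> s)) \<le> \<beta> * E * (\<sigma> - \<tau>)" if t: "t \<in> {\<tau>..\<sigma>}" for t
      proof -
        have "norm (integral {\<tau>..t} (\<lambda>s. B *v v \<sigma> s)) \<le> integral {\<tau>..t} (\<lambda>_. \<beta> * E)"
        proof (rule integral_norm_bound_integral[OF control_integrable[OF trajectoryD(2)[OF Q(1)[OF g(5)]]]])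
          fix s
          have "norm (v \<sigma> s) \<le> E"
            using E(1) E(2)[OF g(6)] by (simp add: v_def)
          then show "norm (B *v v \<sigma> s) \<le> \<beta> * E"
            by (intro order_trans[OF \<beta>(2)] mult_left_mono \<beta>(1))
        qed (use t g in auto)
        also have "\<dots> = \<beta> * E * (t - \<tau>)"
          using t by simp
        also have "\<dots> \<le> \<beta> * E * (\<sigma> - \<tau>)"
          using t \<beta>(1) E(1) by (intro mult_left_mono) auto
        finally show ?thesis .
      qed
    qed (use that in auto)
    then show ?thesis
      by (simp add: \<zeta>_def)
  qed

  have LW: "((\<lambda>p. W (fst p) (snd p)) \<longlongrightarrow> \<xi> 0) (wedge \<tau>)"
  proof (rule LIM_zero_cancel, rule Lim_null_comparison[OF _ filterlim_wedge_fst[OF \<rho>]])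
    show "\<forall>\<^sub>F p in wedge \<tau>. norm (W (fst p) (snd p) - \<xi> 0) \<le> \<rho> (fst p)"
      using evw by eventually_elim (auto intro: Wi)
  qed
  have LZ: "((\<lambda>p. Z (fst p) (snd p)) \<longlongrightarrow> 0) (wedge \<tau>)"
  proof (rule Lim_null_comparison[OF _ filterlim_wedge_fst[OF \<zeta>]])
    show "\<forall>\<^sub>F p in wedge \<tau>. norm (Z (fst p) (snd p)) \<le> \<zeta> (fst p)"
      using evw by eventually_elim (use \<tau> in \<open>auto intro!: Zb\<close>)
  qed
  have Wxe: "norm (W \<sigma> r + (-1) *\<^sub>R xe r) \<le> \<rho> \<sigma>" if "good \<sigma>" "r \<in> {0..\<sigma>}" for \<sigma> r
  proof (cases "r \<le> \<tau>")
    case True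
    have "0 \<le> \<rho> \<sigma>"
      using Wi[OF that(1), of \<sigma>] good[OF that(1)] norm_ge_zero[of "W \<sigma> \<sigma> - \<xi> 0"] by (auto simp del: norm_ge_zero)
    then show ?thesis
      using True that Q(4)[OF good(5)[OF that(1)], of r] by simp
  next
    case False
    then show ?thesis
      using Wi[OF that(1), of r] that by (simp add: xe_def)
  qed
  have LdW: "((\<lambda>p. drift (W (fst p)) (snd p)) \<longlongrightarrow> drift xe \<tau>) (wedge \<tau>)"
  proof -
    have "((\<lambda>p. drift (W (fst p)) (snd p) - drift xe (snd p)) \<longlongrightarrow> 0) (wedge \<tau>)"
    proof (rule Lim_null_comparison)
      show "\<forall>\<^sub>F p in wedge \<tau>. norm (drift (W (fst p)) (snd p) - drift xe (snd p)) \<le> rate * \<rho> (fst p)"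
        using evw
      proof eventually_elim
        case (elim p)
        note g = good[of "fst p"]
        have s: "snd p \<in> {0..T}"
          using elim g \<tau> by auto
        have Wc: "continuous_on {0..T} (W (fst p))"
          using elim by (intro trajectoryD(1)[OF Q(3)] g) auto
        have "drift (W (fst p)) (snd p) - drift xe (snd p) = drift (\<lambda>r. W (fst p) r + (-1) *\<^sub>R xe r) (snd p)"
          by (subst drift_add_scaleR[OF Wc xe s]) simp
        also have "norm \<dots> \<le> rate * \<rho> (fst p)"
          using elim by (intro norm_drift_le[OF _ s] continuous_intros Wc xe Wxe) auto
        finally show ?case .
      qed
      have "((\<lambda>p. rate * \<rho> (fst p)) \<longlongrightarrow> rate * 0) (wedge \<tau>)"
        by (intro tendsto_intros filterlim_wedge_fst \<rho>)
      then show "((\<lambda>p. rate * \<rho> (fst p)) \<longlongrightarrow> 0) (wedge \<tau>)"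
        by simp
    qed
    from tendsto_add[OF this tendsto_wedge_snd[OF drift_continuous_on[OF xe] \<tau>'(2) \<tau>(2)]] show ?thesis
      by simp
  qed
  have LdZ: "((\<lambda>p. drift (Z (fst p)) (snd p)) \<longlongrightarrow> 0) (wedge \<tau>)"
  proof (rule Lim_null_comparison)
    show "\<forall>\<^sub>F p in wedge \<tau>. norm (drift (Z (fst p)) (snd p)) \<le> rate * \<zeta> (fst p)"
      using evw
    proof eventually_elim
      case (elim p)
      note g = good[of "fst p"]
      have s: "snd p \<in> {0..T}"
        using elim g \<tau> by auto
      show ?case
        using elim by (intro norm_drift_le[OF _ s] trajectoryD(1)[OF Q(1)] g Zb) auto
    qed
    have "((\<lambda>p. rate * \<zeta> (fst p)) \<longlongrightarrow> rate * 0) (wedge \<tau>)"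
      by (intro tendsto_intros filterlim_wedge_fst \<zeta>)
    then show "((\<lambda>p. rate * \<zeta> (fst p)) \<longlongrightarrow> 0) (wedge \<tau>)"
      by simp
  qed
  note Clim = bounded_linear.tendsto[OF matrix_vector_mul_bounded_linear[of C]]
  have Ld1: "(d1 \<longlongrightarrow> d1 \<tau>) (at_right \<tau>)"
    by (rule tendsto_at_right_continuous_on[OF d1_cont \<tau>'(2) \<tau>(2)])
  have Le: "(e \<longlongrightarrow> e \<tau>) (at_right \<tau>)"
    by (rule tendsto_at_right_continuous_on[OF e \<tau>'(2) \<tau>(2)])
  have Wc: "continuous_on {0..T} (W \<sigma>)" and Zc: "continuous_on {0..T} (Z \<sigma>)" if "good \<sigma>" for \<sigma>
    using trajectoryD(1)[OF Q(3)[OF good(5)[OF that]]] trajectoryD(1)[OF Q(1)[OF good(5)[OF that]]] by auto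

  have A1: "((\<lambda>\<sigma>. (1 / (\<sigma> - \<tau>)) *\<^sub>R integral {\<tau>..\<sigma>} (\<lambda>t. (C *v W \<sigma> t) \<bullet> y t)) \<longlongrightarrow> (C *v \<xi> 0) \<bullet> y \<tau>) (at_right \<tau>)"
  proof (rule tendsto_average)
    show "((\<lambda>p. (C *v W (fst p) (snd p)) \<bullet> y (snd p)) \<longlongrightarrow> (C *v \<xi> 0) \<bullet> y \<tau>) (wedge \<tau>)"
      by (intro tendsto_inner Clim LW tendsto_wedge_snd[OF y_cont] \<tau>' \<tau>)
    show "\<forall>\<^sub>F \<sigma> in at_right \<tau>. (\<lambda>t. (C *v W \<sigma> t) \<bullet> y t) integrable_on {\<tau>..\<sigma>}"
      using ev by eventually_elim (intro lin_integrable Wc good(7))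
  qed
  have A2: "((\<lambda>\<sigma>. (1 / (\<sigma> - \<tau>)) *\<^sub>R integral {\<tau>..\<sigma>} (\<lambda>t. d1 \<sigma> \<bullet> drift (W \<sigma>) t)) \<longlongrightarrow> d1 \<tau> \<bullet> drift xe \<tau>) (at_right \<tau>)"
  proof (rule tendsto_average)
    show "((\<lambda>p. d1 (fst p) \<bullet> drift (W (fst p)) (snd p)) \<longlongrightarrow> d1 \<tau> \<bullet> drift xe \<tau>) (wedge \<tau>)"
      by (intro tendsto_inner LdW filterlim_wedge_fst[OF Ld1])
    show "\<forall>\<^sub>F \<sigma> in at_right \<tau>. (\<lambda>t. d1 \<sigma> \<bullet> drift (W \<sigma>) t) integrable_on {\<tau>..\<sigma>}"
      using ev by eventually_elim
        (intro integrable_continuous_real continuous_intros continuous_on_subset[OF drift_continuous_on] Wc good(7))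
  qed
  have A3: "((\<lambda>\<sigma>. (1 / (\<sigma> - \<tau>)) *\<^sub>R integral {\<tau>..\<sigma>} (\<lambda>t. (C *v W \<sigma> t) \<bullet> (C *v Z \<sigma> t))) \<longlongrightarrow> 0) (at_right \<tau>)"
  proof (rule tendsto_average)
    have "((\<lambda>p. (C *v W (fst p) (snd p)) \<bullet> (C *v Z (fst p) (snd p))) \<longlongrightarrow> (C *v \<xi> 0) \<bullet> (C *v 0)) (wedge \<tau>)"
      by (intro tendsto_inner Clim LW LZ)
    then show "((\<lambda>p. (C *v W (fst p) (snd p)) \<bullet> (C *v Z (fst p) (snd p))) \<longlongrightarrow> 0) (wedge \<tau>)"
      by simp
    show "\<forall>\<^sub>F \<sigma> in at_right \<tau>. (\<lambda>t. (C *v W \<sigma> t) \<bullet> (C *v Z \<sigma> t)) integrable_on {\<tau>..\<sigma>}"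
      using ev by eventually_elim
        (intro integrable_continuous_real continuous_on_inner output_continuous_on Wc Zc good(7))
  qed
  have A4: "((\<lambda>\<sigma>. (1 / (\<sigma> - \<tau>)) *\<^sub>R integral {\<tau>..\<sigma>} (\<lambda>t. drift (Z \<sigma>) t + B *v e \<sigma>)) \<longlongrightarrow> B *v e \<tau>) (at_right \<tau>)"
  proof (rule tendsto_average)
    have "((\<lambda>p. drift (Z (fst p)) (snd p) + B *v e (fst p)) \<longlongrightarrow> 0 + B *v e \<tau>) (wedge \<tau>)"
      by (intro tendsto_add LdZ bounded_linear.tendsto[OF matrix_vector_mul_bounded_linear]
          filterlim_wedge_fst[OF Le])
    then show "((\<lambda>p. drift (Z (fst p)) (snd p) + B *v e (fst p)) \<longlongrightarrow> B *v e \<tau>) (wedge \<tau>)"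
      by simp
    show "\<forall>\<^sub>F \<sigma> in at_right \<tau>. (\<lambda>t. drift (Z \<sigma>) t + B *v e \<sigma>) integrable_on {\<tau>..\<sigma>}"
      using ev by eventually_elim (intro integrable_add integrable_const_ivl drift_integrable Zc good(7))
  qed
  have A5: "((\<lambda>\<sigma>. (1 / (\<sigma> - \<tau>)) *\<^sub>R integral {\<tau>..\<sigma>} (\<lambda>t. P1 t \<sigma> *v Z \<sigma> t)) \<longlongrightarrow> 0) (at_right \<tau>)"
  proof (rule tendsto_average)
    have "((\<lambda>p. P1 (snd p) (fst p) *v Z (fst p) (snd p)) \<longlongrightarrow> P1 \<tau> \<tau> *v 0) (wedge \<tau>)"
      by (intro bounded_bilinear.tendsto[OF bounded_bilinear_matrix_vector_mult]
          tendsto_wedge_triangle[OF P1_cont \<tau>] LZ)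
    then show "((\<lambda>p. P1 (snd p) (fst p) *v Z (fst p) (snd p)) \<longlongrightarrow> 0) (wedge \<tau>)"
      by simp
    show "\<forall>\<^sub>F \<sigma> in at_right \<tau>. (\<lambda>t. P1 t \<sigma> *v Z \<sigma> t) integrable_on {\<tau>..\<sigma>}"
      using ev
    proof eventually_elim
      case (elim \<sigma>)
      have "continuous_on {0..\<sigma>} (\<lambda>t. P1 t \<sigma> *v Z \<sigma> t)"
        using good[OF elim] by (intro past1_continuous continuous_on_subset[OF Zc[OF elim]]) auto
      then show ?case
        using \<tau> by (intro integrable_continuous_real) (auto elim: continuous_on_subset)
    qed
  qed
  have A6: "((\<lambda>\<sigma>. (1 / (\<sigma> - \<tau>)) *\<^sub>R integral {\<tau>..\<sigma>} (\<lambda>t. (\<xi> (\<sigma> - t) - W \<sigma> t) \<bullet> d2 t \<sigma>)) \<longlongrightarrow> 0) (at_right \<tau>)"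
  proof (rule tendsto_average)
    have "((\<lambda>p. \<xi> (fst p - snd p)) \<longlongrightarrow> \<xi> 0) (wedge \<tau>)"
    proof (rule continuous_on_tendsto_compose[OF \<xi>])
      have "((\<lambda>p. fst p - snd p) \<longlongrightarrow> \<tau> - \<tau>) (wedge \<tau>)"
        by (intro tendsto_diff tendsto_wedge_ident)
      then show "((\<lambda>p. fst p - snd p) \<longlongrightarrow> 0) (wedge \<tau>)"
        by simp
      show "\<forall>\<^sub>F p in wedge \<tau>. fst p - snd p \<in> {0..T}"
        using evw by eventually_elim (use \<tau> in \<open>auto simp: good_def\<close>)
    qed (use \<tau> in auto)
    then have "((\<lambda>p. (\<xi> (fst p - snd p) - W (fst p) (snd p)) \<bullet> d2 (snd p) (fst p)) \<longlongrightarrow> (\<xi> 0 - \<xi> 0) \<bullet> d2 \<tau> \<tau>) (wedge \<tau>)"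
      by (intro tendsto_inner tendsto_diff LW tendsto_wedge_triangle[OF d2_cont \<tau>])
    then show "((\<lambda>p. (\<xi> (fst p - snd p) - W (fst p) (snd p)) \<bullet> d2 (snd p) (fst p)) \<longlongrightarrow> 0) (wedge \<tau>)"
      by simp
    show "\<forall>\<^sub>F \<sigma> in at_right \<tau>. (\<lambda>t. (\<xi> (\<sigma> - t) - W \<sigma> t) \<bullet> d2 t \<sigma>) integrable_on {\<tau>..\<sigma>}"
      using ev
    proof eventually_elim
      case (elim \<sigma>)
      note g = good[OF elim]
      have "continuous_on {\<tau>..\<sigma>} (\<lambda>t. \<xi> (\<sigma> - t))"
        by (rule continuous_on_compose2[OF \<xi>]) (use \<tau> g in \<open>auto intro!: continuous_intros\<close>)
      moreover have "continuous_on {\<tau>..\<sigma>} (\<lambda>t. d2 t \<sigma>)"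
        using \<tau> by (intro continuous_on_subset[OF d2_continuous_on[OF g(6)]]) auto
      ultimately show ?case
        by (intro integrable_continuous_real continuous_on_inner continuous_on_diff continuous_on_subset[OF Wc[OF elim] g(7)])
    qed
  qed
  obtain p1 where p1: "0 < p1"
    "\<And>s \<sigma> x. 0 \<le> s \<Longrightarrow> s \<le> \<sigma> \<Longrightarrow> \<sigma> \<le> T \<Longrightarrow> norm (P1 s \<sigma> *v x) \<le> p1 * norm x"
    by (rule P1_bounded) blast
  obtain p2 where p2: "0 < p2"
    "\<And>s \<nu> \<sigma> x. 0 \<le> s \<Longrightarrow> s \<le> \<sigma> \<Longrightarrow> 0 \<le> \<nu> \<Longrightarrow> \<nu> \<le> \<sigma> \<Longrightarrow> \<sigma> \<le> T \<Longrightarrow> norm (P2 s \<nu> \<sigma> *v x) \<le> p2 * norm x"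
    by (rule P2_bounded) blast
  have Lpast: "((\<lambda>\<sigma>. past1 \<sigma> (W \<sigma>)) \<longlongrightarrow> past1 \<tau> xe) (at_right \<tau>)"
  proof -
    have "((\<lambda>\<sigma>. past1 \<sigma> (W \<sigma>) - past1 \<sigma> xe) \<longlongrightarrow> 0) (at_right \<tau>)"
    proof (rule Lim_null_comparison)
      show "\<forall>\<^sub>F \<sigma> in at_right \<tau>. norm (past1 \<sigma> (W \<sigma>) - past1 \<sigma> xe) \<le> p1 * \<rho> \<sigma> * \<sigma>"
        using ev
      proof eventually_elim
        case (elim \<sigma>)
        note g = good[OF elim]
        have sub: "{0..\<sigma>} \<subseteq> {0..T}"
          using g by auto
        note c = continuous_on_subset[OF Wc[OF elim] sub] continuous_on_subset[OF xe sub]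
        have "past1 \<sigma> (W \<sigma>) - past1 \<sigma> xe = past1 \<sigma> (\<lambda>s. W \<sigma> s + (-1) *\<^sub>R xe s)"
          by (subst past1_add[OF g(6) c]) simp
        also have "norm \<dots> \<le> (p1 * \<rho> \<sigma>) * (\<sigma> - 0)"
          unfolding past1_def
        proof (rule integral_bound)
          show "continuous_on {0..\<sigma>} (\<lambda>s. P1 s \<sigma> *v (W \<sigma> s + (-1) *\<^sub>R xe s))"
            by (intro past1_continuous g continuous_intros c)
          show "norm (P1 s \<sigma> *v (W \<sigma> s + (-1) *\<^sub>R xe s)) \<le> p1 * \<rho> \<sigma>" if "s \<in> {0..\<sigma>}" for s
            using that g p1(1) Wxe[OF elim that]
            by (intro order_trans[OF p1(2)] mult_left_mono) auto
        qed (use \<tau> g in auto)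
        finally show ?case
          by simp
      qed
      show "((\<lambda>\<sigma>. p1 * \<rho> \<sigma> * \<sigma>) \<longlongrightarrow> 0) (at_right \<tau>)"
        by (rule tendsto_eq_intros \<rho> refl | simp)+
    qed
    from tendsto_add[OF this tendsto_at_right_continuous_on[OF past1_moving_continuous[OF xe] \<tau>'(2) \<tau>(2)]]
    show ?thesis
      by simp
  qed
  have Lgain: "((\<lambda>\<sigma>. P0 \<sigma> *v W \<sigma> \<sigma> + past1 \<sigma> (W \<sigma>)) \<longlongrightarrow> P0 \<tau> *v \<xi> 0 + past1 \<tau> xe) (at_right \<tau>)"
    by (intro tendsto_add Lpast bounded_bilinear.tendsto[OF bounded_bilinear_matrix_vector_mult]
        tendsto_wedge_diagonal[OF LW] tendsto_at_right_continuous_on[OF P0_cont \<tau>'(2) \<tau>(2)])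
  have A7: "((\<lambda>\<sigma>. (past2 \<sigma> (W \<sigma>) (Z \<sigma>) + past2 \<sigma> (Z \<sigma>) (W \<sigma>)) / 2 / (\<sigma> - \<tau>)) \<longlongrightarrow> 0) (at_right \<tau>)"
  proof (rule Lim_null_comparison)
    show "\<forall>\<^sub>F \<sigma> in at_right \<tau>. norm ((past2 \<sigma> (W \<sigma>) (Z \<sigma>) + past2 \<sigma> (Z \<sigma>) (W \<sigma>)) / 2 / (\<sigma> - \<tau>)) \<le> T * (p2 * D * \<zeta> \<sigma>)"
      using ev
    proof eventually_elim
      case (elim \<sigma>)
      note g = good[OF elim]
      have bd: "\<bar>past2 \<sigma> (W \<sigma>) (Z \<sigma>)\<bar> \<le> (\<sigma> - \<tau>) * (T * (p2 * D * \<zeta> \<sigma>))"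
        "\<bar>past2 \<sigma> (Z \<sigma>) (W \<sigma>)\<bar> \<le> (\<sigma> - \<tau>) * (T * (p2 * D * \<zeta> \<sigma>))"
        by (rule past2_short[OF \<tau>'(2) g(3,4) Wc[OF elim] Zc[OF elim] Q(2)[OF g(5)] Wb[OF elim] Zb[OF elim] p2];
            assumption)+
      have 1: "\<bar>(r + s) / 2\<bar> \<le> c" if "\<bar>r\<bar> \<le> c" "\<bar>s\<bar> \<le> c" for r s c :: real
        using that by (simp add: abs_le_iff)
      have 2: "norm (r / h) \<le> c" if "\<bar>r\<bar> \<le> h * c" "0 < h" for r h c :: real
        using that by (simp add: abs_divide pos_divide_le_eq mult.commute)
      show ?case
        by (rule 2[OF 1[OF bd]]) (use g in simp)
    qed
    show "((\<lambda>\<sigma>. T * (p2 * D * \<zeta> \<sigma>)) \<longlongrightarrow> 0) (at_right \<tau>)"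
      by (rule tendsto_eq_intros \<zeta> refl | simp)+
  qed
  note A8 = kernel_quotient_tendsto[OF H1 \<tau>]

  define R where "R \<sigma> = (1 / (\<sigma> - \<tau>)) *\<^sub>R integral {\<tau>..\<sigma>} (\<lambda>t. (C *v W \<sigma> t) \<bullet> y t)
      - (1 / (\<sigma> - \<tau>)) *\<^sub>R integral {\<tau>..\<sigma>} (\<lambda>t. d1 \<sigma> \<bullet> drift (W \<sigma>) t)
      + (1 / (\<sigma> - \<tau>)) *\<^sub>R integral {\<tau>..\<sigma>} (\<lambda>t. (C *v W \<sigma> t) \<bullet> (C *v Z \<sigma> t))
      + (((1 / (\<sigma> - \<tau>)) *\<^sub>R integral {\<tau>..\<sigma>} (\<lambda>t. drift (Z \<sigma>) t + B *v e \<sigma>)) \<bullet> (P0 \<sigma> *v W \<sigma> \<sigma> + past1 \<sigma> (W \<sigma>))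
         + W \<sigma> \<sigma> \<bullet> ((1 / (\<sigma> - \<tau>)) *\<^sub>R integral {\<tau>..\<sigma>} (\<lambda>t. P1 t \<sigma> *v Z \<sigma> t))
         + (past2 \<sigma> (W \<sigma>) (Z \<sigma>) + past2 \<sigma> (Z \<sigma>) (W \<sigma>)) / 2 / (\<sigma> - \<tau>))
      + (1 / (\<sigma> - \<tau>)) *\<^sub>R integral {\<tau>..\<sigma>} (\<lambda>t. (\<xi> (\<sigma> - t) - W \<sigma> t) \<bullet> d2 t \<sigma>)
      + (1 / (\<sigma> - \<tau>)) * integral {0..\<tau>} (\<lambda>s. (\<xi> (\<sigma> - s) - \<xi> (\<tau> - s)) \<bullet> d2 s \<sigma>)" for \<sigma>
  have "(R \<longlongrightarrow> (C *v \<xi> 0) \<bullet> y \<tau> - d1 \<tau> \<bullet> drift xe \<tau> + 0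
      + ((B *v e \<tau>) \<bullet> (P0 \<tau> *v \<xi> 0 + past1 \<tau> xe) + \<xi> 0 \<bullet> 0 + 0) + 0
      + integral {0..\<tau>} (\<lambda>s. g s \<bullet> d2 (\<tau> - s) \<tau>)) (at_right \<tau>)"
    unfolding R_def
    by (intro tendsto_add tendsto_diff tendsto_inner A1 A2 A3 A4 A5 A6 A7 A8 Lgain tendsto_wedge_diagonal[OF LW])
  moreover have "((\<lambda>\<sigma>. (l \<sigma> (\<lambda>s. \<xi> (\<sigma> - s)) - l \<tau> (\<lambda>s. \<xi> (\<tau> - s))) / (\<sigma> - \<tau>) - R \<sigma>) \<longlongrightarrow> 0) (at_right \<tau>)"
  proof (rule Lim_null_comparison)
    show "\<forall>\<^sub>F \<sigma> in at_right \<tau>. norm ((l \<sigma> (\<lambda>s. \<xi> (\<sigma> - s)) - l \<tau> (\<lambda>s. \<xi> (\<tau> - s))) / (\<sigma> - \<tau>) - R \<sigma>) \<le> 2 * (\<sigma> - \<tau>)"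
      using ev
    proof eventually_elim
      case (elim \<sigma>)
      note g = good[OF elim] and q = Q[OF good(5)[OF elim]]
      have h: "0 < \<sigma> - \<tau>"
        using g by simp
      have past: "W \<sigma> s = \<xi> (\<tau> - s)" if "s \<in> {0..\<tau>}" for s
        using q(4)[OF that] that by (simp add: xe_def)
      have v: "v \<sigma> t = transpose B *v d1 \<sigma>" if "t < \<sigma>" for t
        using that by (simp add: v_def e_def)
      note est = increment_estimate[OF \<tau>(1) g(1,2) \<xi> q(3) past q(1) v q(6,7)]
      have Z\<sigma>: "Z \<sigma> \<sigma> = integral {\<tau>..\<sigma>} (\<lambda>t. drift (Z \<sigma>) t + B *v e \<sigma>)"
      proof -
        have "Z \<sigma> \<sigma> = Z \<sigma> \<tau> + integral {\<tau>..\<sigma>} (drift (Z \<sigma>)) + integral {\<tau>..\<sigma>} (\<lambda>s. B *v v \<sigma> s)"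
          using g by (intro trajectoryD(3)[OF q(1)]) auto
        moreover have "Z \<sigma> \<tau> = 0"
          using q(2) \<tau> by (simp add: null_past_def)
        moreover have "integral {\<tau>..\<sigma>} (\<lambda>s. B *v v \<sigma> s) = integral {\<tau>..\<sigma>} (\<lambda>s. B *v e \<sigma>)"
          by (rule integral_spike[of "{\<sigma>}"]) (auto simp: v_def)
        moreover have "integral {\<tau>..\<sigma>} (\<lambda>t. drift (Z \<sigma>) t + B *v e \<sigma>)
            = integral {\<tau>..\<sigma>} (drift (Z \<sigma>)) + integral {\<tau>..\<sigma>} (\<lambda>s. B *v e \<sigma>)"
          by (intro integral_add drift_integrable Zc elim g integrable_const_ivl)
        ultimately show ?thesis
          by simp
      qed
      have past1Z: "past1 \<sigma> (Z \<sigma>) = integral {\<tau>..\<sigma>} (\<lambda>t. P1 t \<sigma> *v Z \<sigma> t)"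
      proof -
        have c: "continuous_on {0..\<sigma>} (\<lambda>t. P1 t \<sigma> *v Z \<sigma> t)"
          using g by (intro past1_continuous continuous_on_subset[OF Zc[OF elim]]) auto
        have "integral {0..\<tau>} (\<lambda>t. P1 t \<sigma> *v Z \<sigma> t) + integral {\<tau>..\<sigma>} (\<lambda>t. P1 t \<sigma> *v Z \<sigma> t) = past1 \<sigma> (Z \<sigma>)"
          unfolding past1_def using \<tau> g
          by (intro Henstock_Kurzweil_Integration.integral_combine integrable_continuous_real c) auto
        moreover have "integral {0..\<tau>} (\<lambda>t. P1 t \<sigma> *v Z \<sigma> t) = integral {0..\<tau>} (\<lambda>_. 0)"
          using q(2) by (intro integral_cong) (simp add: null_past_def)
        ultimately show ?thesis
          by simp
      qed
      let ?S = "integral {\<tau>..\<sigma>} (\<lambda>t. (C *v W \<sigma> t) \<bullet> y t) - integral {\<tau>..\<sigma>} (\<lambda>t. d1 \<sigma> \<bullet> drift (W \<sigma>) t)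
         + integral {\<tau>..\<sigma>} (\<lambda>t. (C *v W \<sigma> t) \<bullet> (C *v Z \<sigma> t)) + b \<sigma> (W \<sigma>) (Z \<sigma>)
         + integral {\<tau>..\<sigma>} (\<lambda>s. (\<xi> (\<sigma> - s) - W \<sigma> s) \<bullet> d2 s \<sigma>)
         + integral {0..\<tau>} (\<lambda>s. (\<xi> (\<sigma> - s) - \<xi> (\<tau> - s)) \<bullet> d2 s \<sigma>)"
      have "R \<sigma> = ?S / (\<sigma> - \<tau>)"
        unfolding R_def b_def past1Z[symmetric] Z\<sigma>[symmetric]
        by (simp add: add_divide_distrib diff_divide_distrib)
      then have "norm ((l \<sigma> (\<lambda>s. \<xi> (\<sigma> - s)) - l \<tau> (\<lambda>s. \<xi> (\<tau> - s))) / (\<sigma> - \<tau>) - R \<sigma>)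
          = \<bar>(l \<sigma> (\<lambda>s. \<xi> (\<sigma> - s)) - l \<tau> (\<lambda>s. \<xi> (\<tau> - s))) - ?S\<bar> / (\<sigma> - \<tau>)"
        using h by (simp only: real_norm_def diff_divide_distrib[symmetric] abs_divide abs_of_pos)
      also have "\<dots> \<le> (2 * (\<sigma> - \<tau>)\<^sup>2) / (\<sigma> - \<tau>)"
        using h by (intro divide_right_mono est) auto
      also have "\<dots> = 2 * (\<sigma> - \<tau>)"
        using h by (simp add: power2_eq_square)
      finally show ?case .
    qed
    show "((\<lambda>\<sigma>. 2 * (\<sigma> - \<tau>)) \<longlongrightarrow> 0) (at_right \<tau>)"
      by (auto intro!: tendsto_eq_intros)
  qed
  ultimately have "((\<lambda>\<sigma>. ((l \<sigma> (\<lambda>s. \<xi> (\<sigma> - s)) - l \<tau> (\<lambda>s. \<xi> (\<tau> - s))) / (\<sigma> - \<tau>) - R \<sigma>) + R \<sigma>) \<longlongrightarrow>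
      0 + ((C *v \<xi> 0) \<bullet> y \<tau> - d1 \<tau> \<bullet> drift xe \<tau> + 0
      + ((B *v e \<tau>) \<bullet> (P0 \<tau> *v \<xi> 0 + past1 \<tau> xe) + \<xi> 0 \<bullet> 0 + 0) + 0
      + integral {0..\<tau>} (\<lambda>s. g s \<bullet> d2 (\<tau> - s) \<tau>))) (at_right \<tau>)"
    by (intro tendsto_add)
  then show ?thesis
    by (simp add: e_def)
qed

end

lemma H1_deriv_pairing_unique:
  fixes g g' c :: "real \<Rightarrow> 'a::euclidean_space"
  assumes g: "H1_deriv 0 T \<xi> g" and g': "H1_deriv 0 \<tau> \<xi> g'" and \<tau>: "0 < \<tau>" "\<tau> \<le> T"
    and c: "continuous_on {0..\<tau>} c"
  shows "integral {0..\<tau>} (\<lambda>s. g' s \<bullet> c s) = integral {0..\<tau>} (\<lambda>s. g s \<bullet> c s)"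
proof -
  have eq: "integral {0..\<beta>} (\<lambda>s. g' s \<bullet> c s) - integral {0..\<beta>} (\<lambda>s. g s \<bullet> c s) = 0" if "\<beta> \<in> {0..<\<tau>}" for \<beta>
  proof -
    have c\<beta>: "continuous_on {0..\<beta>} c"
      using that by (intro continuous_on_subset[OF c]) auto
    have "integral {0..\<beta>} (\<lambda>s. g' s \<bullet> c s) = integral {0..\<beta>} (\<lambda>s. g s \<bullet> c s)"
      using that \<tau> by (intro tendsto_unique[OF trivial_limit_at_right_real
          difference_quotient_tendsto[OF g' _ _ c\<beta>] difference_quotient_tendsto[OF g _ _ c\<beta>]]) auto
    then show ?thesis
      by simp
  qed
  have int: "(\<lambda>s. g' s \<bullet> c s) integrable_on {0..\<tau>}" "(\<lambda>s. g s \<bullet> c s) integrable_on {0..\<tau>}"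
    using \<tau> by (auto intro!: L2_continuous_integrable_on[OF H1_deriv_imp_integral(1)[OF g'] _ c]
        L2_continuous_integrable_on[OF H1_deriv_imp_integral(1)[OF g] _ c])
  have "continuous_on (closure {0..<\<tau>})
      (\<lambda>\<beta>. integral {0..\<beta>} (\<lambda>s. g' s \<bullet> c s) - integral {0..\<beta>} (\<lambda>s. g s \<bullet> c s))"
    unfolding closure_atLeastLessThan[OF \<tau>(1)]
    by (intro continuous_on_diff indefinite_integral_continuous_1 int)
  from continuous_constant_on_closure[OF this eq, of \<tau>] show ?thesis
    using \<tau> by simp
qed

lemma input_op_adj_eq:
  fixes B :: "real^'m::finite^'d::finite"
  shows "input_op_adj B \<tau> \<eta> = transpose B *v fst \<eta>"
proof -
  have ip: "M2_inner \<tau> (input_op B z) \<eta> = z \<bullet> (transpose B *v fst \<eta>)" for z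
  proof -
    have "M2_inner \<tau> (input_op B z) \<eta> = (B *v z) \<bullet> fst \<eta>"
      by (simp add: M2_inner_def L2_inner_def input_op_def)
    also have "\<dots> = z \<bullet> (transpose B *v fst \<eta>)"
      by (metis dot_lmul_matrix inner_commute transpose_matrix_vector)
    finally show ?thesis .
  qed
  show ?thesis
    unfolding input_op_adj_def hilbert_adjoint_def ip
    by (rule some_equality) (auto simp: vector_eq_ldot)
qed

context tracking_coefficients
begin

lemma l_moving_continuous:
  assumes "continuous_on {0..T} x"
  shows "continuous_on {0..T} (\<lambda>\<sigma>. l \<sigma> x)"
proof -
  have "continuous_on {(r, s). 0 \<le> r \<and> r \<le> s \<and> s \<le> T} (\<lambda>(r, s). x r \<bullet> d2 r s)"
    using d2_cont unfolding case_prod_beta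
    by (intro continuous_intros continuous_on_compose2[OF assms]) auto
  from continuous_on_integral_moving[OF this] show ?thesis
    unfolding l_def by (intro continuous_intros assms d1_cont)
qed

lemma l_reversed_continuous:
  assumes \<xi>: "continuous_on {0..T} \<xi>"
  shows "continuous_on {0..T} (\<lambda>\<sigma>. l \<sigma> (\<lambda>s. \<xi> (\<sigma> - s)))"
proof -
  have "continuous_on {(r, s). 0 \<le> r \<and> r \<le> s \<and> s \<le> T} (\<lambda>(r, s). \<xi> (s - r) \<bullet> d2 r s)"
    using d2_cont unfolding case_prod_beta
    by (intro continuous_intros continuous_on_compose2[OF \<xi>]) auto
  from continuous_on_integral_moving[OF this] show ?thesis
    unfolding l_def diff_self by (intro continuous_intros d1_cont)
qed

lemma d2_reversed_continuous: "\<sigma> \<in> {0..T} \<Longrightarrow> continuous_on {0..\<sigma>} (\<lambda>s. d2 (\<sigma> - s) \<sigma>)"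
  by (rule continuous_on_compose2[OF d2_continuous_on]) (auto intro!: continuous_intros)

lemma M2_inner_eq_l:
  assumes \<sigma>: "\<sigma> \<in> {0..T}" and \<xi>: "continuous_on {0..T} \<xi>"
  shows "M2_inner \<sigma> (d_state d1 d2 \<sigma>) (\<xi> 0, \<xi>) = l \<sigma> (\<lambda>s. \<xi> (\<sigma> - s))"
proof -
  have \<xi>\<sigma>: "continuous_on {0..\<sigma>} \<xi>"
    using \<sigma> by (intro continuous_on_subset[OF \<xi>]) auto
  have c: "continuous_on {0..\<sigma>} (\<lambda>s. d2 (\<sigma> - s) \<sigma> \<bullet> \<xi> s)"
    by (intro continuous_intros d2_reversed_continuous \<xi>\<sigma> \<sigma>)
  have "(LBINT s:{0..\<sigma>}. d2 (\<sigma> - s) \<sigma> \<bullet> \<xi> s) = integral {0..\<sigma>} (\<lambda>s. d2 (\<sigma> - s) \<sigma> \<bullet> \<xi> s)"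
    by (intro set_borel_integral_eq_integral(2) borel_integrable_atLeastAtMost' c)
  also have "\<dots> = integral {0..\<sigma>} (\<lambda>s. d2 (\<sigma> - (\<sigma> - s)) \<sigma> \<bullet> \<xi> (\<sigma> - s))"
    by (rule integral_reflect_interval[OF c, symmetric])
  finally show ?thesis
    by (simp add: M2_inner_def L2_inner_def d_state_def l_def inner_commute)
qed

lemma l_has_derivative:
  assumes H1: "H1_deriv 0 T \<xi> g" and \<tau>: "\<tau> \<in> {0<..<T}"
  shows "((\<lambda>\<sigma>. l \<sigma> (\<lambda>s. \<xi> (\<sigma> - s))) has_real_derivative
    (C *v \<xi> 0) \<bullet> y \<tau> - d1 \<tau> \<bullet> (A *v \<xi> 0 + integral {0..\<tau>} (\<lambda>s. N s *v \<xi> s))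
    + (B *v (transpose B *v d1 \<tau>)) \<bullet> (P0 \<tau> *v \<xi> 0 + integral {0..\<tau>} (\<lambda>s. P1 (\<tau> - s) \<tau> *v \<xi> s))
    + integral {0..\<tau>} (\<lambda>s. g s \<bullet> d2 (\<tau> - s) \<tau>)) (at \<tau>)"
proof -
  note \<xi> = H1_deriv_imp_continuous_on[OF H1]
  define F where "F \<tau> = (C *v \<xi> 0) \<bullet> y \<tau> - d1 \<tau> \<bullet> (A *v \<xi> 0 + integral {0..\<tau>} (\<lambda>s. N s *v \<xi> s))
    + (B *v (transpose B *v d1 \<tau>)) \<bullet> (P0 \<tau> *v \<xi> 0 + integral {0..\<tau>} (\<lambda>s. P1 (\<tau> - s) \<tau> *v \<xi> s))
    + integral {0..\<tau>} (\<lambda>s. g s \<bullet> d2 (\<tau> - s) \<tau>)" for \<tau>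
  have "((\<lambda>\<sigma>. l \<sigma> (\<lambda>s. \<xi> (\<sigma> - s))) has_real_derivative F \<tau>) (at \<tau>)"
  proof (rule continuous_right_derivative_imp_derivative[OF _ _ _ \<tau>])
    show "continuous_on {0<..<T} (\<lambda>\<sigma>. l \<sigma> (\<lambda>s. \<xi> (\<sigma> - s)))"
      by (rule continuous_on_subset[OF l_reversed_continuous[OF \<xi>]]) auto
    have "continuous_on ({0..T} \<times> {0..T}) (\<lambda>p. (\<lambda>(s, \<sigma>). d2 s \<sigma>) (max 0 (fst p - snd p), fst p))"
      by (rule continuous_on_compose2[OF d2_cont]) (auto intro!: continuous_intros)
    then have "continuous_on ({0..T} \<times> {0..T}) (\<lambda>(\<tau>, s). d2 (max 0 (\<tau> - s)) \<tau>)"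
      by (simp add: case_prod_beta)
    from continuous_on_integral_moving_L2[OF H1_deriv_imp_integral(1)[OF H1] this]
    have "continuous_on {0..T} (\<lambda>\<tau>. integral {0..\<tau>} (\<lambda>s. g s \<bullet> d2 (max 0 (\<tau> - s)) \<tau>))" .
    moreover have "integral {0..\<tau>} (\<lambda>s. g s \<bullet> d2 (max 0 (\<tau> - s)) \<tau>) = integral {0..\<tau>} (\<lambda>s. g s \<bullet> d2 (\<tau> - s) \<tau>)" for \<tau>
      by (intro integral_cong) auto
    ultimately have c1: "continuous_on {0..T} (\<lambda>\<tau>. integral {0..\<tau>} (\<lambda>s. g s \<bullet> d2 (\<tau> - s) \<tau>))"
      by simp
    have "continuous_on {(r, s). 0 \<le> r \<and> r \<le> s \<and> s \<le> T} (\<lambda>p. (\<lambda>(s, \<sigma>). P1 s \<sigma>) (snd p - fst p, snd p) *v \<xi> (fst p))"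
      by (intro continuous_intros continuous_on_compose2[OF P1_cont] continuous_on_compose2[OF \<xi>]) auto
    then have "continuous_on {(r, s). 0 \<le> r \<and> r \<le> s \<and> s \<le> T} (\<lambda>(r, s). P1 (s - r) s *v \<xi> r)"
      by (simp add: case_prod_beta)
    note c2 = continuous_on_integral_moving[OF this]
    have "(\<lambda>s. N s *v \<xi> s) integrable_on {0..T}"
      by (intro integrable_continuous_real continuous_intros N_cont \<xi>)
    note c3 = indefinite_integral_continuous_1[OF this]
    have "continuous_on {0..T} F"
      unfolding F_def by (intro continuous_intros y_cont d1_cont P0_cont c1 c2 c3)
    then show "continuous_on {0<..<T} F"
      by (rule continuous_on_subset) auto
    fix \<tau> assume \<tau>: "\<tau> \<in> {0<..<T}"
    let ?xe = "\<lambda>r. \<xi> (max 0 (\<tau> - r))"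
    have \<tau>': "\<tau> \<in> {0..T}" "{0..\<tau>} \<subseteq> {0..T}"
      using \<tau> by auto
    have cN: "continuous_on {0..\<tau>} (\<lambda>s. N s *v \<xi> s)"
      by (intro continuous_intros continuous_on_subset[OF N_cont] continuous_on_subset[OF \<xi>] \<tau>')
    have "integral {0..\<tau>} (\<lambda>r. N (\<tau> - r) *v ?xe r) = integral {0..\<tau>} (\<lambda>r. N (\<tau> - r) *v \<xi> (\<tau> - r))"
      by (intro integral_cong) auto
    then have 1: "drift ?xe \<tau> = A *v \<xi> 0 + integral {0..\<tau>} (\<lambda>s. N s *v \<xi> s)"
      unfolding drift_def using integral_reflect_interval[OF cN] by simp
    have "continuous_on {0..\<tau>} (\<lambda>s. P1 (\<tau> - s) \<tau>)"
      by (rule continuous_on_compose2[OF P1_continuous_on[OF \<tau>'(1)]]) (auto intro!: continuous_intros)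
    then have cP: "continuous_on {0..\<tau>} (\<lambda>s. P1 (\<tau> - s) \<tau> *v \<xi> s)"
      by (intro continuous_intros continuous_on_subset[OF \<xi>] \<tau>')
    have "past1 \<tau> ?xe = integral {0..\<tau>} (\<lambda>r. P1 (\<tau> - (\<tau> - r)) \<tau> *v \<xi> (\<tau> - r))"
      unfolding past1_def by (intro integral_cong) auto
    then have 2: "past1 \<tau> ?xe = integral {0..\<tau>} (\<lambda>s. P1 (\<tau> - s) \<tau> *v \<xi> s)"
      using integral_reflect_interval[OF cP] by simp
    show "((\<lambda>s. (l s (\<lambda>r. \<xi> (s - r)) - l \<tau> (\<lambda>r. \<xi> (\<tau> - r))) / (s - \<tau>)) \<longlongrightarrow> F \<tau>) (at_right \<tau>)"
      using l_right_derivative[OF H1, of \<tau>] \<tau> unfolding F_def 1 2 by auto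
  qed
  then show ?thesis
    unfolding F_def .
qed

lemma l_terminal:
  assumes x: "continuous_on {0..T} x"
  shows "l T x = 0"
proof -
  obtain X where X: "0 < X" "\<And>s. s \<in> {0..T} \<Longrightarrow> norm (x s) \<le> X"
    by (rule bounded_on_interval[OF x]) blast
  obtain Y where Y: "0 < Y" "\<And>s. s \<in> {0..T} \<Longrightarrow> norm (y s) \<le> Y"
    by (rule bounded_on_interval[OF y_cont]) blast
  obtain \<gamma> where \<gamma>: "\<And>v. norm (C *v v) \<le> norm v * \<gamma>" "0 \<le> \<gamma>"
    using bounded_linear.nonneg_bounded[OF matrix_vector_mul_bounded_linear] by blast
  define k where "k = (2 * X * \<gamma> + Y)\<^sup>2"
  have V_bound: "V \<sigma> (\<lambda>s. 0 + c *\<^sub>R x s) \<le> k * (T - \<sigma>)"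
    if \<sigma>: "\<sigma> \<in> {0<..<T}" "rate * (T - \<sigma>) \<le> 1 / 2" and c: "\<bar>c\<bar> = 1" for \<sigma> c
  proof -
    have \<sigma>': "\<sigma> \<in> {0..T}" "0 \<le> \<sigma>" "\<sigma> \<le> T"
      using \<sigma> by auto
    have cx: "continuous_on {0..\<sigma>} (\<lambda>s. 0 + c *\<^sub>R x s)"
      using \<sigma>' by (intro continuous_intros continuous_on_subset[OF x]) auto
    have "(\<lambda>_. 0) \<in> L2 \<sigma> T"
      by (rule continuous_on_imp_L2) simp
    then obtain W where W: "trajectory \<sigma> (\<lambda>_. 0) W" "\<And>s. s \<in> {0..\<sigma>} \<Longrightarrow> W s = 0 + c *\<^sub>R x s"
      by (rule trajectory_exists[OF \<sigma>'(1) _ cx]) blast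
    have Wb: "norm (W t) \<le> 2 * (X + 0)" if "t \<in> {0..T}" for t
      by (rule trajectory_short_bound[OF \<sigma>'(2,3) order_refl \<sigma>(2) W(1) _ _ that])
        (use W(2) X(2) c \<sigma>' in auto)
    have "V \<sigma> (\<lambda>s. 0 + c *\<^sub>R x s) \<le> J \<sigma> (\<lambda>_. 0) W"
      by (rule V_le_J[OF \<sigma>'(1) W])
    also have "\<dots> \<le> k * (T - \<sigma>)"
    proof (rule has_integral_le[OF J_eq_integral[OF \<sigma>'(2) W(1)]])
      show "((\<lambda>_. k) has_integral k * (T - \<sigma>)) {\<sigma>..T}"
        using has_integral_const_real[of k \<sigma> T] \<sigma>' by (simp add: mult.commute)
      fix t assume t: "t \<in> {\<sigma>..T}"
      have "norm (C *v W t - y t) \<le> norm (C *v W t) + norm (y t)"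
        by (rule norm_triangle_ineq4)
      also have "norm (C *v W t) \<le> (2 * X) * \<gamma>"
        using Wb[of t] t \<sigma>' \<gamma>(2) by (intro order_trans[OF \<gamma>(1)] mult_right_mono) auto
      also have "norm (y t) \<le> Y"
        using t \<sigma>' by (intro Y(2)) auto
      finally show "(norm (C *v W t - y t))\<^sup>2 + (norm 0)\<^sup>2 \<le> k"
        unfolding k_def by (simp add: power_mono)
    qed
    finally show ?thesis .
  qed
  have bound: "norm (l \<sigma> x) \<le> k * (T - \<sigma>)" if \<sigma>: "\<sigma> \<in> {0<..<T}" "rate * (T - \<sigma>) \<le> 1 / 2" for \<sigma>
  proof -
    have \<sigma>': "\<sigma> \<in> {0..T}" "0 \<le> k * (T - \<sigma>)"
      using \<sigma> by (auto simp: k_def)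
    have x\<sigma>: "continuous_on {0..\<sigma>} x"
      using \<sigma> by (intro continuous_on_subset[OF x]) auto
    have "0 \<le> V \<sigma> (\<lambda>s. 0 + c *\<^sub>R x s)" for c
      by (intro V_nonneg[OF \<sigma>'(1)] continuous_intros x\<sigma>)
    from this[of 1] this[of "-1"] V_bound[OF \<sigma>, of 1] V_bound[OF \<sigma>, of "-1"] \<sigma>'(2)
    show ?thesis
      unfolding V_zero_plus[OF \<sigma>(1) x\<sigma>] by (simp add: abs_le_iff)
  qed
  have "max 0 (T - 1 / (2 * rate)) < T"
    using T_pos rate_pos by simp
  from eventually_at_left_real[OF this]
  have "\<forall>\<^sub>F \<sigma> in at_left T. norm (l \<sigma> x) \<le> k * (T - \<sigma>)"
  proof eventually_elim
    case (elim \<sigma>)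
    have "T - \<sigma> \<le> 1 / (2 * rate)"
      using elim by simp
    then have "rate * (T - \<sigma>) \<le> rate * (1 / (2 * rate))"
      using rate_pos by (intro mult_left_mono) auto
    then show ?case
      using elim rate_pos by (intro bound) auto
  qed
  moreover have "((\<lambda>\<sigma>. k * (T - \<sigma>)) \<longlongrightarrow> 0) (at_left T)"
    by (auto intro!: tendsto_eq_intros)
  ultimately have "((\<lambda>\<sigma>. l \<sigma> x) \<longlongrightarrow> 0) (at_left T)"
    by (rule Lim_null_comparison)
  moreover have "((\<lambda>\<sigma>. l \<sigma> x) \<longlongrightarrow> l T x) (at_left T)"
    unfolding at_within_Icc_at_left[OF T_pos, symmetric]
    using l_moving_continuous[OF x] T_pos by (simp add: continuous_on_def)
  ultimately show ?thesis
    by (intro tendsto_unique[OF trivial_limit_at_left_real]) 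
qed

lemma d_state_terminal: "M2_is_zero T (d_state d1 d2 T)"
proof -
  have TT: "T \<in> {0..T}"
    using T_pos by simp
  note c = d2_continuous_on[OF TT]
  have "continuous_on {0..T} (\<lambda>s. (T - s) *\<^sub>R d2 s T)"
    by (intro continuous_intros c)
  from l_terminal[OF this] have "integral {0..T} (\<lambda>s. (T - s) * (d2 s T \<bullet> d2 s T)) = 0"
    by (simp add: l_def)
  moreover have "continuous_on {0..T} (\<lambda>s. (T - s) * (d2 s T \<bullet> d2 s T))"
    by (intro continuous_intros c)
  ultimately have "\<forall>s\<in>{0..T}. (T - s) * (d2 s T \<bullet> d2 s T) = 0"
    using integral_eq_0_iff[of 0 T "\<lambda>s. (T - s) * (d2 s T \<bullet> d2 s T)"] T_pos by simp
  then have d2: "d2 s T = 0" if "s \<in> {0..<T}" for s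
    using that by auto
  have "integral {0..T} (\<lambda>s. d1 T \<bullet> d2 s T) = integral {0..T} (\<lambda>_. 0)"
    by (rule integral_spike[of "{T}"]) (use d2 in auto)
  then have "d1 T = 0"
    using l_terminal[OF continuous_on_const, of "d1 T"] by (simp add: l_def)
  moreover have "AE s\<in>{0..T} in lborel. d2 (T - s) T = 0"
    using AE_lborel_singleton[of 0] by eventually_elim (use d2 in auto)
  ultimately show ?thesis
    by (simp add: M2_is_zero_def d_state_def)
qed

end

theorem mainTheorem3:
  fixes T :: real
    and A :: "real^'d::finite^'d"
    and B :: "real^'m::finite^'d"
    and C :: "real^'d^'p::finite"
    and N :: "real \<Rightarrow> real^'d^'d"
    and y :: "real \<Rightarrow> real^'p"
    and P0 :: "real \<Rightarrow> real^'d^'d"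
    and P1 :: "real \<Rightarrow> real \<Rightarrow> real^'d^'d"
    and P2 :: "real \<Rightarrow> real \<Rightarrow> real \<Rightarrow> real^'d^'d"
    and d1 :: "real \<Rightarrow> real^'d"
    and d2 :: "real \<Rightarrow> real \<Rightarrow> real^'d"
    and M :: "real \<Rightarrow> real"
    and \<xi>h :: "real^'d"
    and \<xi>t :: "real \<Rightarrow> real^'d"
  assumes "0 < T"
    and "continuous_on {0..T} N"
    and "continuous_on {0..T} y"
    and "value_coefficients T A B C N y P0 P1 P2 d1 d2 M"
    and "\<xi>t \<in> H1 0 T"
    and "\<xi>t 0 = \<xi>h"
  shows "(\<forall>\<tau>\<in>{0<..<T}.
           ((\<lambda>\<sigma>. M2_inner \<sigma> (d_state d1 d2 \<sigma>) (\<xi>h, \<xi>t)) has_real_derivative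
              - M2_inner \<tau> (d_state d1 d2 \<tau>)
                  (state_op A N \<tau> (\<xi>h, \<xi>t)
                   - input_op B (input_op_adj B \<tau> (riccati_op P0 P1 P2 \<tau> (\<xi>h, \<xi>t))))
              + y \<tau> \<bullet> output_op C (\<xi>h, \<xi>t)) (at \<tau>))
         \<and> M2_is_zero T (d_state d1 d2 T)"
proof (intro conjI ballI)
  interpret tracking_coefficients T A B C N y P0 P1 P2 d1 d2 M
    by unfold_locales (use assms in auto)
  show "M2_is_zero T (d_state d1 d2 T)"
    by (rule d_state_terminal)
  obtain g where g: "H1_deriv 0 T \<xi>t g"
    using assms(5) by (auto simp: H1_def)
  note \<xi> = H1_deriv_imp_continuous_on[OF g]
  fix \<tau> assume \<tau>: "\<tau> \<in> {0<..<T}"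
  then have \<tau>': "\<tau> \<in> {0..T}" "0 < \<tau>" "\<tau> \<le> T" "{0..\<tau>} \<subseteq> {0..T}"
    by auto
  let ?g = "weak_deriv 0 \<tau> \<xi>t"
  have "\<exists>g. H1_deriv 0 \<tau> \<xi>t g"
    using H1_subinterval[OF assms(5) \<tau>'(3)] by (simp add: H1_def)
  then have wd: "H1_deriv 0 \<tau> \<xi>t ?g"
    unfolding weak_deriv_def by (rule someI_ex)
  have conv: "(LBINT s:{0..\<tau>}. f s) = integral {0..\<tau>} f" if "continuous_on {0..\<tau>} f"
    for f :: "real \<Rightarrow> real^'d"
    by (intro set_borel_integral_eq_integral(2) borel_integrable_atLeastAtMost' that)
  have N: "(LBINT s:{0..\<tau>}. N s *v \<xi>t s) = integral {0..\<tau>} (\<lambda>s. N s *v \<xi>t s)"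
    by (intro conv continuous_intros continuous_on_subset[OF N_cont] continuous_on_subset[OF \<xi>] \<tau>')
  have "continuous_on {0..\<tau>} (\<lambda>s. P1 (\<tau> - s) \<tau>)"
    by (rule continuous_on_compose2[OF P1_continuous_on[OF \<tau>'(1)]]) (auto intro!: continuous_intros)
  then have P1: "P1_op P1 \<tau> \<xi>t = integral {0..\<tau>} (\<lambda>s. P1 (\<tau> - s) \<tau> *v \<xi>t s)"
    unfolding P1_op_def by (intro conv continuous_intros continuous_on_subset[OF \<xi>] \<tau>')
  have "set_integrable lborel {0..\<tau>} (\<lambda>s. ?g s \<bullet> d2 (\<tau> - s) \<tau>)"
    by (intro L2_inner_set_integrable H1_deriv_imp_integral(1)[OF wd] continuous_on_imp_L2
        d2_reversed_continuous \<tau>')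
  from set_borel_integral_eq_integral(2)[OF this]
  have "(LBINT s:{0..\<tau>}. ?g s \<bullet> d2 (\<tau> - s) \<tau>) = integral {0..\<tau>} (\<lambda>s. ?g s \<bullet> d2 (\<tau> - s) \<tau>)" .
  also have "\<dots> = integral {0..\<tau>} (\<lambda>s. g s \<bullet> d2 (\<tau> - s) \<tau>)"
    by (rule H1_deriv_pairing_unique[OF g wd \<tau>'(2,3) d2_reversed_continuous[OF \<tau>'(1)]])
  finally have g2: "L2_inner 0 \<tau> (\<lambda>s. d2 (\<tau> - s) \<tau>) (\<lambda>s. - ?g s) = - integral {0..\<tau>} (\<lambda>s. g s \<bullet> d2 (\<tau> - s) \<tau>)"
    by (simp add: L2_inner_def inner_commute set_lebesgue_integral_def)
  have adj: "d1 \<tau> \<bullet> (B *v (transpose B *v z)) = (B *v (transpose B *v d1 \<tau>)) \<bullet> z" for z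
    by (metis dot_lmul_matrix inner_commute transpose_matrix_vector)
  have snd: "snd (state_op A N \<tau> (\<xi>h, \<xi>t) - input_op B v) = (\<lambda>s. - ?g s)" for v
    by (simp add: state_op_def input_op_def fun_eq_iff)
  have "- M2_inner \<tau> (d_state d1 d2 \<tau>)
        (state_op A N \<tau> (\<xi>h, \<xi>t) - input_op B (input_op_adj B \<tau> (riccati_op P0 P1 P2 \<tau> (\<xi>h, \<xi>t))))
      + y \<tau> \<bullet> output_op C (\<xi>h, \<xi>t)
    = (C *v \<xi>t 0) \<bullet> y \<tau> - d1 \<tau> \<bullet> (A *v \<xi>t 0 + integral {0..\<tau>} (\<lambda>s. N s *v \<xi>t s))
      + (B *v (transpose B *v d1 \<tau>)) \<bullet> (P0 \<tau> *v \<xi>t 0 + integral {0..\<tau>} (\<lambda>s. P1 (\<tau> - s) \<tau> *v \<xi>t s))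
      + integral {0..\<tau>} (\<lambda>s. g s \<bullet> d2 (\<tau> - s) \<tau>)"
    unfolding M2_inner_def snd input_op_adj_eq adj[symmetric]
    by (simp add: d_state_def state_op_def input_op_def output_op_def riccati_op_def N P1 g2 assms(6)
        inner_diff_right inner_commute)
  moreover have "((\<lambda>\<sigma>. M2_inner \<sigma> (d_state d1 d2 \<sigma>) (\<xi>h, \<xi>t)) has_real_derivative
      (C *v \<xi>t 0) \<bullet> y \<tau> - d1 \<tau> \<bullet> (A *v \<xi>t 0 + integral {0..\<tau>} (\<lambda>s. N s *v \<xi>t s))
      + (B *v (transpose B *v d1 \<tau>)) \<bullet> (P0 \<tau> *v \<xi>t 0 + integral {0..\<tau>} (\<lambda>s. P1 (\<tau> - s) \<tau> *v \<xi>t s))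
      + integral {0..\<tau>} (\<lambda>s. g s \<bullet> d2 (\<tau> - s) \<tau>)) (at \<tau>)"
  proof (rule has_field_derivative_transform_within_open[OF l_has_derivative[OF g \<tau>] open_greaterThanLessThan \<tau>])
    fix \<sigma> assume "\<sigma> \<in> {0<..<T}"
    then show "l \<sigma> (\<lambda>s. \<xi>t (\<sigma> - s)) = M2_inner \<sigma> (d_state d1 d2 \<sigma>) (\<xi>h, \<xi>t)"
      using M2_inner_eq_l[OF _ \<xi>, of \<sigma>] assms(6) by simp
  qed
  ultimately show "((\<lambda>\<sigma>. M2_inner \<sigma> (d_state d1 d2 \<sigma>) (\<xi>h, \<xi>t)) has_real_derivative
      - M2_inner \<tau> (d_state d1 d2 \<tau>)
          (state_op A N \<tau> (\<xi>h, \<xi>t) - input_op B (input_op_adj B \<tau> (riccati_op P0 P1 P2 \<tau> (\<xi>h, \<xi>t))))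
      + y \<tau> \<bullet> output_op C (\<xi>h, \<xi>t)) (at \<tau>)"
    by (simp only:)
qed

end
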